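(* Let $\delta\in(0,1)$, $n\in\mathbb N$, and let $\lambda\in(0,s]$ satisfy $$\mathcal B_{n,\lambda}\log\left(\tfrac{2}{\delta}\right)\le \tfrac{\sqrt\lambda}{2},\qquad \mathcal B_{n,\lambda}:=2\left(\frac{2b\kappa^2}{\sqrt\lambda\,n}+\sqrt{\frac{b\kappa^2\mathcal N(\lambda)}{n}}\right).$$ Assume: (1) $k(x,x)\le\kappa^2$ for all $x\in X$; (2) $dq_X=\beta\,dp_X$ with $0\le\beta(x)\le b$ for all $x\in X$; (3) $\|y\|_Y\le M'$ for $p$-almost every $(x,y)$; (4) $f^*=C_*\phi(\cdot)$ with $C_*=C_o\,\varphi(C_X)$ for some $C_o\in\mathcal S_2(\mathcal H,Y)$ and an index function $\varphi$. Assume further that the qualification $\nu$ of the regularization family $\{g_\lambda\}$ covers the index function $\varphi$, with covering constant $c$. Then, with probability at least $1-\delta$ over the i.i.d. sample $\mathbf z$ from $p$, $$\big\|f^*-\widehat f_{\mathbf z,\lambda}\big\|_{\mathcal G}\le\left(\frac{A_1}{n\lambda}+A_2\sqrt{\frac{\mathcal N(\lambda)}{n\lambda}}\right)\log\left(\frac2\delta\right)+A_3\,\varphi(\lambda),$$ where, with $\bar\nu:=\lfloor\nu\rfloor$ and $M:=M'+\kappa\|C_*\|_{\mathcal S_2(\mathcal H,Y)}$, $$A_1=2^{2\nu-\bar\nu+2}(\gamma_\nu+\gamma)\max\left(1,\tfrac1c\right)\bar\nu\,b\,\kappa^2\|C_*\|_{\mathcal S_2(\mathcal H,Y)}+2\sqrt{10}\,b\,M\,\kappa\,(B+D),$$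 $$A_2=2^{2\nu-\bar\nu+1}(\gamma_\nu+\gamma)\max\left(1,\tfrac1c\right)\bar\nu\,\sqrt b\,\kappa\,\|C_*\|_{\mathcal S_2(\mathcal H,Y)}+\sqrt{10}\,\sqrt b\,M\,(B+D),$$ $$A_3=2^{2\nu-\bar\nu}(\gamma_\nu+\gamma)\max\left(1,\tfrac1c\right)\|C_o\|_{\mathcal S_2(\mathcal H,Y)}.$$
   Context: Spaces. $X$ is a second-countable locally compact Hausdorff space and $Y$ an infinite-dimensional real separable Hilbert space. $k:X\times X\to\mathbb R$ is the reproducing kernel of a separable scalar RKHS $\mathcal H$, with measurable feature map $\phi(x)=k(x,\cdot)\in\mathcal H$. $\mathcal S_2(\mathcal H,Y)$ is the space of Hilbert–Schmidt operators $\mathcal H\to Y$; $\|\cdot\|_{op}$ is the operator norm; $a\otimes a'$ denotes the operator $v\mapsto\langle v,a'\rangle a$. (Note: $\phi$ is the feature map, $\varphi$ an index function.) $\mathcal G$ is the vector-valued RKHS of functions $X\to Y$ with operator-valued kernel $K(x,t)=k(x,t)\,Id_Y$; equivalently $\mathcal G=\{C\phi(\cdot):C\in\mathcal S_2(\mathcal H,Y)\}$ with $\|C\phi(\cdot)\|_{\mathcal G}=\|C\|_{\mathcal S_2(\mathcal H,Y)}$. Data (covariate shift). $p$ and $q$ are probability distributions on $X\times Y$ with the same conditional distribution $p(y|x)$ and marginals $p_X,q_X$ on $X$, i.e. $p(x,y)=p(y|x)p_X(x)$, $q(x,y)=p(y|x)q_X(x)$. The common regression function is $f^*(x)=\int_Y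 y\,dp(y|x)$. The sample $\mathbf z=\{(x_i,y_i)\}_{i=1}^n$ is i.i.d. from $p$. The weight function $\beta=dq_X/dp_X:X\to[0,\infty)$ is known exactly. Operators. $C_X=\mathbb E_{x\sim q_X}[\phi(x)\otimes\phi(x)]=\mathbb E_{x\sim p_X}[\beta(x)\,\phi(x)\otimes\phi(x)]$ on $\mathcal H$; $\widehat C_X^\beta=\frac1n\sum_{i=1}^n\beta(x_i)\phi(x_i)\otimes\phi(x_i)$; $\widehat C_{YX}^\beta=\frac1n\sum_{i=1}^n\beta(x_i)\,y_i\otimes\phi(x_i)$. Effective dimension: $\mathcal N(\lambda)=\mathrm{Tr}\big(C_X(C_X+\lambda I)^{-1}\big)$. Regularization family. A family of functions $g_\lambda:[0,s]\to\mathbb R$, $0<\lambda\le s$ (with $s\ge b\kappa^2$, so that $g_\lambda(\widehat C_X^\beta)$ is defined by functional calculus), with constants $B,D,\gamma>0$ independent of $\lambda$ such that $\sup_{\sigma\in(0,s]}|\sigma g_\lambda(\sigma)|\le D$, $\sup_{\sigma\in(0,s]}|g_\lambda(\sigma)|\le B/\lambda$, $\sup_{\sigma\in(0,s]}|1-\sigma g_\lambda(\sigma)|\le\gamma$. Its qualification is the largest $\nu>0$ for which $\sup_{\sigma\in(0,s]}|1-\sigma g_\lambda(\sigma)|\sigma^\nu\le\gamma_\nu\lambda^\nu$ with $\gamma_\nu$ independent of $\lambda$. Index function: a continuous strictly increasing $\varphi:[0,\infty)\to[0,\infty)$ with $\varphi(0)=0$. The qualification $\nu$ covers an index function $\psi$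 (with constant $c>0$) if $c\,\frac{t^\nu}{\psi(t)}\le\inf_{t\le\sigma\le s}\frac{\sigma^\nu}{\psi(\sigma)}$ for all $0<t\le s$. Estimator: $\widehat f_{\mathbf z,\lambda}(x)=\widehat C_\lambda^\beta\phi(x)$ with $\widehat C_\lambda^\beta=\widehat C_{YX}^\beta\,g_\lambda(\widehat C_X^\beta)$. *)

theory Defs
  imports "HOL-Probability.Probability"
begin

section \<open>Operators between real Hilbert spaces\<close>

definition is_onb :: "'a::real_inner set \<Rightarrow> bool" where
  "is_onb E \<longleftrightarrow> (\<forall>e\<in>E. norm e = 1) \<and> pairwise orthogonal E \<and> closure (span E) = UNIV"

text \<open>Hilbert-Schmidt norms and traces are computed in one fixed orthonormal basis. As usual,
  finiteness and value of the Hilbert-Schmidt norm do not depend on the choice, nor does the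
  trace of a trace class operator.\<close>

definition some_onb :: "'a::real_inner set" where
  "some_onb = (SOME E. is_onb E)"

definition hilbert_schmidt :: "('a::real_inner \<Rightarrow>\<^sub>L 'b::real_inner) \<Rightarrow> bool" where
  "hilbert_schmidt T \<longleftrightarrow> (\<lambda>e. (norm (blinfun_apply T e))\<^sup>2) summable_on some_onb"

definition hs_norm :: "('a::real_inner \<Rightarrow>\<^sub>L 'b::real_inner) \<Rightarrow> real" where
  "hs_norm T = sqrt (\<Sum>\<^sub>\<infinity>e\<in>some_onb. (norm (blinfun_apply T e))\<^sup>2)"

definition op_trace :: "('a::real_inner \<Rightarrow>\<^sub>L 'a) \<Rightarrow> real" where
  "op_trace T = (\<Sum>\<^sub>\<infinity>e\<in>some_onb. blinfun_apply T e \<bullet> e)"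

definition op_inverse :: "('a::real_inner \<Rightarrow>\<^sub>L 'a) \<Rightarrow> ('a \<Rightarrow>\<^sub>L 'a)" where
  "op_inverse T = (THE S. T o\<^sub>L S = id_blinfun \<and> S o\<^sub>L T = id_blinfun)"

definition tensor_op :: "'b::real_inner \<Rightarrow> 'a::real_inner \<Rightarrow> ('a \<Rightarrow>\<^sub>L 'b)" where
  "tensor_op a a' = Blinfun (\<lambda>v. (v \<bullet> a') *\<^sub>R a)"

text \<open>Functional calculus for an operator with an orthonormal basis of eigenvectors, i.e. in
  particular for compact self-adjoint operators:
  \<open>f(A)\<close> is diagonal in such a basis, with the eigenvalues transformed by f. For a unit
  eigenvector e the eigenvalue is \<open>A e \<bullet> e\<close>. The result does not depend on the chosen
  eigenbasis; only the values of f on the eigenvalues matter.\<close>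

definition eigenbasis :: "('a::real_inner \<Rightarrow>\<^sub>L 'a) \<Rightarrow> 'a set" where
  "eigenbasis A = (SOME E. is_onb E \<and> (\<forall>e\<in>E. \<exists>\<mu>. blinfun_apply A e = \<mu> *\<^sub>R e))"

definition op_fun :: "(real \<Rightarrow> real) \<Rightarrow> ('a::real_inner \<Rightarrow>\<^sub>L 'a) \<Rightarrow> ('a \<Rightarrow>\<^sub>L 'a)" where
  "op_fun f A = Blinfun (\<lambda>v. \<Sum>\<^sub>\<infinity>e\<in>eigenbasis A. (f (blinfun_apply A e \<bullet> e) * (v \<bullet> e)) *\<^sub>R e)"

text \<open>The expectation of a random operator is taken pointwise, as a Bochner integral in the target
  space: the library's Bochner integral needs a separable target, which the space of bounded
  operators is not. Since evaluation at a vector is continuous and linear, this agrees with the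
  Bochner integral in the Hilbert-Schmidt operators whenever the latter exists.\<close>

definition op_expectation ::
  "'x measure \<Rightarrow> ('x \<Rightarrow> ('a::real_normed_vector \<Rightarrow>\<^sub>L 'b::{banach, second_countable_topology})) \<Rightarrow> ('a \<Rightarrow>\<^sub>L 'b)"
  where "op_expectation m T = Blinfun (\<lambda>v. \<integral>x. blinfun_apply (T x) v \<partial>m)"

section \<open>Reproducing kernel Hilbert spaces\<close>

text \<open>A Hilbert space of functions is represented by a Hilbert space type \<open>'g\<close> and an
  injective map \<open>rep\<close> sending a vector to the function it stands for, so that the function space is
  \<open>range rep\<close> with the transported Hilbert space structure. The reproducing property is
  \<open>\<langle>f(x), y\<rangle> = \<langle>f, K(\<cdot>, x) y\<rangle>\<close>; it forces \<open>rep\<close> to be linear. A scalar kernel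
  \<open>k\<close> is the case \<open>'y = real\<close>, \<open>K = k Id\<close>.\<close>

definition is_rkhs ::
  "('x \<Rightarrow> 'x \<Rightarrow> ('y::real_inner \<Rightarrow>\<^sub>L 'y)) \<Rightarrow> ('g::{real_inner, complete_space} \<Rightarrow> 'x \<Rightarrow> 'y) \<Rightarrow> bool"
  where
  "is_rkhs K rep \<longleftrightarrow> inj rep \<and>
     (\<forall>x y. (\<lambda>t. blinfun_apply (K t x) y) \<in> range rep) \<and>
     (\<forall>g x y. rep g x \<bullet> y = g \<bullet> inv rep (\<lambda>t. blinfun_apply (K t x) y))"

definition kernel_Id :: "('x \<Rightarrow> 'x \<Rightarrow> real) \<Rightarrow> 'x \<Rightarrow> 'x \<Rightarrow> ('y::real_inner \<Rightarrow>\<^sub>L 'y)" where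
  "kernel_Id k x t = k x t *\<^sub>R id_blinfun"

definition rkhs_norm :: "('g::real_inner \<Rightarrow> 'x \<Rightarrow> 'y) \<Rightarrow> ('x \<Rightarrow> 'y) \<Rightarrow> real" where
  "rkhs_norm rep f = norm (inv rep f)"

definition feature :: "('x \<Rightarrow> 'x \<Rightarrow> real) \<Rightarrow> ('h \<Rightarrow> 'x \<Rightarrow> real) \<Rightarrow> 'x \<Rightarrow> 'h" where
  "feature k rep x = inv rep (k x)"

section \<open>Covariate shift\<close>

definition marginal_X :: "('x::topological_space \<times> 'y) measure \<Rightarrow> 'x measure" where
  "marginal_X p = distr p borel fst"

definition joint_measure ::
  "'x::topological_space measure \<Rightarrow> ('x \<Rightarrow> 'y::topological_space measure) \<Rightarrow> ('x \<times> 'y) measure"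
  where "joint_measure m \<rho> = m \<bind> (\<lambda>x. distr (\<rho> x) borel (\<lambda>y. (x, y)))"

definition covariate_shift ::
  "('x::topological_space \<times> 'y::topological_space) measure \<Rightarrow> ('x \<times> 'y) measure \<Rightarrow> ('x \<Rightarrow> 'y measure) \<Rightarrow> bool"
  where
  "covariate_shift p q \<rho> \<longleftrightarrow>
     prob_space p \<and> sets p = sets borel \<and>
     prob_space q \<and> sets q = sets borel \<and>
     \<rho> \<in> borel \<rightarrow>\<^sub>M prob_algebra borel \<and>
     p = joint_measure (marginal_X p) \<rho> \<and>
     q = joint_measure (marginal_X q) \<rho>"

definition regression_fun ::
  "('x \<Rightarrow> 'y::{banach, second_countable_topology} measure) \<Rightarrow> 'x \<Rightarrow> 'y" where
  "regression_fun \<rho> x = (\<integral>y. y \<partial>\<rho> x)"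

section \<open>Covariance operators and the estimator\<close>

definition cov_op ::
  "'x measure \<Rightarrow> ('x \<Rightarrow> 'h::{real_inner, banach, second_countable_topology}) \<Rightarrow> ('h \<Rightarrow>\<^sub>L 'h)" where
  "cov_op m \<phi> = op_expectation m (\<lambda>x. tensor_op (\<phi> x) (\<phi> x))"

definition eff_dim :: "('h::real_inner \<Rightarrow>\<^sub>L 'h) \<Rightarrow> real \<Rightarrow> real" where
  "eff_dim C lam = op_trace (C o\<^sub>L op_inverse (C + lam *\<^sub>R id_blinfun))"

text \<open>A sample of size n is a function on the natural numbers of which only the values below n
  are used.\<close>

definition emp_cov_X ::
  "nat \<Rightarrow> ('x \<Rightarrow> real) \<Rightarrow> ('x \<Rightarrow> 'h::real_inner) \<Rightarrow> (nat \<Rightarrow> 'x \<times> 'y) \<Rightarrow> ('h \<Rightarrow>\<^sub>L 'h)" where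
  "emp_cov_X n \<beta> \<phi> z =
     (1 / real n) *\<^sub>R (\<Sum>i<n. \<beta> (fst (z i)) *\<^sub>R tensor_op (\<phi> (fst (z i))) (\<phi> (fst (z i))))"

definition emp_cov_YX ::
  "nat \<Rightarrow> ('x \<Rightarrow> real) \<Rightarrow> ('x \<Rightarrow> 'h::real_inner) \<Rightarrow> (nat \<Rightarrow> 'x \<times> 'y::real_inner) \<Rightarrow> ('h \<Rightarrow>\<^sub>L 'y)" where
  "emp_cov_YX n \<beta> \<phi> z =
     (1 / real n) *\<^sub>R (\<Sum>i<n. \<beta> (fst (z i)) *\<^sub>R tensor_op (snd (z i)) (\<phi> (fst (z i))))"

definition estimator ::
  "(real \<Rightarrow> real \<Rightarrow> real) \<Rightarrow> real \<Rightarrow> nat \<Rightarrow> ('x \<Rightarrow> real) \<Rightarrow> ('x \<Rightarrow> 'h::real_inner) \<Rightarrow>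
     (nat \<Rightarrow> 'x \<times> 'y::real_inner) \<Rightarrow> 'x \<Rightarrow> 'y" where
  "estimator g lam n \<beta> \<phi> z x =
     blinfun_apply (emp_cov_YX n \<beta> \<phi> z o\<^sub>L op_fun (g lam) (emp_cov_X n \<beta> \<phi> z)) (\<phi> x)"

section \<open>Regularization families and index functions\<close>

text \<open>Functions on \<open>[0,s]\<close> or \<open>[0,\<infinity>)\<close> are total here; values outside these intervals are
  unconstrained.\<close>

definition regularization_family ::
  "real \<Rightarrow> (real \<Rightarrow> real \<Rightarrow> real) \<Rightarrow> real \<Rightarrow> real \<Rightarrow> real \<Rightarrow> bool" where
  "regularization_family s g B D \<gamma> \<longleftrightarrow> 0 < B \<and> 0 < D \<and> 0 < \<gamma> \<and>
     (\<forall>lam\<in>{0<..s}. \<forall>\<sigma>\<in>{0<..s}.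
        \<bar>\<sigma> * g lam \<sigma>\<bar> \<le> D \<and> \<bar>g lam \<sigma>\<bar> \<le> B / lam \<and> \<bar>1 - \<sigma> * g lam \<sigma>\<bar> \<le> \<gamma>)"

definition qualification_bound ::
  "real \<Rightarrow> (real \<Rightarrow> real \<Rightarrow> real) \<Rightarrow> real \<Rightarrow> real \<Rightarrow> bool" where
  "qualification_bound s g \<nu> \<gamma>\<^sub>\<nu> \<longleftrightarrow>
     (\<forall>lam\<in>{0<..s}. \<forall>\<sigma>\<in>{0<..s}. \<bar>1 - \<sigma> * g lam \<sigma>\<bar> * \<sigma> powr \<nu> \<le> \<gamma>\<^sub>\<nu> * lam powr \<nu>)"

definition is_qualification ::
  "real \<Rightarrow> (real \<Rightarrow> real \<Rightarrow> real) \<Rightarrow> real \<Rightarrow> bool" where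
  "is_qualification s g \<nu> \<longleftrightarrow> 0 < \<nu> \<and> (\<exists>\<gamma>'. qualification_bound s g \<nu> \<gamma>') \<and>
     (\<forall>\<nu>'>0. (\<exists>\<gamma>'. qualification_bound s g \<nu>' \<gamma>') \<longrightarrow> \<nu>' \<le> \<nu>)"

definition index_function :: "(real \<Rightarrow> real) \<Rightarrow> bool" where
  "index_function \<psi> \<longleftrightarrow> continuous_on {0..} \<psi> \<and> strict_mono_on {0..} \<psi> \<and> \<psi> 0 = 0"

definition covers :: "real \<Rightarrow> real \<Rightarrow> (real \<Rightarrow> real) \<Rightarrow> real \<Rightarrow> bool" where
  "covers s \<nu> \<psi> c \<longleftrightarrow> 0 < c \<and>
     (\<forall>t\<in>{0<..s}. c * (t powr \<nu> / \<psi> t) \<le> (INF \<sigma>\<in>{t..s}. \<sigma> powr \<nu> / \<psi> \<sigma>))"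

end

theory Submission
  imports Defs
begin

text \<open>Let \<open>C\<close> and \<open>D\<close> be the population and the empirical covariance operator,
  \<open>A = lam (C + lam)\<^bsup>-1\<^esup>\<close> and \<open>B = lam (D + lam)\<^bsup>-1\<^esup>\<close>. The Hilbert-Schmidt norm of the error
  operator is the \<open>l\<^sup>2\<close> norm of its adjoint on an orthonormal basis of the output space, so everything
  reduces to estimates for single vectors of \<open>\<H>\<close>. There the error is \<open>r(D) h + g(D) m\<close> with
  \<open>r(\<sigma>) = 1 - \<sigma> g(\<sigma>)\<close>, \<open>h\<close> in the range of \<open>C\<^sub>*\<^sup>*\<close>, and \<open>m\<close> the empirical mean of the noise.
  The qualification bounds \<open>r(D)\<close> by \<open>B\<^sup>\<nu>\<close>. The integer part of this power is changed into a power
  of \<open>A\<close> by telescoping the resolvents, the fractional part by the Loewner-Heinz inequality,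
  and \<open>A\<^sup>\<nu> \<phi>(C)\<close> is controlled because the qualification covers the index function.

  Both random quantities are means of bounded Hilbert space valued variables. For these
  \<open>E cosh \<parallel>S\<^sub>n\<parallel>\<close> grows at most by a factor \<open>1 + E \<parallel>\<xi>\<parallel>\<^sup>2\<close> per summand, which gives a Bernstein type tail
  without dimension dependence; it is proved for finitely many coordinates and extended by monotone limits.
  A union bound over the two events costs a factor two in the confidence, which the constants
  of the theorem leave room for: for small \<open>\<delta>\<close> by the factor two in front of the logarithm,
  and for large \<open>\<delta>\<close> because Chebyshev's inequality is then good enough.\<close>

section \<open>Orthonormal bases\<close>

text \<open>Adjoints are used because multiplication from the right by functions of \<open>C\<close>
  or \<open>D\<close> becomes their action on a single vector, where operator inequalities are
  inequalities between norms. The obstacle is that \<open>C\<close> and \<open>D\<close> do not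
  commute and that powers above 1 are not operator monotone; hence the splitting of the exponent at
  its integer part. The smallness hypothesis on \<open>\<B>\<close> keeps the Hilbert-Schmidt norm
  of (D - C)(C + lam)^(-1/2) below sqrt lam / 2 on the good event. The resolvents then differ by at
  most half of \<open>B\<close> itself, so norm (B w) <= 2 * norm (A w), the only comparison fed
  into Loewner-Heinz. Constants: 2 powr \<nu> comes from \<sigma> + lam <= 2 * max \<sigma> lam, 2
  powr (\<nu> - \<nu>') from the factor 2 just mentioned, max 1 (1 / c) from the two ranges of the
  covering condition, and sqrt 10 = 2 * sqrt 2 * (sqrt 5 / 2) from, in this order, the deviation
  bound, Loewner-Heinz at exponent 1/2 and the enlarged noise threshold. Random operators are seen
  through coordinates in countable orthonormal bases, so that concentration is only ever applied to
  finitely many real variables at a time.\<close>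

text \<open>The distance to \<open>S\<close> is attained by completeness: midpoints stay in
  \<open>S\<close>, so the parallelogram law makes a minimising sequence Cauchy. At its limit no
  direction inside \<open>S\<close> decreases the distance, which is the orthogonality.\<close>

lemma closed_subspace_projection:
  fixes S :: "'a::{real_inner, banach} set" and v :: 'a
  assumes S: "subspace S" "closed S"
  obtains p where "p \<in> S" "\<And>s. s \<in> S \<Longrightarrow> (v - p) \<bullet> s = 0"
proof -
  define d where "d = (INF s\<in>S. (norm (v - s))\<^sup>2)"
  have bdd: "bdd_below ((\<lambda>s. (norm (v - s))\<^sup>2) ` S)"
    by (intro bdd_belowI2[of _ 0]) auto
  have ne: "S \<noteq> {}" using S subspace_0 by blast
  have d_le: "d \<le> (norm (v - s))\<^sup>2" if "s \<in> S" for s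
    unfolding d_def using bdd that by (rule cINF_lower)
  have "\<exists>s\<in>S. (norm (v - s))\<^sup>2 < d + 1 / real (Suc n)" for n
  proof -
    have "d < d + 1 / real (Suc n)" by simp
    then show ?thesis unfolding d_def using cINF_less_iff[OF ne bdd] by blast
  qed
  then obtain x where xS: "\<And>n. x n \<in> S" and x: "\<And>n. (norm (v - x n))\<^sup>2 < d + 1 / real (Suc n)"
    by metis
  have close: "(norm (x m - x n))\<^sup>2 \<le> 2 / real (Suc m) + 2 / real (Suc n)" for m n
  proof -
    have par: "(norm (x m - x n))\<^sup>2 = 2 * (norm (v - x m))\<^sup>2 + 2 * (norm (v - x n))\<^sup>2
        - 4 * (norm (v - (1/2) *\<^sub>R (x m + x n)))\<^sup>2"
      unfolding power2_norm_eq_inner by (simp add: inner_simps inner_commute algebra_simps)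
    have "(1/2) *\<^sub>R (x m + x n) \<in> S"
      using S xS by (simp add: subspace_add subspace_scale)
    from d_le[OF this] par x[of m] x[of n] show ?thesis by simp
  qed
  have "Cauchy x"
  proof (rule metric_CauchyI)
    fix e :: real assume e: "0 < e"
    obtain N where N: "4 / e\<^sup>2 < real N" using reals_Archimedean2 by blast
    have Npos: "0 < real (Suc N)" by simp
    have "dist (x m) (x n) < e" if "m \<ge> N" "n \<ge> N" for m n
    proof -
      have "2 / real (Suc m) \<le> 2 / real (Suc N)" "2 / real (Suc n) \<le> 2 / real (Suc N)"
        using that by (auto intro!: divide_left_mono)
      then have "(norm (x m - x n))\<^sup>2 \<le> 4 / real (Suc N)" using close[of m n] by simp
      also have "\<dots> < e\<^sup>2"
        using N e by (simp add: field_simps) (metis add_strict_increasing add.commute zero_less_power less_eq_real_def)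
      finally have "norm (x m - x n) < e" using e by (simp add: power_less_imp_less_base)
      then show ?thesis by (simp add: dist_norm)
    qed
    then show "\<exists>M. \<forall>m\<ge>M. \<forall>n\<ge>M. dist (x m) (x n) < e" by blast
  qed
  then obtain p where p: "x \<longlonglongrightarrow> p" using Cauchy_convergent convergent_def by blast
  have pS: "p \<in> S" using closed_sequentially[OF S(2)] xS p by blast
  have "(\<lambda>n. (norm (v - x n))\<^sup>2) \<longlonglongrightarrow> (norm (v - p))\<^sup>2" by (intro tendsto_intros p)
  moreover have "(\<lambda>n. d + 1 / real (Suc n)) \<longlonglongrightarrow> d + 0"
    by (intro tendsto_add tendsto_const LIMSEQ_Suc[OF lim_1_over_n])
  ultimately have "(norm (v - p))\<^sup>2 \<le> d + 0"
    by (rule LIMSEQ_le) (use x less_imp_le in blast)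
  then have min: "(norm (v - p))\<^sup>2 \<le> (norm (v - s))\<^sup>2" if "s \<in> S" for s
    using order_trans[OF _ d_le[OF that]] by simp
  have "(v - p) \<bullet> s = 0" if s: "s \<in> S" for s
  proof (cases "s = 0")
    case False
    \<comment> \<open>Minimiser of the quadratic function norm (v - p - t s) ^ 2 of t; moving there
      would lower it by ((v - p) . s)^2 / (s . s).\<close>
    define t where "t = ((v - p) \<bullet> s) / (s \<bullet> s)"
    have ss: "s \<bullet> s > 0" using False by simp
    have "p + t *\<^sub>R s \<in> S" using S pS s by (simp add: subspace_add subspace_scale)
    from min[OF this] have "(v - p) \<bullet> (v - p) \<le> (v - p - t *\<^sub>R s) \<bullet> (v - p - t *\<^sub>R s)"
      by (simp add: power2_norm_eq_inner algebra_simps)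
    also have "\<dots> = (v - p) \<bullet> (v - p) - 2 * t * ((v - p) \<bullet> s) + t\<^sup>2 * (s \<bullet> s)"
      by (simp add: inner_simps inner_commute power2_eq_square algebra_simps)
    also have "\<dots> = (v - p) \<bullet> (v - p) - ((v - p) \<bullet> s)\<^sup>2 / (s \<bullet> s)"
      using ss by (simp add: t_def power2_eq_square field_simps)
    finally have "((v - p) \<bullet> s)\<^sup>2 / (s \<bullet> s) \<le> 0" by simp
    then show ?thesis using ss by (simp add: divide_le_0_iff)
  qed simp
  with pS that show thesis by blast
qed

lemma closed_subspace_eq_UNIV:
  fixes S :: "'a::{real_inner, banach} set"
  assumes "subspace S" "closed S" "\<And>v. (\<And>s. s \<in> S \<Longrightarrow> v \<bullet> s = 0) \<Longrightarrow> v = 0"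
  shows "S = UNIV"
proof -
  have "v \<in> S" for v
  proof -
    obtain p where "p \<in> S" "\<And>s. s \<in> S \<Longrightarrow> (v - p) \<bullet> s = 0"
      using closed_subspace_projection[OF assms(1,2)] by blast
    with assms(3)[of "v - p"] show ?thesis by simp
  qed
  then show ?thesis by blast
qed

lemma inner_closure_span_eq_0:
  fixes v :: "'a::real_inner"
  assumes "\<And>e. e \<in> E \<Longrightarrow> v \<bullet> e = 0" "s \<in> closure (span E)"
  shows "v \<bullet> s = 0"
proof -
  have "closed {s. v \<bullet> s = 0}"
    by (intro closed_Collect_eq continuous_intros)
  moreover have "span E \<subseteq> {s. v \<bullet> s = 0}"
    by (rule span_minimal) (use assms in \<open>auto simp: subspace_def inner_simps\<close>)
  ultimately show ?thesis using assms(2) closure_minimal by blast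
qed

lemma subspace_closure_span: "subspace (closure (span E))"
  for E :: "'a::real_normed_vector set"
  unfolding subspace_def
proof (intro conjI ballI allI)
  show "0 \<in> closure (span E)" using closure_subset span_zero by blast
next
  fix x y assume "x \<in> closure (span E)" "y \<in> closure (span E)"
  then obtain u v where uv: "\<And>n::nat. u n \<in> span E" "u \<longlonglongrightarrow> x" "\<And>n::nat. v n \<in> span E" "v \<longlonglongrightarrow> y"
    unfolding closure_sequential by blast
  then have "(\<lambda>n. u n + v n) \<longlonglongrightarrow> x + y" "\<And>n. u n + v n \<in> span E"
    by (auto intro: tendsto_add span_add)
  then show "x + y \<in> closure (span E)" unfolding closure_sequential
    by (intro exI[of _ "\<lambda>n. u n + v n"]) auto
next
  fix c :: real and x assume "x \<in> closure (span E)"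
  then obtain u where u: "\<And>n::nat. u n \<in> span E" "u \<longlonglongrightarrow> x"
    unfolding closure_sequential by blast
  then have "(\<lambda>n. c *\<^sub>R u n) \<longlonglongrightarrow> c *\<^sub>R x" "\<And>n. c *\<^sub>R u n \<in> span E"
    by (auto intro: tendsto_scaleR span_scale)
  then show "c *\<^sub>R x \<in> closure (span E)" unfolding closure_sequential
    by (intro exI[of _ "\<lambda>n. c *\<^sub>R u n"]) auto
qed

definition orthonormal :: "'a::real_inner set \<Rightarrow> bool" where
  "orthonormal E \<longleftrightarrow> (\<forall>e\<in>E. norm e = 1) \<and> pairwise orthogonal E"

lemma is_onb_orthonormal: "is_onb E \<Longrightarrow> orthonormal E"
  by (simp add: is_onb_def orthonormal_def)

lemma orthonormal_inner:
  assumes "orthonormal E" "e \<in> E" "e' \<in> E"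
  shows "e \<bullet> e' = (if e = e' then 1 else 0)"
  using assms by (auto simp: orthonormal_def pairwise_def orthogonal_def norm_eq_1)

text \<open>Zorn's lemma with a side condition \<open>P\<close> on the vectors, so that one argument
  serves for plain bases and for bases of eigenvectors. By \<open>step\<close> a system whose closed
  span is proper can be enlarged, hence a maximal one has dense span.\<close>

lemma ex_onb_satisfying:
  fixes P :: "'a::{real_inner, banach} \<Rightarrow> bool"
  assumes step: "\<And>E. orthonormal E \<Longrightarrow> (\<forall>e\<in>E. P e) \<Longrightarrow> closure (span E) \<noteq> UNIV \<Longrightarrow>
     \<exists>v. norm v = 1 \<and> P v \<and> (\<forall>e\<in>E. v \<bullet> e = 0)"
  shows "\<exists>E. is_onb E \<and> (\<forall>e\<in>E. P e)"
proof -
  define A where "A = {E. orthonormal E \<and> (\<forall>e\<in>E. P e)}"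
  have "\<exists>M\<in>A. \<forall>X\<in>A. M \<subseteq> X \<longrightarrow> X = M"
  proof (rule subset_Zorn)
    fix C assume C: "subset.chain A C"
    have "\<Union>C \<in> A"
      unfolding A_def orthonormal_def
    proof (intro CollectI conjI ballI)
      show "pairwise orthogonal (\<Union>C)"
        unfolding pairwise_def
      proof (intro ballI impI)
        fix x y assume "x \<in> \<Union>C" "y \<in> \<Union>C" "x \<noteq> y"
        then obtain X Y where XY: "X \<in> C" "x \<in> X" "Y \<in> C" "y \<in> Y" by blast
        with C have "X \<subseteq> Y \<or> Y \<subseteq> X" unfolding subset_chain_def by blast
        then obtain Z where "Z \<in> C" "x \<in> Z" "y \<in> Z" using XY by blast
        with C \<open>x \<noteq> y\<close> show "orthogonal x y"
          by (auto simp: subset_chain_def A_def orthonormal_def pairwise_def)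
      qed
    qed (use C in \<open>auto simp: subset_chain_def A_def orthonormal_def\<close>)
    then show "\<exists>U\<in>A. \<forall>X\<in>C. X \<subseteq> U" by blast
  qed
  then obtain M where M: "M \<in> A" and max: "\<And>X. X \<in> A \<Longrightarrow> M \<subseteq> X \<Longrightarrow> X = M" by blast
  have "closure (span M) = UNIV"
  proof (rule ccontr)
    assume "closure (span M) \<noteq> UNIV"
    with step[of M] M obtain v where v: "norm v = 1" "P v" "\<forall>e\<in>M. v \<bullet> e = 0"
      by (auto simp: A_def)
    have "v \<notin> M" using v by (metis inner_eq_zero_iff norm_zero zero_neq_one)
    have "insert v M \<in> A"
      using M v by (auto simp: A_def orthonormal_def pairwise_insert orthogonal_def inner_commute)
    with max[of "insert v M"] \<open>v \<notin> M\<close> show False by blast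
  qed
  with M show ?thesis by (auto simp: A_def is_onb_def orthonormal_def)
qed

lemma ex_unit_orthogonal:
  fixes S :: "'a::{real_inner, banach} set"
  assumes "subspace S" "closed S" "S \<noteq> UNIV"
  obtains v where "norm v = 1" "\<And>s. s \<in> S \<Longrightarrow> v \<bullet> s = 0"
proof -
  obtain v where v: "\<And>s. s \<in> S \<Longrightarrow> v \<bullet> s = 0" "v \<noteq> 0"
    using closed_subspace_eq_UNIV[OF assms(1,2)] assms(3) by blast
  show thesis
    by (rule that[of "v /\<^sub>R norm v"]) (use v in auto)
qed

lemma ex_onb: "\<exists>E :: 'a::{real_inner, banach} set. is_onb E"
proof -
  have "\<exists>E :: 'a set. is_onb E \<and> (\<forall>e\<in>E. True)"
  proof (rule ex_onb_satisfying)
    fix E :: "'a set" assume "closure (span E) \<noteq> UNIV"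
    then obtain v where "norm v = 1" "\<And>s. s \<in> closure (span E) \<Longrightarrow> v \<bullet> s = 0"
      using ex_unit_orthogonal[OF subspace_closure_span closed_closure] by blast
    then show "\<exists>v. norm v = 1 \<and> True \<and> (\<forall>e\<in>E. v \<bullet> e = 0)"
      using closure_subset span_superset by blast
  qed
  then show ?thesis by blast
qed

lemma some_onb: "is_onb (some_onb :: 'a::{real_inner, banach} set)"
  unfolding some_onb_def by (rule someI_ex[OF ex_onb])

text \<open>Distinct vectors are at distance sqrt 2, so the balls of radius 1/2 around them are
  disjoint open sets, of which there are only countably many. Countability later allows a basis to
  be exhausted by an increasing sequence of finite sets.\<close>

lemma orthonormal_countable:
  fixes E :: "'a::{real_inner, second_countable_topology} set"
  assumes E: "orthonormal E"
  shows "countable E"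
proof -
  have sep: "1 < dist e e'" if "e \<in> E" "e' \<in> E" "e \<noteq> e'" for e e'
  proof -
    have "(norm (e - e'))\<^sup>2 = 2"
      unfolding power2_norm_eq_inner
      using orthonormal_inner[OF E] that by (simp add: inner_simps)
    then have "1\<^sup>2 < (norm (e - e'))\<^sup>2" by simp
    then show ?thesis unfolding dist_norm by (rule power_less_imp_less_base) simp
  qed
  have inj: "inj_on (\<lambda>e. ball e (1/2)) E"
  proof (rule inj_onI, rule ccontr)
    fix a b assume "a \<in> E" "b \<in> E" "ball a (1/2) = ball b (1/2)" "a \<noteq> b"
    then have "a \<in> ball b (1/2)" "1 < dist a b" using sep by auto
    then show False by (simp add: dist_commute)
  qed
  have "countable ((\<lambda>e. ball e (1/2)) ` E)"
  proof (rule countable_disjoint_open_subsets)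
    show "disjoint ((\<lambda>e. ball e (1/2)) ` E)"
    proof (rule disjointI, clarify)
      fix a b assume ab: "a \<in> E" "b \<in> E" "ball a (1/2) \<noteq> ball b (1/2)"
      have "dist a b < 1" if "x \<in> ball a (1/2)" "x \<in> ball b (1/2)" for x
        using that dist_triangle2[of a b x] by (simp add: dist_commute)
      with sep[of a b] ab show "ball a (1/2) \<inter> ball b (1/2) = {}" by force
    qed
  qed auto
  then show ?thesis using inj countable_image_inj_on by blast
qed

section \<open>Fourier expansions, Parseval's identity and orthogonal series\<close>

lemma orthonormal_residual:
  assumes F: "orthonormal F" "finite F" and u: "u \<in> span F"
  shows "(v - (\<Sum>e\<in>F. (v \<bullet> e) *\<^sub>R e)) \<bullet> u = 0"
proof -
  have 1: "(\<Sum>e\<in>F. (v \<bullet> e) * (e \<bullet> f)) = v \<bullet> f" if "f \<in> F" for f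
  proof -
    have "(\<Sum>e\<in>F. (v \<bullet> e) * (e \<bullet> f)) = (\<Sum>e\<in>F. if e = f then v \<bullet> e else 0)"
      by (rule sum.cong) (auto simp: orthonormal_inner[OF F(1)] that)
    then show ?thesis using F(2) that by simp
  qed
  have "(v - (\<Sum>e\<in>F. (v \<bullet> e) *\<^sub>R e)) \<bullet> f = 0" if "f \<in> F" for f
    using 1[OF that] by (simp add: inner_diff_left inner_sum_left)
  moreover have "u \<in> closure (span F)" using closure_subset u by (rule subsetD)
  ultimately show ?thesis by (rule inner_closure_span_eq_0)
qed

lemma pythagoras: "u \<bullet> v = 0 \<Longrightarrow> (norm (u + v))\<^sup>2 = (norm u)\<^sup>2 + (norm v)\<^sup>2"
  for u v :: "'a::real_inner"
  by (simp add: power2_norm_eq_inner inner_simps inner_commute)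

lemma orthonormal_best_approx:
  assumes F: "orthonormal F" "finite F" and u: "u \<in> span F"
  shows "norm (v - (\<Sum>e\<in>F. (v \<bullet> e) *\<^sub>R e)) \<le> norm (v - u)"
proof -
  let ?p = "\<Sum>e\<in>F. (v \<bullet> e) *\<^sub>R e"
  have "?p - u \<in> span F"
    by (intro span_diff u span_sum span_scale span_base)
  then have "(v - ?p) \<bullet> (?p - u) = 0" by (rule orthonormal_residual[OF F])
  from pythagoras[OF this] have "(norm (v - ?p))\<^sup>2 \<le> (norm (v - u))\<^sup>2" by simp
  then show ?thesis by simp
qed

text \<open>Once a finite set \<open>F\<close> contains the basis vectors used by an approximant
  \<open>w\<close> of \<open>v\<close>, best approximation puts the partial sum over
  \<open>F\<close> at least as close to \<open>v\<close> as \<open>w\<close>. This is convergence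
  along the net of finite subsets, independent of any enumeration.\<close>

lemma onb_has_sum:
  fixes v :: "'a::real_inner"
  assumes E: "is_onb E"
  shows "((\<lambda>e. (v \<bullet> e) *\<^sub>R e) has_sum v) E"
  unfolding has_sum_def
proof (rule tendstoI)
  fix \<epsilon> :: real assume "\<epsilon> > 0"
  moreover have "v \<in> closure (span E)" using E by (simp add: is_onb_def)
  ultimately obtain w where w: "w \<in> span E" "dist w v < \<epsilon>"
    unfolding closure_approachable by blast
  then obtain t r where t: "finite t" "t \<subseteq> E" "w = (\<Sum>a\<in>t. r a *\<^sub>R a)"
    unfolding span_explicit by blast
  have "dist (\<Sum>e\<in>F. (v \<bullet> e) *\<^sub>R e) v < \<epsilon>" if F: "finite F" "t \<subseteq> F" "F \<subseteq> E" for F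
  proof -
    have "orthonormal F"
      using is_onb_orthonormal[OF E] F(3) pairwise_mono unfolding orthonormal_def by blast
    moreover have "w \<in> span F" unfolding t(3)
      using t F by (intro span_sum span_scale span_base) auto
    ultimately have "norm (v - (\<Sum>e\<in>F. (v \<bullet> e) *\<^sub>R e)) \<le> norm (v - w)"
      using orthonormal_best_approx F(1) by blast
    with w(2) show ?thesis by (simp add: dist_norm norm_minus_commute)
  qed
  then show "\<forall>\<^sub>F F in finite_subsets_at_top E. dist (\<Sum>e\<in>F. (v \<bullet> e) *\<^sub>R e) v < \<epsilon>"
    unfolding eventually_finite_subsets_at_top using t by blast
qed

lemma onb_inner_has_sum:
  assumes E: "is_onb E"
  shows "((\<lambda>e. (u \<bullet> e) * (v \<bullet> e)) has_sum (u \<bullet> v)) E"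
  using has_sum_bounded_linear[OF bounded_linear_inner_right[of u] onb_has_sum[OF E, of v]]
  by (simp add: mult.commute)

lemma parseval:
  assumes E: "is_onb E"
  shows "((\<lambda>e. (v \<bullet> e)\<^sup>2) has_sum (norm v)\<^sup>2) E"
  using onb_inner_has_sum[OF E, of v v] by (simp add: power2_eq_square power2_norm_eq_inner[symmetric])

lemma onb_eqI:
  assumes E: "is_onb E" and "\<And>e. e \<in> E \<Longrightarrow> u \<bullet> e = v \<bullet> e"
  shows "u = v"
proof (rule has_sum_unique)
  show "((\<lambda>e. (u \<bullet> e) *\<^sub>R e) has_sum u) E" by (rule onb_has_sum[OF E])
  have "((\<lambda>e. (u \<bullet> e) *\<^sub>R e) has_sum v) E \<longleftrightarrow> ((\<lambda>e. (v \<bullet> e) *\<^sub>R e) has_sum v) E"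
    by (rule has_sum_cong) (simp add: assms(2))
  then show "((\<lambda>e. (u \<bullet> e) *\<^sub>R e) has_sum v) E" using onb_has_sum[OF E] by blast
qed

lemma norm_sum_orthogonal:
  fixes x :: "'i \<Rightarrow> 'a::real_inner"
  assumes "finite I" "\<And>i j. i \<in> I \<Longrightarrow> j \<in> I \<Longrightarrow> i \<noteq> j \<Longrightarrow> x i \<bullet> x j = 0"
  shows "(norm (\<Sum>i\<in>I. x i))\<^sup>2 = (\<Sum>i\<in>I. (norm (x i))\<^sup>2)"
  using assms
proof (induction I rule: finite_induct)
  case (insert i I)
  have "x i \<bullet> (\<Sum>i\<in>I. x i) = 0"
    using insert by (auto simp: inner_sum_right intro!: sum.neutral)
  from pythagoras[OF this] insert show ?case by simp
qed simp

text \<open>For orthogonal terms the squared norm of a finite sum is the sum of the squares, so the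
  partial sums inherit the Cauchy property from the real series. Completeness gives the limit,
  continuity of the norm its size.\<close>

lemma orthogonal_summable:
  fixes x :: "'i \<Rightarrow> 'a::{real_inner, banach}"
  assumes orth: "\<And>i j. i \<in> I \<Longrightarrow> j \<in> I \<Longrightarrow> i \<noteq> j \<Longrightarrow> x i \<bullet> x j = 0"
    and sum: "((\<lambda>i. (norm (x i))\<^sup>2) has_sum S) I"
  shows "x summable_on I" "(norm (infsum x I))\<^sup>2 = S"
proof -
  let ?q = "\<lambda>i. (norm (x i))\<^sup>2"
  have lim: "(sum ?q \<longlongrightarrow> S) (finite_subsets_at_top I)"
    using sum unfolding has_sum_def .
  have nrm: "(norm (sum x F))\<^sup>2 = sum ?q F" if "finite F" "F \<subseteq> I" for F
    by (rule norm_sum_orthogonal) (use that orth in auto)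
  have "\<exists>P. eventually P (finite_subsets_at_top I) \<and>
          (\<forall>F F'. P F \<and> P F' \<longrightarrow> dist (sum x F) (sum x F') < e)" if e: "e > 0" for e
  proof -
    \<comment> \<open>Two partial sums within e^2 / 8 of \<open>S\<close> differ by less than e^2 /
      4 = (e / 2)^2; two comparisons with \<open>F0\<close> then stay below
      \<open>e\<close>.\<close>
    have "e\<^sup>2 / 8 > 0" using e by simp
    with lim have "\<forall>\<^sub>F F in finite_subsets_at_top I. dist (sum ?q F) S < e\<^sup>2 / 8"
      by (rule tendstoD)
    then obtain F0 where F0: "finite F0" "F0 \<subseteq> I"
      and F0': "\<forall>F. finite F \<and> F0 \<subseteq> F \<and> F \<subseteq> I \<longrightarrow> dist (sum ?q F) S < e\<^sup>2 / 8"
      unfolding eventually_finite_subsets_at_top by blast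
    have near: "dist (sum x F) (sum x F0) < e / 2" if F: "finite F" "F0 \<subseteq> F" "F \<subseteq> I" for F
    proof -
      have "(norm (sum x (F - F0)))\<^sup>2 = sum ?q (F - F0)" using F by (intro nrm) auto
      also have "\<dots> = sum ?q F - sum ?q F0" using F by (simp add: sum_diff)
      also have "\<dots> < e\<^sup>2 / 4"
      proof -
        have "dist (sum ?q F) S < e\<^sup>2 / 8" "dist (sum ?q F0) S < e\<^sup>2 / 8" using F0' F F0 by auto
        then show ?thesis unfolding dist_real_def abs_less_iff by linarith
      qed
      also have "\<dots> = (e / 2)\<^sup>2" by (simp add: power2_eq_square)
      finally have "norm (sum x (F - F0)) < e / 2" by (rule power_less_imp_less_base) (use e in simp)
      moreover have "sum x (F - F0) = sum x F - sum x F0" using F by (simp add: sum_diff)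
      ultimately show ?thesis by (simp add: dist_norm)
    qed
    show ?thesis
    proof (intro exI conjI allI impI)
      show "eventually (\<lambda>F. finite F \<and> F0 \<subseteq> F \<and> F \<subseteq> I) (finite_subsets_at_top I)"
        unfolding eventually_finite_subsets_at_top using F0 by blast
      fix F F' assume "(finite F \<and> F0 \<subseteq> F \<and> F \<subseteq> I) \<and> (finite F' \<and> F0 \<subseteq> F' \<and> F' \<subseteq> I)"
      then have "dist (sum x F) (sum x F0) < e / 2" "dist (sum x F') (sum x F0) < e / 2"
        using near by auto
      then show "dist (sum x F) (sum x F') < e" by (rule dist_triangle_half_l)
    qed
  qed
  then have "cauchy_filter (filtermap (sum x) (finite_subsets_at_top I))"
    by (simp add: cauchy_filter_metric_filtermap)
  then obtain L where "(sum x \<longlongrightarrow> L) (finite_subsets_at_top I)"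
    using complete_uniform[where S="UNIV :: 'a set"] complete_UNIV by (force simp: filterlim_def)
  then show s: "x summable_on I" using summable_on_def has_sum_def by blast
  then have "(sum x \<longlongrightarrow> infsum x I) (finite_subsets_at_top I)"
    using has_sum_infsum has_sum_def by blast
  then have "((\<lambda>F. (norm (sum x F))\<^sup>2) \<longlongrightarrow> (norm (infsum x I))\<^sup>2) (finite_subsets_at_top I)"
    by (intro tendsto_intros)
  moreover have "((\<lambda>F. (norm (sum x F))\<^sup>2) \<longlongrightarrow> S) (finite_subsets_at_top I)"
    by (rule Lim_transform_eventually[OF lim])
      (auto simp: nrm intro!: eventually_finite_subsets_at_top_weakI)
  ultimately show "(norm (infsum x I))\<^sup>2 = S"
    using tendsto_unique finite_subsets_at_top_neq_bot by blast
qed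

text \<open>Tonelli's theorem for sums. It is the common source of the basis independence of
  Hilbert-Schmidt norms and of the trace.\<close>

lemma nonneg_double_has_sum:
  fixes a :: "'i \<Rightarrow> 'j \<Rightarrow> real"
  assumes nonneg: "\<And>i j. i \<in> I \<Longrightarrow> j \<in> J \<Longrightarrow> 0 \<le> a i j"
    and rows: "\<And>i. i \<in> I \<Longrightarrow> (a i has_sum r i) J"
    and cols: "\<And>j. j \<in> J \<Longrightarrow> ((\<lambda>i. a i j) has_sum c j) I"
    and total: "(r has_sum S) I"
  shows "(c has_sum S) J"
proof -
  let ?f = "\<lambda>(i, j). a i j"
  have "(\<lambda>x. norm (?f x)) summable_on I \<times> J"
    unfolding Infinite_Sum.abs_summable_on_Sigma_iff
  proof (intro conjI ballI)
    fix i assume i: "i \<in> I"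
    have "(\<lambda>j. norm (?f (i, j))) summable_on J \<longleftrightarrow> a i summable_on J"
      by (rule summable_on_cong) (use nonneg i in auto)
    then show "(\<lambda>j. norm (?f (i, j))) summable_on J"
      using has_sum_imp_summable[OF rows[OF i]] by blast
  next
    have "infsum (\<lambda>j. norm (?f (i, j))) J = r i" if i: "i \<in> I" for i
    proof -
      have "infsum (\<lambda>j. norm (?f (i, j))) J = infsum (a i) J"
        by (rule infsum_cong) (use nonneg i in auto)
      with infsumI[OF rows[OF i]] show ?thesis by simp
    qed
    moreover have "0 \<le> r i" if "i \<in> I" for i
      using rows[OF that] nonneg[OF that] has_sum_nonneg by blast
    ultimately have "(\<lambda>i. norm (infsum (\<lambda>j. norm (?f (i, j))) J)) summable_on I \<longleftrightarrow> r summable_on I"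
      by (intro summable_on_cong) auto
    then show "(\<lambda>i. norm (infsum (\<lambda>j. norm (?f (i, j))) J)) summable_on I"
      using has_sum_imp_summable[OF total] by blast
  qed
  then have "?f summable_on I \<times> J" by (rule abs_summable_summable)
  then have "(?f has_sum S) (I \<times> J)"
    using rows total by (intro has_sum_SigmaI[where g = r]) auto
  then have "((\<lambda>(j, i). a i j) has_sum S) (J \<times> I)"
    unfolding has_sum_swap[of ?f] by (simp add: case_prod_unfold)
  then show ?thesis by (rule has_sum_SigmaD) (use cols in auto)
qed

lemma has_sum_ubound:
  fixes f :: "'i \<Rightarrow> real"
  assumes "\<And>i. i \<in> I \<Longrightarrow> 0 \<le> f i" "\<And>F. finite F \<Longrightarrow> F \<subseteq> I \<Longrightarrow> sum f F \<le> K"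
  shows "f summable_on I" "infsum f I \<le> K"
proof -
  show "f summable_on I"
    by (rule nonneg_bdd_above_summable_on) (use assms in \<open>auto intro!: bdd_aboveI2\<close>)
  then show "infsum f I \<le> K" by (rule infsum_le_finite_sums) (use assms in auto)
qed

section \<open>Riesz representation, adjoints and Hilbert-Schmidt norms\<close>

text \<open>The representing vector is the series of \<open>l e *\<^sub>R e\<close> over a basis.
  Testing \<open>l\<close> on a finite partial sum gives S <= K * sqrt S for the sum S of the
  squares, hence S <= K^2, which is the summability required.\<close>

lemma riesz_representation:
  fixes l :: "'a::{real_inner, banach} \<Rightarrow> real"
  assumes l: "bounded_linear l"
  obtains a where "\<And>v. l v = v \<bullet> a"
proof -
  obtain E :: "'a set" where E: "is_onb E" using ex_onb by blast
  note oE = orthonormal_inner[OF is_onb_orthonormal[OF E]]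
  obtain K where K: "\<And>v. norm (l v) \<le> norm v * K" using bounded_linear.bounded[OF l] by blast
  interpret l: bounded_linear l by (rule l)
  have bound: "(\<Sum>e\<in>F. (norm (l e *\<^sub>R e))\<^sup>2) \<le> K\<^sup>2" if F: "finite F" "F \<subseteq> E" for F
  proof -
    let ?S = "\<Sum>e\<in>F. (l e)\<^sup>2"
    have n1: "norm e = 1" if "e \<in> E" for e using E that by (simp add: is_onb_def)
    have q: "(\<Sum>e\<in>F. (norm (l e *\<^sub>R e))\<^sup>2) = ?S"
      using F n1 by (intro sum.cong) auto
    have nn: "(norm (\<Sum>e\<in>F. l e *\<^sub>R e))\<^sup>2 = ?S"
      unfolding q[symmetric] by (rule norm_sum_orthogonal) (use F in \<open>simp_all add: oE subset_iff\<close>)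
    have "?S = l (\<Sum>e\<in>F. l e *\<^sub>R e)"
      by (simp add: l.sum l.scaleR power2_eq_square)
    also have "\<dots> \<le> norm (\<Sum>e\<in>F. l e *\<^sub>R e) * K" using K by (metis abs_le_D1 real_norm_def)
    finally have "?S\<^sup>2 \<le> (norm (\<Sum>e\<in>F. l e *\<^sub>R e) * K)\<^sup>2"
      by (intro power_mono sum_nonneg) auto
    also have "\<dots> = ?S * K\<^sup>2" by (simp add: power_mult_distrib nn)
    finally have "?S * ?S \<le> ?S * K\<^sup>2" by (simp add: power2_eq_square)
    moreover have "?S \<ge> 0" by (intro sum_nonneg) auto
    ultimately have "?S \<le> K\<^sup>2" by (cases "?S = 0") (auto simp: mult_le_cancel_left)
    then show ?thesis unfolding q .
  qed
  have "(\<lambda>e. (norm (l e *\<^sub>R e))\<^sup>2) summable_on E"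
    by (rule has_sum_ubound(1)[OF _ bound]) auto
  then have "((\<lambda>e. (norm (l e *\<^sub>R e))\<^sup>2) has_sum (\<Sum>\<^sub>\<infinity>e\<in>E. (norm (l e *\<^sub>R e))\<^sup>2)) E"
    by (rule has_sum_infsum)
  then have "(\<lambda>e. l e *\<^sub>R e) summable_on E"
    by (rule orthogonal_summable(1)[rotated]) (simp add: oE)
  then have a: "((\<lambda>e. l e *\<^sub>R e) has_sum (\<Sum>\<^sub>\<infinity>e\<in>E. l e *\<^sub>R e)) E" (is "(_ has_sum ?a) E")
    by simp
  show thesis
  proof (rule that)
    fix v
    have "((\<lambda>e. l e * (v \<bullet> e)) has_sum (v \<bullet> ?a)) E"
      using has_sum_bounded_linear[OF bounded_linear_inner_right[of v] a] by simp
    moreover have "((\<lambda>e. l e * (v \<bullet> e)) has_sum l v) E"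
      using has_sum_bounded_linear[OF l onb_has_sum[OF E, of v]] by (simp add: l.scaleR mult.commute)
    ultimately show "l v = v \<bullet> ?a" using has_sum_unique by blast
  qed
qed

text \<open>Riesz representation for each \<open>y\<close> separately; the adjoint is a bare
  function characterised by the duality identity, the form in which all later arguments use
  it.\<close>

lemma ex_adjoint:
  fixes T :: "'a::{real_inner, banach} \<Rightarrow>\<^sub>L 'b::real_inner"
  obtains t where "\<And>v y. T v \<bullet> y = v \<bullet> t y"
proof -
  have "\<exists>a. \<forall>v. T v \<bullet> y = v \<bullet> a" for y
  proof -
    have "bounded_linear (\<lambda>v. T v \<bullet> y)"
      by (rule bounded_linear_inner_left_comp[OF blinfun.bounded_linear_right])
    then show ?thesis using riesz_representation[of "\<lambda>v. T v \<bullet> y"] by metis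
  qed
  then show thesis using that by metis
qed

text \<open>Both sides are the double sum of (T e . y)^2 over pairs of basis vectors, read by rows
  and by columns through Parseval's identity.\<close>

lemma hs_adjoint_has_sum:
  fixes T :: "'a::real_inner \<Rightarrow> 'b::real_inner"
  assumes E: "is_onb E" and F: "is_onb F" and t: "\<And>v y. T v \<bullet> y = v \<bullet> t y"
    and sum: "((\<lambda>e. (norm (T e))\<^sup>2) has_sum S) E"
  shows "((\<lambda>y. (norm (t y))\<^sup>2) has_sum S) F"
proof (rule nonneg_double_has_sum[OF _ _ _ sum])
  show "((\<lambda>y. (T e \<bullet> y)\<^sup>2) has_sum (norm (T e))\<^sup>2) F" for e by (rule parseval[OF F])
  show "((\<lambda>e. (T e \<bullet> y)\<^sup>2) has_sum (norm (t y))\<^sup>2) E" for y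
    using parseval[OF E, of "t y"] by (simp add: t inner_commute[of "t y"])
qed auto

text \<open>Passing to the adjoint and back removes the dependence on the basis fixed in the
  definition. The sum over a basis of the output space is the form in which the error operator is
  estimated.\<close>

lemma hs_norm_adjoint:
  fixes T :: "'a::{real_inner, banach} \<Rightarrow>\<^sub>L 'b::{real_inner, banach}"
  assumes F: "is_onb F" and t: "\<And>v y. T v \<bullet> y = v \<bullet> t y"
  shows "hilbert_schmidt T \<longleftrightarrow> (\<lambda>y. (norm (t y))\<^sup>2) summable_on F"
    and "hs_norm T = sqrt (\<Sum>\<^sub>\<infinity>y\<in>F. (norm (t y))\<^sup>2)"
proof -
  have t': "t y \<bullet> v = y \<bullet> T v" for v y by (metis t inner_commute)
  show iff: "hilbert_schmidt T \<longleftrightarrow> (\<lambda>y. (norm (t y))\<^sup>2) summable_on F"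
    unfolding hilbert_schmidt_def
    using hs_adjoint_has_sum[OF some_onb F t] hs_adjoint_has_sum[OF F some_onb t']
    unfolding summable_on_def by blast
  show "hs_norm T = sqrt (\<Sum>\<^sub>\<infinity>y\<in>F. (norm (t y))\<^sup>2)"
  proof (cases "hilbert_schmidt T")
    case True
    then have "((\<lambda>e. (norm (T e))\<^sup>2) has_sum (hs_norm T)\<^sup>2) some_onb"
      by (simp add: hilbert_schmidt_def hs_norm_def infsum_nonneg)
    from infsumI[OF hs_adjoint_has_sum[OF some_onb F t this]] show ?thesis
      by (simp add: hs_norm_def infsum_nonneg)
  next
    \<comment> \<open>Outside the Hilbert-Schmidt class both infinite sums take the default value 0,
      so the equation persists.\<close>
    case False
    then have "\<not> (\<lambda>y. (norm (t y))\<^sup>2) summable_on F" using iff by blast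
    with False show ?thesis
      by (simp add: hs_norm_def hilbert_schmidt_def infsum_not_exists)
  qed
qed

section \<open>Compact positive operators\<close>

text \<open>Supplies the finite-dimensional compact approximation to the image of a unit ball. The
  induction adds one segment at a time as a Minkowski sum.\<close>

lemma compact_bounded_combinations:
  fixes x :: "'i \<Rightarrow> 'a::real_normed_vector"
  assumes "finite F"
  shows "compact {\<Sum>i\<in>F. c i *\<^sub>R x i | c. \<forall>i. \<bar>c i\<bar> \<le> (1::real)}"
  using assms
proof (induction F rule: finite_induct)
  case empty
  have "{\<Sum>i\<in>{}. c i *\<^sub>R x i | c. \<forall>i. \<bar>c i\<bar> \<le> (1::real)} = {0}"
    by (auto intro!: exI[of _ "\<lambda>_. 0"])
  then show ?case by simp
next
  case (insert i F)
  let ?K = "{\<Sum>i\<in>F. c i *\<^sub>R x i | c. \<forall>i. \<bar>c i\<bar> \<le> (1::real)}"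
  have "compact ((\<lambda>t. t *\<^sub>R x i) ` {-1..1::real})"
    by (intro compact_continuous_image continuous_intros) auto
  from compact_sums[OF this insert.IH]
  have "compact {a + b |a b. a \<in> (\<lambda>t. t *\<^sub>R x i) ` {-1..1} \<and> b \<in> ?K}" .
  moreover have "{a + b |a b. a \<in> (\<lambda>t. t *\<^sub>R x i) ` {-1..1} \<and> b \<in> ?K}
      = {\<Sum>i\<in>insert i F. c i *\<^sub>R x i | c. \<forall>i. \<bar>c i\<bar> \<le> (1::real)}" (is "?L = ?R")
  proof (intro set_eqI iffI)
    fix y assume "y \<in> ?L"
    then obtain t c where tc: "-1 \<le> t" "t \<le> 1" "\<forall>i. \<bar>c i\<bar> \<le> (1::real)"
      "y = t *\<^sub>R x i + (\<Sum>i\<in>F. c i *\<^sub>R x i)" by auto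
    have "(\<Sum>j\<in>F. c j *\<^sub>R x j) = (\<Sum>j\<in>F. (c(i := t)) j *\<^sub>R x j)"
      by (rule sum.cong) (use insert in auto)
    then have "y = (\<Sum>j\<in>insert i F. (c(i := t)) j *\<^sub>R x j)"
      using insert tc by simp
    moreover have "\<forall>j. \<bar>(c(i := t)) j\<bar> \<le> 1" using tc by auto
    ultimately show "y \<in> ?R" by blast
  next
    fix y assume "y \<in> ?R"
    then obtain c where c: "\<forall>i. \<bar>c i\<bar> \<le> (1::real)" "y = (\<Sum>j\<in>insert i F. c j *\<^sub>R x j)" by blast
    then have "y = c i *\<^sub>R x i + (\<Sum>j\<in>F. c j *\<^sub>R x j)" using insert by simp
    moreover have "c i \<in> {-1..1}" using c(1)[rule_format, of i] by auto
    ultimately show "y \<in> ?L" using c(1) by blast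
  qed
  ultimately show ?case by simp
qed

text \<open>Projecting the unit ball onto finitely many basis vectors moves its image by at most the
  square root of the tail of the Hilbert-Schmidt sum (Cauchy-Schwarz in the coefficients), and the
  image of the projection lies in a compact set of bounded combinations. Hence total
  boundedness.\<close>

lemma compact_image_cball:
  fixes A :: "'a::real_inner \<Rightarrow>\<^sub>L 'b::banach"
  assumes E: "is_onb E" and sum: "(\<lambda>e. (norm (A e))\<^sup>2) summable_on E"
  shows "compact (closure (A ` cball 0 1))"
proof -
  have "\<exists>k. finite k \<and> closure (A ` cball 0 1) \<subseteq> (\<Union>x\<in>k. ball x \<epsilon>)" if eps: "\<epsilon> > 0" for \<epsilon> :: real
  proof -
  let ?q = "\<lambda>e. (norm (A e))\<^sup>2"
  \<comment> \<open>Of the budget \<epsilon> one quarter each goes to the closure, to the projection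
    onto \<open>F\<close> and to the finite net of \<open>C\<close>.\<close>
  have "(\<epsilon> / 4)\<^sup>2 > 0" using eps by simp
  then obtain F where F: "finite F" "F \<subseteq> E" and dF: "dist (sum ?q F) (infsum ?q E) \<le> (\<epsilon> / 4)\<^sup>2"
    using infsum_finite_approximation[OF sum] by blast
  have oF: "orthonormal F"
    using is_onb_orthonormal[OF E] F(2) pairwise_mono unfolding orthonormal_def by blast
  let ?P = "\<lambda>v. \<Sum>e\<in>F. (v \<bullet> e) *\<^sub>R e"
  have tail: "sum ?q G \<le> (\<epsilon> / 4)\<^sup>2" if G: "finite G" "G \<subseteq> E - F" for G
  proof -
    have "sum ?q G + sum ?q F = sum ?q (G \<union> F)"
      using G F by (subst sum.union_disjoint) auto
    also have "\<dots> \<le> infsum ?q E"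
      by (rule finite_sum_le_infsum[OF sum]) (use G F in auto)
    finally show ?thesis using dF by (simp add: dist_real_def abs_le_iff)
  qed
  have close: "norm (A (v - ?P v)) \<le> \<epsilon> / 4" if v: "norm v \<le> 1" for v
  proof -
    let ?w = "v - ?P v"
    have w1: "norm ?w \<le> 1"
      using orthonormal_best_approx[OF oF F(1), of 0 v] v by (simp add: span_zero)
    have w0: "?w \<bullet> e = 0" if "e \<in> F" for e
      using orthonormal_residual[OF oF F(1) span_base[OF that]] .
    have fin: "norm (\<Sum>e\<in>G. (?w \<bullet> e) *\<^sub>R A e) \<le> \<epsilon> / 4" if G: "finite G" "G \<subseteq> E" for G
    proof -
      have "(\<Sum>e\<in>G. (?w \<bullet> e) *\<^sub>R A e) = (\<Sum>e\<in>G - F. (?w \<bullet> e) *\<^sub>R A e)"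
        by (rule sum.mono_neutral_right) (use G w0 in auto)
      also have "norm \<dots> \<le> (\<Sum>e\<in>G - F. \<bar>?w \<bullet> e\<bar> * \<bar>norm (A e)\<bar>)"
        by (rule order_trans[OF norm_sum]) simp
      also have "\<dots> \<le> L2_set (\<lambda>e. ?w \<bullet> e) (G - F) * L2_set (\<lambda>e. norm (A e)) (G - F)"
        by (rule L2_set_mult_ineq)
      also have "\<dots> \<le> 1 * (\<epsilon> / 4)"
      proof (intro mult_mono)
        have "(\<Sum>e\<in>G - F. (?w \<bullet> e)\<^sup>2) \<le> (norm ?w)\<^sup>2"
          by (rule finite_sum_le_has_sum[OF parseval[OF E]]) (use G in auto)
        also have "\<dots> \<le> 1" using w1 by (simp add: power_le_one)
        finally show "L2_set (\<lambda>e. ?w \<bullet> e) (G - F) \<le> 1" by (simp add: L2_set_def)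
        show "L2_set (\<lambda>e. norm (A e)) (G - F) \<le> \<epsilon> / 4"
          unfolding L2_set_def using G eps by (intro real_le_lsqrt tail sum_nonneg) auto
      qed (use eps in \<open>auto simp: L2_set_nonneg\<close>)
      finally show ?thesis by simp
    qed
    have "((\<lambda>e. (?w \<bullet> e) *\<^sub>R A e) has_sum A ?w) E"
      using has_sum_bounded_linear[OF blinfun.bounded_linear_right onb_has_sum[OF E], of A ?w]
      by (simp add: blinfun.scaleR_right)
    then have "((\<lambda>G. \<Sum>e\<in>G. (?w \<bullet> e) *\<^sub>R A e) \<longlongrightarrow> A ?w) (finite_subsets_at_top E)"
      unfolding has_sum_def .
    then show ?thesis
      by (rule Lim_norm_ubound[rotated])
        (use fin in \<open>auto intro!: eventually_finite_subsets_at_top_weakI\<close>)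
  qed
  define C where "C = {\<Sum>e\<in>F. c e *\<^sub>R A e | c. \<forall>e. \<bar>c e\<bar> \<le> (1::real)}"
  have "compact C" unfolding C_def by (rule compact_bounded_combinations[OF F(1)])
  moreover have "\<epsilon> / 4 > 0" using eps by simp
  ultimately obtain k where k: "finite k" "C \<subseteq> (\<Union>x\<in>k. ball x (\<epsilon> / 4))"
    unfolding compact_eq_totally_bounded by blast
  have "closure (A ` cball 0 1) \<subseteq> (\<Union>x\<in>k. ball x \<epsilon>)"
  proof
    fix y assume "y \<in> closure (A ` cball 0 1)"
    then have "\<exists>z\<in>A ` cball 0 1. dist z y < \<epsilon> / 4"
      unfolding closure_approachable using \<open>\<epsilon> / 4 > 0\<close> by blast
    then obtain v where v: "norm v \<le> 1" "dist (A v) y < \<epsilon> / 4" by auto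
    \<comment> \<open>Membership in \<open>C\<close> demands coefficients bounded by 1 at every
      index, while Cauchy-Schwarz gives this only at unit vectors; elsewhere the coefficient is set
      to 0.\<close>
    define c where "c e = (if norm e = 1 then v \<bullet> e else 0)" for e
    have "\<bar>c e\<bar> \<le> 1" for e
      using Cauchy_Schwarz_ineq2[of v e] v(1) by (auto simp: c_def)
    moreover have "A (?P v) = (\<Sum>e\<in>F. c e *\<^sub>R A e)"
      using oF by (simp add: blinfun.sum_right blinfun.scaleR_right c_def orthonormal_def)
    ultimately have "A (?P v) \<in> C" unfolding C_def by blast
    then have "A (?P v) \<in> (\<Union>x\<in>k. ball x (\<epsilon> / 4))" using k(2) by blast
    then obtain x where x: "x \<in> k" "dist x (A (?P v)) < \<epsilon> / 4" by auto
    have "dist (A v) (A (?P v)) \<le> \<epsilon> / 4"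
      using close[OF v(1)] by (simp add: dist_norm blinfun.diff_right)
    then have "dist x y < \<epsilon>"
      using x(2) v(2) eps dist_triangle[of x y "A (?P v)"] dist_triangle[of "A (?P v)" y "A v"]
      by (simp add: dist_commute)
    then show "y \<in> (\<Union>x\<in>k. ball x \<epsilon>)" using x(1) by auto
  qed
  then show "\<exists>k. finite k \<and> closure (A ` cball 0 1) \<subseteq> (\<Union>x\<in>k. ball x \<epsilon>)" using k(1) by blast
  qed
  then show ?thesis by (simp add: compact_eq_totally_bounded complete_eq_closed)
qed

text \<open>\<open>\<mu>\<close> is the supremum of the Rayleigh quotient on the unit sphere of
  \<open>S\<close>. A maximising sequence consists of approximate eigenvectors; compactness makes
  its images converge along a subsequence, and for nonzero \<mu> the vectors follow. The invariant
  subspace \<open>S\<close> is there to be the orthogonal complement of the eigenvectors already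
  found.\<close>

lemma compact_positive_ex_eigenvector:
  fixes A :: "'a::{real_inner, banach} \<Rightarrow>\<^sub>L 'a"
  assumes S: "subspace S" "closed S" "w \<in> S" "w \<noteq> 0" and inv: "\<And>v. v \<in> S \<Longrightarrow> A v \<in> S"
    and sa: "\<And>u v. A u \<bullet> v = u \<bullet> A v" and pos: "\<And>v. 0 \<le> A v \<bullet> v"
    and cpt: "compact (closure (A ` cball 0 1))"
  obtains v \<mu> where "v \<in> S" "norm v = 1" "A v = \<mu> *\<^sub>R v"
proof -
  define U where "U = {v\<in>S. norm v = 1}"
  define \<mu> where "\<mu> = (SUP v\<in>U. A v \<bullet> v)"
  have wU: "w /\<^sub>R norm w \<in> U" using S by (simp add: U_def subspace_scale)
  have bdd: "bdd_above ((\<lambda>v. A v \<bullet> v) ` U)"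
  proof (rule bdd_aboveI2)
    fix v assume "v \<in> U"
    then show "A v \<bullet> v \<le> norm A"
      using norm_cauchy_schwarz[of "A v" v] norm_blinfun[of A v] by (simp add: U_def)
  qed
  have le\<mu>: "A v \<bullet> v \<le> \<mu>" if "v \<in> U" for v
    unfolding \<mu>_def by (rule cSUP_upper[OF that bdd])
  have form: "A v \<bullet> v \<le> \<mu> * (norm v)\<^sup>2" if "v \<in> S" for v
  proof (cases "v = 0")
    case False
    then have "v /\<^sub>R norm v \<in> U" using S(1) that by (simp add: U_def subspace_scale)
    from le\<mu>[OF this] False show ?thesis
      by (simp add: blinfun.scaleR_right field_simps power2_eq_square)
  qed simp
  have \<mu>0: "0 \<le> \<mu>" using le\<mu>[OF wU] pos[of "w /\<^sub>R norm w"] by linarith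
  have expand: "A (v + t *\<^sub>R A v) \<bullet> (v + t *\<^sub>R A v)
      = A v \<bullet> v + 2 * t * (norm (A v))\<^sup>2 + t\<^sup>2 * (A (A v) \<bullet> A v)" for v t
    by (simp add: blinfun.add_right blinfun.scaleR_right inner_simps sa[of "A v" v]
        power2_norm_eq_inner[symmetric] power2_eq_square[of t] algebra_simps)
  show thesis
  proof (cases "\<mu> = 0")
    \<comment> \<open>The form then vanishes on \<open>S\<close>; its value at u + A u is 2 * (norm
      (A u))^2, so \<open>u\<close> is an eigenvector for 0.\<close>
    case True
    define u where "u = w /\<^sub>R norm w"
    have z: "A v \<bullet> v = 0" if "v \<in> S" for v using form[OF that] pos[of v] True by simp
    have uS: "u \<in> S" "norm u = 1" using wU by (simp_all add: U_def u_def)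
    then have "u + 1 *\<^sub>R A u \<in> S" using inv S(1) by (simp add: subspace_add)
    from z[OF this] have "2 * (norm (A u))\<^sup>2 = 0"
      unfolding expand using z[OF uS(1)] z[OF inv[OF uS(1)]] by simp
    then have "A u = 0 *\<^sub>R u" by simp
    then show thesis using that uS by blast
  next
    case False
    with \<mu>0 have \<mu>: "\<mu> > 0" by simp
    have sq: "(norm (A v))\<^sup>2 \<le> \<mu> * (A v \<bullet> v)" if v: "v \<in> S" for v
    proof -
      \<comment> \<open>Positivity at v - A v / \<mu>. Invariance of \<open>S\<close> lets the
        supremum \<mu> bound the term quadratic in A v as well.\<close>
      have "0 \<le> A (v + (- 1 / \<mu>) *\<^sub>R A v) \<bullet> (v + (- 1 / \<mu>) *\<^sub>R A v)" by (rule pos)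
      also have "\<dots> \<le> A v \<bullet> v + 2 * (- 1 / \<mu>) * (norm (A v))\<^sup>2 + (- 1 / \<mu>)\<^sup>2 * (\<mu> * (norm (A v))\<^sup>2)"
        unfolding expand by (intro add_left_mono mult_left_mono form inv v) auto
      also have "\<dots> = A v \<bullet> v - (norm (A v))\<^sup>2 / \<mu>"
        using \<mu> by (simp add: field_simps power2_eq_square)
      finally show ?thesis using \<mu> by (simp add: field_simps)
    qed
    have "\<exists>v\<in>U. \<mu> - 1 / real (Suc n) < A v \<bullet> v" for n
    proof -
      have "\<mu> - 1 / real (Suc n) < \<mu>" by simp
      moreover have "U \<noteq> {}" using wU by blast
      ultimately show ?thesis unfolding \<mu>_def using less_cSUP_iff[OF _ bdd] by blast
    qed
    then obtain x where xU: "\<And>n. x n \<in> U" and x: "\<And>n. \<mu> - 1 / real (Suc n) < A (x n) \<bullet> x n"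
      by metis
    define d where "d n = A (x n) - \<mu> *\<^sub>R x n" for n
    have d: "(norm (d n))\<^sup>2 \<le> \<mu> * (1 / real (Suc n))" for n
    proof -
      have n1: "x n \<bullet> x n = 1" using xU by (simp add: U_def norm_eq_1)
      have "(norm (d n))\<^sup>2 = (norm (A (x n)))\<^sup>2 - 2 * \<mu> * (A (x n) \<bullet> x n) + \<mu>\<^sup>2"
        unfolding d_def power2_norm_eq_inner
        by (simp add: inner_simps n1 inner_commute power2_eq_square algebra_simps)
      also have "\<dots> \<le> \<mu> * (A (x n) \<bullet> x n) - 2 * \<mu> * (A (x n) \<bullet> x n) + \<mu>\<^sup>2"
        using sq[of "x n"] xU by (simp add: U_def)
      also have "\<dots> = \<mu> * (\<mu> - A (x n) \<bullet> x n)" by (simp add: algebra_simps power2_eq_square)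
      also have "\<dots> \<le> \<mu> * (1 / real (Suc n))"
        using x[of n] \<mu> by (intro mult_left_mono) auto
      finally show ?thesis .
    qed
    have "(\<lambda>n. \<mu> * (1 / real (Suc n))) \<longlonglongrightarrow> \<mu> * 0"
      by (intro tendsto_mult tendsto_const LIMSEQ_Suc[OF lim_1_over_n])
    then have up: "(\<lambda>n. \<mu> * (1 / real (Suc n))) \<longlonglongrightarrow> 0" by simp
    have "(\<lambda>n. (norm (d n))\<^sup>2) \<longlonglongrightarrow> 0"
      by (rule tendsto_sandwich[OF _ _ tendsto_const up])
        (simp_all only: d zero_le_power2 eventually_True)
    then have "(\<lambda>n. sqrt ((norm (d n))\<^sup>2)) \<longlonglongrightarrow> sqrt 0" by (rule tendsto_real_sqrt)
    then have d0: "d \<longlonglongrightarrow> 0" by (simp add: tendsto_norm_zero_iff)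
    have "A (x n) \<in> closure (A ` cball 0 1)" for n
    proof (rule closure_subset[THEN subsetD])
      show "A (x n) \<in> A ` cball 0 1" using xU[of n] by (simp add: U_def)
    qed
    then have "\<exists>l\<in>closure (A ` cball 0 1). \<exists>r. strict_mono r \<and> ((\<lambda>n. A (x n)) \<circ> r) \<longlonglongrightarrow> l"
      using cpt[unfolded compact_def, rule_format, of "\<lambda>n. A (x n)"] by simp
    then obtain l r where r: "strict_mono r" "((\<lambda>n. A (x n)) \<circ> r) \<longlonglongrightarrow> l" by blast
    have "(\<lambda>n. (1 / \<mu>) *\<^sub>R (A (x (r n)) - d (r n))) \<longlonglongrightarrow> (1 / \<mu>) *\<^sub>R (l - 0)"
      using r LIMSEQ_subseq_LIMSEQ[OF d0 r(1)] by (intro tendsto_intros) (simp_all add: o_def)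
    then have xl: "(\<lambda>n. x (r n)) \<longlonglongrightarrow> (1 / \<mu>) *\<^sub>R l"
      using \<mu> by (simp add: d_def)
    let ?u = "(1 / \<mu>) *\<^sub>R l"
    have "?u \<in> S" using closed_sequentially[OF S(2) _ xl] xU by (simp add: U_def)
    moreover have "(\<lambda>n. norm (x (r n))) \<longlonglongrightarrow> norm ?u" by (intro tendsto_norm xl)
    then have "(\<lambda>n::nat. 1) \<longlonglongrightarrow> norm ?u" using xU by (simp add: U_def del: norm_scaleR)
    then have "norm ?u = 1" by (simp only: LIMSEQ_const_iff)
    moreover have "(\<lambda>n. A (x (r n))) \<longlonglongrightarrow> A ?u" by (intro blinfun.tendsto tendsto_const xl)
    then have "A ?u = l" using r(2) unfolding o_def by (rule LIMSEQ_unique)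
    then have "A ?u = \<mu> *\<^sub>R ?u" using \<mu> by simp
    ultimately show thesis using that by blast
  qed
qed

text \<open>The orthogonal complement of a set of eigenvectors is invariant because \<open>A\<close>
  is self-adjoint; as long as it is nonzero it contains a further eigenvector, so a maximal system
  is a basis.\<close>

lemma eigenbasis_exists:
  fixes A :: "'a::{real_inner, banach} \<Rightarrow>\<^sub>L 'a"
  assumes E0: "is_onb E0" "(\<lambda>e. (norm (A e))\<^sup>2) summable_on E0"
    and sa: "\<And>u v. A u \<bullet> v = u \<bullet> A v" and pos: "\<And>v. 0 \<le> A v \<bullet> v"
  shows "\<exists>E. is_onb E \<and> (\<forall>e\<in>E. \<exists>\<mu>. A e = \<mu> *\<^sub>R e)"
proof (rule ex_onb_satisfying)
  fix E :: "'a set" assume E: "\<forall>e\<in>E. \<exists>\<mu>. A e = \<mu> *\<^sub>R e" "closure (span E) \<noteq> UNIV"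
  define S where "S = {v. \<forall>e\<in>E. v \<bullet> e = 0}"
  obtain w where w: "norm w = 1" "\<And>s. s \<in> closure (span E) \<Longrightarrow> w \<bullet> s = 0"
    using ex_unit_orthogonal[OF subspace_closure_span closed_closure E(2)] by blast
  have "subspace S" by (auto simp: S_def subspace_def inner_simps)
  moreover have "closed S"
  proof -
    have "S = (\<Inter>e\<in>E. {v. v \<bullet> e = 0})" by (auto simp: S_def)
    then show ?thesis by (auto intro!: closed_INT closed_Collect_eq continuous_intros)
  qed
  moreover have "w \<in> S"
  proof -
    have "E \<subseteq> closure (span E)" using span_superset closure_subset by (rule order_trans)
    then show ?thesis using w(2) by (auto simp: S_def)
  qed
  moreover have "w \<noteq> 0" using w(1) by auto
  moreover have "A v \<in> S" if "v \<in> S" for v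
    unfolding S_def
  proof (intro CollectI ballI)
    fix e assume e: "e \<in> E"
    with E(1) obtain \<mu> where "A e = \<mu> *\<^sub>R e" by blast
    with e that show "A v \<bullet> e = 0" by (simp add: sa S_def)
  qed
  ultimately obtain v \<mu> where "v \<in> S" "norm v = 1" "A v = \<mu> *\<^sub>R v"
    using compact_positive_ex_eigenvector[where A = A and S = S and w = w]
      sa pos compact_image_cball[OF E0] by metis
  then show "\<exists>v. norm v = 1 \<and> (\<exists>\<mu>. A v = \<mu> *\<^sub>R v) \<and> (\<forall>e\<in>E. v \<bullet> e = 0)"
    unfolding S_def by blast
qed

lemma eigenbasis:
  fixes A :: "'a::{real_inner, banach} \<Rightarrow>\<^sub>L 'a"
  assumes "is_onb E0" "(\<lambda>e. (norm (A e))\<^sup>2) summable_on E0"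
    and "\<And>u v. A u \<bullet> v = u \<bullet> A v" and "\<And>v. 0 \<le> A v \<bullet> v"
  shows "is_onb (eigenbasis A)" "e \<in> eigenbasis A \<Longrightarrow> A e = (A e \<bullet> e) *\<^sub>R e"
proof -
  have *: "is_onb (eigenbasis A) \<and> (\<forall>e\<in>eigenbasis A. \<exists>\<mu>. A e = \<mu> *\<^sub>R e)"
    unfolding eigenbasis_def by (rule someI_ex[OF eigenbasis_exists[OF assms]])
  then show "is_onb (eigenbasis A)" by blast
  assume e: "e \<in> eigenbasis A"
  with * obtain \<mu> where "A e = \<mu> *\<^sub>R e" by blast
  moreover have "e \<bullet> e = 1" using * e by (simp add: is_onb_def norm_eq_1)
  ultimately show "A e = (A e \<bullet> e) *\<^sub>R e" by simp
qed

section \<open>Operators diagonal in an orthonormal basis\<close>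

text \<open>The multiplier is a function of the basis vector and the basis is explicit, so that
  powers, residuals and products can all be formed in two fixed eigenbases, one for each covariance
  operator.\<close>

definition diag_op :: "'a::real_inner set \<Rightarrow> ('a \<Rightarrow> real) \<Rightarrow> 'a \<Rightarrow>\<^sub>L 'a" where
  "diag_op E f = Blinfun (\<lambda>v. \<Sum>\<^sub>\<infinity>e\<in>E. (f e * (v \<bullet> e)) *\<^sub>R e)"

lemma op_fun_diag: "op_fun f A = diag_op (eigenbasis A) (\<lambda>e. f (A e \<bullet> e))"
  by (simp add: op_fun_def diag_op_def)

lemma has_sum_mult_bounded:
  fixes a :: "'i \<Rightarrow> real"
  assumes a: "\<And>i. i \<in> I \<Longrightarrow> 0 \<le> a i" "(a has_sum S) I"
    and w: "\<And>i. i \<in> I \<Longrightarrow> 0 \<le> w i" "\<And>i. i \<in> I \<Longrightarrow> w i \<le> K"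
  shows "(\<lambda>i. w i * a i) summable_on I" "(\<Sum>\<^sub>\<infinity>i\<in>I. w i * a i) \<le> K * S"
proof -
  have "sum (\<lambda>i. w i * a i) F \<le> K * S" if F: "finite F" "F \<subseteq> I" for F
  \<comment> \<open>The sign of \<open>K\<close> is known only if there is an index at all, so the
    empty sum needs its own argument; for empty \<open>I\<close> the total \<open>S\<close> is
    0.\<close>
  proof (cases "F = {}")
    case True
    show ?thesis
    proof (cases "I = {}")
      case True
      then have "S = 0" using a(2) has_sum_unique[OF has_sum_empty, of a S] by auto
      with \<open>F = {}\<close> show ?thesis by simp
    next
      case False
      then have "0 \<le> K" using w by force
      then show ?thesis using \<open>F = {}\<close> has_sum_nonneg[OF a(2,1)] by simp
    qed
  next
    case False
    then have "0 \<le> K" using F w by force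
    have "sum (\<lambda>i. w i * a i) F \<le> (\<Sum>i\<in>F. K * a i)"
      using F a(1) w by (intro sum_mono mult_right_mono) auto
    also have "\<dots> = K * sum a F" by (simp add: sum_distrib_left)
    also have "\<dots> \<le> K * S"
      using \<open>0 \<le> K\<close> F a by (intro mult_left_mono finite_sum_le_has_sum[OF a(2)]) auto
    finally show ?thesis .
  qed
  from has_sum_ubound[OF _ this]
  show "(\<lambda>i. w i * a i) summable_on I" "(\<Sum>\<^sub>\<infinity>i\<in>I. w i * a i) \<le> K * S"
    using a(1) w(1) by auto
qed

context
  fixes E :: "'a::{real_inner, banach} set" and f :: "'a \<Rightarrow> real" and K :: real
  assumes E: "is_onb E" and f: "\<And>e. e \<in> E \<Longrightarrow> \<bar>f e\<bar> \<le> K"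
begin

private abbreviation series where "series v \<equiv> \<Sum>\<^sub>\<infinity>e\<in>E. (f e * (v \<bullet> e)) *\<^sub>R e"

private lemma series:
  "((\<lambda>e. (f e * (v \<bullet> e)) *\<^sub>R e) has_sum series v) E"
  "(norm (series v))\<^sup>2 \<le> K\<^sup>2 * (norm v)\<^sup>2"
proof -
  have f2: "(f e)\<^sup>2 \<le> K\<^sup>2" if "e \<in> E" for e
    using f[OF that] by (metis abs_ge_zero power2_abs power_mono)
  have *: "(\<lambda>e. (f e)\<^sup>2 * (v \<bullet> e)\<^sup>2) summable_on E"
    "(\<Sum>\<^sub>\<infinity>e\<in>E. (f e)\<^sup>2 * (v \<bullet> e)\<^sup>2) \<le> K\<^sup>2 * (norm v)\<^sup>2"
    by (rule has_sum_mult_bounded[OF _ parseval[OF E]], use f2 in auto)+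
  have n: "(norm ((f e * (v \<bullet> e)) *\<^sub>R e))\<^sup>2 = (f e)\<^sup>2 * (v \<bullet> e)\<^sup>2" if "e \<in> E" for e
    using E that by (simp add: is_onb_def power_mult_distrib)
  have "((\<lambda>e. (norm ((f e * (v \<bullet> e)) *\<^sub>R e))\<^sup>2) has_sum (\<Sum>\<^sub>\<infinity>e\<in>E. (f e)\<^sup>2 * (v \<bullet> e)\<^sup>2)) E"
    using has_sum_infsum[OF *(1)] by (subst has_sum_cong[OF n]) auto
  note os = orthogonal_summable[OF _ this]
  have "(\<lambda>e. (f e * (v \<bullet> e)) *\<^sub>R e) summable_on E"
    by (rule os(1)) (simp add: orthonormal_inner[OF is_onb_orthonormal[OF E]])
  then show "((\<lambda>e. (f e * (v \<bullet> e)) *\<^sub>R e) has_sum series v) E" by simp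
  have "(norm (series v))\<^sup>2 = (\<Sum>\<^sub>\<infinity>e\<in>E. (f e)\<^sup>2 * (v \<bullet> e)\<^sup>2)"
    by (rule os(2)) (simp add: orthonormal_inner[OF is_onb_orthonormal[OF E]])
  with *(2) show "(norm (series v))\<^sup>2 \<le> K\<^sup>2 * (norm v)\<^sup>2" by simp
qed

private lemma bounded_linear_series: "bounded_linear series"
\<comment> \<open>If the basis is empty, \<open>K\<close> may be negative; hence the absolute
  value.\<close>
proof (rule bounded_linear_intro[where K = "\<bar>K\<bar>"])
  fix u v :: 'a and r :: real
  show "series (u + v) = series u + series v"
    using has_sum_add[OF series(1)[of u] series(1)[of v]]
    by (intro infsumI) (simp add: inner_simps algebra_simps)
  show "series (r *\<^sub>R u) = r *\<^sub>R series u"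
    using has_sum_scaleR[OF series(1)[of u], of r]
    by (intro infsumI) (simp add: algebra_simps)
  have "(norm (series u))\<^sup>2 \<le> (norm u * \<bar>K\<bar>)\<^sup>2"
    using series(2)[of u] by (simp add: power_mult_distrib mult.commute)
  then show "norm (series u) \<le> norm u * \<bar>K\<bar>" by (rule power2_le_imp_le) simp
qed

lemma diag_op_has_sum: "((\<lambda>e. (f e * (v \<bullet> e)) *\<^sub>R e) has_sum diag_op E f v) E"
  unfolding diag_op_def bounded_linear_Blinfun_apply[OF bounded_linear_series] by (rule series(1))

lemma diag_op_inner_has_sum: "((\<lambda>e. f e * (u \<bullet> e) * (v \<bullet> e)) has_sum (diag_op E f u \<bullet> v)) E"
  using has_sum_bounded_linear[OF bounded_linear_inner_left[of v] diag_op_has_sum[of u]]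
  by (simp add: inner_commute)

lemma diag_op_self_adjoint: "diag_op E f u \<bullet> v = u \<bullet> diag_op E f v"
proof -
  have "((\<lambda>e. f e * (u \<bullet> e) * (v \<bullet> e)) has_sum (diag_op E f v \<bullet> u)) E"
    using diag_op_inner_has_sum[of v u] by (simp add: mult.commute mult.left_commute)
  with diag_op_inner_has_sum[of u v] show ?thesis
    using has_sum_unique by (metis inner_commute)
qed

lemma diag_op_eigenvector: "e \<in> E \<Longrightarrow> diag_op E f e = f e *\<^sub>R e"
proof -
  assume e: "e \<in> E"
  have "((\<lambda>d. (f d * (e \<bullet> d)) *\<^sub>R d) has_sum (f e *\<^sub>R e)) E \<longleftrightarrow>
        ((\<lambda>d. (f d * (e \<bullet> d)) *\<^sub>R d) has_sum (f e *\<^sub>R e)) {e}"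
    by (rule has_sum_cong_neutral) (use e in \<open>auto simp: orthonormal_inner[OF is_onb_orthonormal[OF E]]\<close>)
  also have "\<dots>"
    by (rule has_sum_finiteI) (use e in \<open>auto simp: orthonormal_inner[OF is_onb_orthonormal[OF E]]\<close>)
  finally show ?thesis using diag_op_has_sum[of e] has_sum_unique by blast
qed

lemma diag_op_inner: "e \<in> E \<Longrightarrow> diag_op E f v \<bullet> e = f e * (v \<bullet> e)"
  by (simp add: diag_op_self_adjoint diag_op_eigenvector)

lemma diag_op_norm_has_sum: "((\<lambda>e. (f e)\<^sup>2 * (v \<bullet> e)\<^sup>2) has_sum (norm (diag_op E f v))\<^sup>2) E"
proof -
  have "((\<lambda>e. (diag_op E f v \<bullet> e)\<^sup>2) has_sum (norm (diag_op E f v))\<^sup>2) E"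
    by (rule parseval[OF E])
  moreover have "(diag_op E f v \<bullet> e)\<^sup>2 = (f e)\<^sup>2 * (v \<bullet> e)\<^sup>2" if "e \<in> E" for e
    using that by (simp add: diag_op_inner power_mult_distrib)
  ultimately show ?thesis by (subst (asm) has_sum_cong) auto
qed

lemma norm_diag_op_le: "norm (diag_op E f v) \<le> \<bar>K\<bar> * norm v"
proof (rule power2_le_imp_le)
  show "(norm (diag_op E f v))\<^sup>2 \<le> (\<bar>K\<bar> * norm v)\<^sup>2"
    unfolding diag_op_def bounded_linear_Blinfun_apply[OF bounded_linear_series]
    using series(2)[of v] by (simp add: power_mult_distrib)
qed simp

lemma diag_op_eqI: "(\<And>e. e \<in> E \<Longrightarrow> w \<bullet> e = f e * (v \<bullet> e)) \<Longrightarrow> w = diag_op E f v"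
  by (rule onb_eqI[OF E]) (simp add: diag_op_inner)

end

section \<open>The Loewner-Heinz inequality\<close>

text \<open>Integrand of the classical formula which represents x powr \<theta>, up to a constant
  factor, by resolvents x / (x + t) when 0 < \<theta> < 1. The constant pi / sin (pi * \<theta>) is
  never evaluated; it cancels.\<close>

definition powr_kernel :: "real \<Rightarrow> real \<Rightarrow> real \<Rightarrow> real" where
  "powr_kernel \<theta> x t = (if t > 0 then t powr (\<theta> - 1) * (x / (x + t)) else 0)"

lemma powr_kernel_measurable[measurable]: "powr_kernel \<theta> x \<in> borel_measurable borel"
  unfolding powr_kernel_def by measurable

lemma powr_kernel_nonneg: "0 \<le> x \<Longrightarrow> 0 \<le> powr_kernel \<theta> x t"
  by (simp add: powr_kernel_def)

text \<open>The substitution t -> x t pulls x powr \<theta> out of the integral; the identity holds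
  in the extended reals, whatever the value of the remaining integral.\<close>

lemma powr_kernel_integral_scale:
  assumes x: "0 < x"
  shows "(\<integral>\<^sup>+t. powr_kernel \<theta> x t \<partial>lborel) = ennreal (x powr \<theta>) * (\<integral>\<^sup>+t. powr_kernel \<theta> 1 t \<partial>lborel)"
proof -
  have "x * powr_kernel \<theta> x (x * t) = x powr \<theta> * powr_kernel \<theta> 1 t" for t
  proof (cases "t > 0")
    case True
    have 1: "x * x powr (\<theta> - 1) = x powr \<theta>" using x by (simp add: powr_diff)
    have "x + x * t = x * (1 + t)" by (simp add: algebra_simps)
    then have 2: "x / (x + x * t) = 1 / (1 + t)" using x by simp
    have "x * powr_kernel \<theta> x (x * t) = (x * x powr (\<theta> - 1)) * t powr (\<theta> - 1) * (x / (x + x * t))"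
      using True x by (simp add: powr_kernel_def powr_mult)
    then show ?thesis unfolding 1 2 using True by (simp add: powr_kernel_def)
  qed (use x in \<open>simp add: powr_kernel_def zero_less_mult_iff\<close>)
  then have eq: "ennreal x * ennreal (powr_kernel \<theta> x (x * t)) = ennreal (x powr \<theta>) * ennreal (powr_kernel \<theta> 1 t)" for t
    using x by (simp add: ennreal_mult[symmetric] powr_kernel_nonneg)
  have "(\<integral>\<^sup>+t. powr_kernel \<theta> x t \<partial>lborel) = ennreal \<bar>x\<bar> * (\<integral>\<^sup>+t. powr_kernel \<theta> x (0 + x * t) \<partial>lborel)"
    using x by (intro nn_integral_real_affine) auto
  also have "\<dots> = (\<integral>\<^sup>+t. ennreal (x powr \<theta>) * powr_kernel \<theta> 1 t \<partial>lborel)"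
    using x by (simp add: nn_integral_cmult[symmetric] eq)
  also have "\<dots> = ennreal (x powr \<theta>) * (\<integral>\<^sup>+t. powr_kernel \<theta> 1 t \<partial>lborel)"
    by (rule nn_integral_cmult) measurable
  finally show ?thesis .
qed

text \<open>The kernel is dominated by t powr (\<theta> - 1) near 0 and by t powr (\<theta> - 2)
  near infinity, both integrable in this range of \<theta>; on the unit interval half of the first
  majorant is a lower bound. The two facts permit cancelling the constant.\<close>

lemma powr_kernel_integral_pos_finite:
  assumes \<theta>: "0 < \<theta>" "\<theta> < 1"
  shows "(\<integral>\<^sup>+t. powr_kernel \<theta> 1 t \<partial>lborel) \<noteq> 0" "(\<integral>\<^sup>+t. powr_kernel \<theta> 1 t \<partial>lborel) \<noteq> \<infinity>"
proof -
  have "((\<lambda>t. t powr (\<theta> - 1)) has_integral (1 powr (\<theta> - 1 + 1) / (\<theta> - 1 + 1))) {0..1}"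
    by (rule has_integral_powr_from_0) (use \<theta> in auto)
  from nn_integral_has_integral_lebesgue[OF _ this]
  have I0: "(\<integral>\<^sup>+t. ennreal (indicator {0..1} t * t powr (\<theta> - 1)) \<partial>lborel) = ennreal (1 / \<theta>)"
    by simp
  have "((\<lambda>t. t powr (\<theta> - 2)) has_integral - (1 powr (\<theta> - 2 + 1)) / (\<theta> - 2 + 1)) {1..}"
    by (rule has_integral_powr_to_inf) (use \<theta> in auto)
  from nn_integral_has_integral_lebesgue[OF _ this]
  have I1: "(\<integral>\<^sup>+t. ennreal (indicator {1..} t * t powr (\<theta> - 2)) \<partial>lborel) = ennreal (- 1 / (\<theta> - 2 + 1))"
    by simp
  have le: "powr_kernel \<theta> 1 t \<le> indicator {0..1} t * t powr (\<theta> - 1) + indicator {1..} t * t powr (\<theta> - 2)" for t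
  proof (cases "t > 0")
    case True
    have "t powr (\<theta> - 1) * (1 / (1 + t)) \<le> t powr (\<theta> - 1) * 1"
      using True by (intro mult_left_mono) auto
    moreover have "t powr (\<theta> - 1) * (1 / (1 + t)) \<le> t powr (\<theta> - 1) * (1 / t)"
      using True by (intro mult_left_mono) (auto simp: field_simps)
    moreover have "t powr (\<theta> - 1) * (1 / t) = t powr (\<theta> - 2)"
      using True by (simp add: powr_diff power2_eq_square)
    ultimately show ?thesis
      using True by (auto simp: powr_kernel_def indicator_def)
  qed (simp add: powr_kernel_def)
  have "(\<integral>\<^sup>+t. powr_kernel \<theta> 1 t \<partial>lborel) \<le>
      (\<integral>\<^sup>+t. ennreal (indicator {0..1} t * t powr (\<theta> - 1)) + ennreal (indicator {1..} t * t powr (\<theta> - 2)) \<partial>lborel)"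
    by (intro nn_integral_mono) (simp add: ennreal_plus[symmetric] ennreal_leI le del: ennreal_plus)
  also have "\<dots> = ennreal (1 / \<theta>) + ennreal (- 1 / (\<theta> - 2 + 1))"
    by (subst nn_integral_add) (simp_all add: I0 I1)
  also have "\<dots> < \<infinity>" by simp
  finally show "(\<integral>\<^sup>+t. powr_kernel \<theta> 1 t \<partial>lborel) \<noteq> \<infinity>" by simp
  have ge: "(1 / 2) * (indicator {0..1} t * t powr (\<theta> - 1)) \<le> powr_kernel \<theta> 1 t" for t
  proof (cases "0 < t \<and> t \<le> 1")
    case True
    then have "t powr (\<theta> - 1) * (1 / 2) \<le> t powr (\<theta> - 1) * (1 / (1 + t))"
      by (intro mult_left_mono) (auto simp: field_simps)
    with True show ?thesis by (simp add: powr_kernel_def)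
  qed (auto simp: powr_kernel_def indicator_def)
  have "ennreal (1 / 2) * ennreal (1 / \<theta>) = (\<integral>\<^sup>+t. ennreal (1 / 2) * ennreal (indicator {0..1} t * t powr (\<theta> - 1)) \<partial>lborel)"
    by (subst nn_integral_cmult) (simp_all add: I0)
  also have "\<dots> \<le> (\<integral>\<^sup>+t. powr_kernel \<theta> 1 t \<partial>lborel)"
  proof (rule nn_integral_mono)
    fix t :: real
    have "ennreal (1 / 2) * ennreal (indicator {0..1} t * t powr (\<theta> - 1)) = ennreal ((1 / 2) * (indicator {0..1} t * t powr (\<theta> - 1)))"
      by (rule ennreal_mult[symmetric]) auto
    also have "\<dots> \<le> ennreal (powr_kernel \<theta> 1 t)" by (rule ennreal_leI[OF ge])
    finally show "ennreal (1 / 2) * ennreal (indicator {0..1} t * t powr (\<theta> - 1)) \<le> ennreal (powr_kernel \<theta> 1 t)" .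
  qed
  finally show "(\<integral>\<^sup>+t. powr_kernel \<theta> 1 t \<partial>lborel) \<noteq> 0"
    using \<theta> by (auto simp: ennreal_mult[symmetric])
qed

context
  fixes E F :: "'a::{real_inner, banach} set" and s u :: "'a \<Rightarrow> real" and K :: real
  assumes E: "is_onb E" and F: "is_onb F"
    and s: "\<And>e. e \<in> E \<Longrightarrow> 0 < s e" "\<And>e. e \<in> E \<Longrightarrow> s e \<le> K"
    and u: "\<And>f. f \<in> F \<Longrightarrow> 0 < u f" "\<And>f. f \<in> F \<Longrightarrow> u f \<le> K"
    and le: "\<And>b. norm (diag_op E s b) \<le> norm (diag_op F u b)"
begin

text \<open>\<open>x \<mapsto> t x / (t + x)\<close> is operator monotone because the associated form at \<open>v\<close> is the infimum
  over \<open>b\<close> of \<open>t \<parallel>v - b\<parallel>\<^sup>2 + \<langle>x b, b\<rangle>\<close>.\<close>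

private lemma resolvent_mono:
  assumes t: "0 < t" and G: "finite G" "G \<subseteq> F" and v: "v = (\<Sum>f\<in>G. (v \<bullet> f) *\<^sub>R f)"
    and H: "finite H" "H \<subseteq> E"
  shows "(\<Sum>e\<in>H. (s e)\<^sup>2 / ((s e)\<^sup>2 + t) * (v \<bullet> e)\<^sup>2) \<le> (\<Sum>f\<in>G. (u f)\<^sup>2 / ((u f)\<^sup>2 + t) * (v \<bullet> f)\<^sup>2)"
proof -
  note oF = orthonormal_inner[OF is_onb_orthonormal[OF F]]
  have s': "\<And>e. e \<in> E \<Longrightarrow> \<bar>s e\<bar> \<le> K" using s by force
  have u': "\<And>e. e \<in> F \<Longrightarrow> \<bar>u e\<bar> \<le> K" using u by force
  have v0: "v \<bullet> f = 0" if "f \<in> F" "f \<notin> G" for f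
  proof -
    have "v \<bullet> f = (\<Sum>g\<in>G. (v \<bullet> g) * (g \<bullet> f))" by (subst v) (simp add: inner_sum_left)
    also have "\<dots> = 0" using G that by (intro sum.neutral) (auto simp: oF subset_iff)
    finally show ?thesis .
  qed
  \<comment> \<open>\<open>b\<close> minimises the form belonging to \<open>u\<close>, namely b = t
    (U^2 + t)^(-1) v for the operator U with eigenvalues \<open>u\<close>. It then serves as a
    competitor in the form belonging to \<open>s\<close>.\<close>
  define w where "w f = t / ((u f)\<^sup>2 + t)" for f
  have w: "\<bar>w f\<bar> \<le> 1" for f using t by (simp add: w_def add_nonneg_pos)
  define b where "b = diag_op F w v"
  have b: "b \<bullet> f = w f * (v \<bullet> f)" if "f \<in> F" for f
    unfolding b_def by (rule diag_op_inner[OF F w that])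
  \<comment> \<open>In each coordinate the minimum over q of the right side is the left side; the
    difference is a square divided by x + t.\<close>
  have young: "x / (x + t) * p\<^sup>2 * t \<le> t * (p - q)\<^sup>2 + x * q\<^sup>2" if "0 \<le> x" for x p q :: real
  proof -
    have "0 \<le> (t * (p - q) - x * q)\<^sup>2 / (x + t)" using t that by simp
    also have "\<dots> = t * (p - q)\<^sup>2 + x * q\<^sup>2 - x / (x + t) * p\<^sup>2 * t"
      using t that by (simp add: field_simps power2_eq_square)
    finally show ?thesis by simp
  qed
  have S1: "((\<lambda>e. t * ((v - b) \<bullet> e)\<^sup>2 + (s e)\<^sup>2 * (b \<bullet> e)\<^sup>2) has_sum (t * (norm (v - b))\<^sup>2 + (norm (diag_op E s b))\<^sup>2)) E"
    by (intro has_sum_add has_sum_cmult_right parseval[OF E] diag_op_norm_has_sum[OF E s'])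
  have "(\<Sum>e\<in>H. (s e)\<^sup>2 / ((s e)\<^sup>2 + t) * (v \<bullet> e)\<^sup>2) * t
      \<le> (\<Sum>e\<in>H. t * ((v - b) \<bullet> e)\<^sup>2 + (s e)\<^sup>2 * (b \<bullet> e)\<^sup>2)"
    unfolding sum_distrib_right inner_diff_left by (intro sum_mono young) simp
  also have "\<dots> \<le> t * (norm (v - b))\<^sup>2 + (norm (diag_op E s b))\<^sup>2"
    by (rule finite_sum_le_has_sum[OF S1 H]) (use t in auto)
  also have "\<dots> \<le> t * (norm (v - b))\<^sup>2 + (norm (diag_op F u b))\<^sup>2"
    using le by (intro add_left_mono power_mono) auto
  also have "\<dots> = (\<Sum>f\<in>G. t * ((v - b) \<bullet> f)\<^sup>2 + (u f)\<^sup>2 * (b \<bullet> f)\<^sup>2)"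
  \<comment> \<open>The coordinates of \<open>v\<close> and \<open>b\<close> vanish outside
    \<open>G\<close>, so the series over \<open>F\<close> is a finite sum.\<close>
  proof (rule has_sum_unique)
    show S2: "((\<lambda>f. t * ((v - b) \<bullet> f)\<^sup>2 + (u f)\<^sup>2 * (b \<bullet> f)\<^sup>2) has_sum (t * (norm (v - b))\<^sup>2 + (norm (diag_op F u b))\<^sup>2)) F"
      by (intro has_sum_add has_sum_cmult_right parseval[OF F] diag_op_norm_has_sum[OF F u'])
    have "((\<lambda>f. t * ((v - b) \<bullet> f)\<^sup>2 + (u f)\<^sup>2 * (b \<bullet> f)\<^sup>2) has_sum (\<Sum>f\<in>G. t * ((v - b) \<bullet> f)\<^sup>2 + (u f)\<^sup>2 * (b \<bullet> f)\<^sup>2)) G"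
      using G by (intro has_sum_finiteI) auto
    then show "((\<lambda>f. t * ((v - b) \<bullet> f)\<^sup>2 + (u f)\<^sup>2 * (b \<bullet> f)\<^sup>2) has_sum (\<Sum>f\<in>G. t * ((v - b) \<bullet> f)\<^sup>2 + (u f)\<^sup>2 * (b \<bullet> f)\<^sup>2)) F"
      by (subst has_sum_cong_neutral[where T = G and g = "\<lambda>f. t * ((v - b) \<bullet> f)\<^sup>2 + (u f)\<^sup>2 * (b \<bullet> f)\<^sup>2"])
        (use G v0 in \<open>auto simp: inner_diff_left b\<close>)
  qed
  also have "\<dots> = (\<Sum>f\<in>G. (u f)\<^sup>2 / ((u f)\<^sup>2 + t) * (v \<bullet> f)\<^sup>2 * t)"
  proof (rule sum.cong)
    fix f assume "f \<in> G"
    then have f: "f \<in> F" using G by blast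
    have p: "(u f)\<^sup>2 + t > 0" using t by (simp add: add_nonneg_pos)
    have 1: "(v - b) \<bullet> f = (u f)\<^sup>2 / ((u f)\<^sup>2 + t) * (v \<bullet> f)"
      unfolding inner_diff_left b[OF f] w_def using p by (simp add: field_simps)
    have id: "t * (x / (x + t) * p)\<^sup>2 + x * (t / (x + t) * p)\<^sup>2 = x / (x + t) * p\<^sup>2 * t" if "x + t > 0" for x p :: real
    proof -
      have "t * (x / (x + t) * p)\<^sup>2 + x * (t / (x + t) * p)\<^sup>2 = (t * x * p\<^sup>2) * ((x + t) / (x + t)\<^sup>2)"
        by (simp add: power_divide power_mult_distrib add_divide_distrib power2_eq_square algebra_simps)
      also have "\<dots> = x / (x + t) * p\<^sup>2 * t" using that by (simp add: power2_eq_square)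
      finally show ?thesis .
    qed
    show "t * ((v - b) \<bullet> f)\<^sup>2 + (u f)\<^sup>2 * (b \<bullet> f)\<^sup>2 = (u f)\<^sup>2 / ((u f)\<^sup>2 + t) * (v \<bullet> f)\<^sup>2 * t"
      unfolding 1 b[OF f] w_def by (rule id[OF p])
  qed simp
  also have "\<dots> = (\<Sum>f\<in>G. (u f)\<^sup>2 / ((u f)\<^sup>2 + t) * (v \<bullet> f)\<^sup>2) * t" by (simp add: sum_distrib_right)
  finally show ?thesis using t by (simp add: mult_le_cancel_right)
qed

text \<open>The resolvent inequality, integrated against t powr (\<theta> - 1), yields the two sums
  of powers times the same constant \<open>?J\<close>, which is positive and finite and cancels.
  Finite \<open>G\<close> and \<open>H\<close> keep every integrand a finite sum.\<close>

private lemma powr_mono_finite: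
  assumes \<theta>: "0 < \<theta>" "\<theta> < 1" and G: "finite G" "G \<subseteq> F" and v: "v = (\<Sum>f\<in>G. (v \<bullet> f) *\<^sub>R f)"
    and H: "finite H" "H \<subseteq> E"
  shows "(\<Sum>e\<in>H. (s e powr \<theta>)\<^sup>2 * (v \<bullet> e)\<^sup>2) \<le> (\<Sum>f\<in>G. (u f powr \<theta>)\<^sup>2 * (v \<bullet> f)\<^sup>2)"
proof -
  let ?J = "\<integral>\<^sup>+t. powr_kernel \<theta> 1 t \<partial>lborel"
  have int: "(\<integral>\<^sup>+t. ennreal (\<Sum>e\<in>H. powr_kernel \<theta> ((x e)\<^sup>2) t * (v \<bullet> e)\<^sup>2) \<partial>lborel)
      = ennreal (\<Sum>e\<in>H. (x e powr \<theta>)\<^sup>2 * (v \<bullet> e)\<^sup>2) * ?J" if "finite H" "\<And>e. e \<in> H \<Longrightarrow> 0 < x e" for H and x :: "'a \<Rightarrow> real"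
  proof -
    have "(\<integral>\<^sup>+t. ennreal (\<Sum>e\<in>H. powr_kernel \<theta> ((x e)\<^sup>2) t * (v \<bullet> e)\<^sup>2) \<partial>lborel)
        = (\<integral>\<^sup>+t. (\<Sum>e\<in>H. ennreal (powr_kernel \<theta> ((x e)\<^sup>2) t) * ennreal ((v \<bullet> e)\<^sup>2)) \<partial>lborel)"
      by (simp add: sum_ennreal[symmetric] ennreal_mult powr_kernel_nonneg)
    also have "\<dots> = (\<Sum>e\<in>H. (\<integral>\<^sup>+t. powr_kernel \<theta> ((x e)\<^sup>2) t \<partial>lborel) * ennreal ((v \<bullet> e)\<^sup>2))"
      by (subst nn_integral_sum) (auto simp: nn_integral_multc)
    also have "\<dots> = (\<Sum>e\<in>H. ennreal ((x e powr \<theta>)\<^sup>2 * (v \<bullet> e)\<^sup>2) * ?J)"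
    proof (rule sum.cong)
      fix e assume "e \<in> H"
      then have x: "0 < x e" by (rule that(2))
      have "(x e)\<^sup>2 powr \<theta> = (x e powr \<theta>)\<^sup>2"
        using x by (simp add: power2_eq_square powr_mult)
      then show "(\<integral>\<^sup>+t. powr_kernel \<theta> ((x e)\<^sup>2) t \<partial>lborel) * ennreal ((v \<bullet> e)\<^sup>2) = ennreal ((x e powr \<theta>)\<^sup>2 * (v \<bullet> e)\<^sup>2) * ?J"
        using x powr_kernel_integral_scale[of "(x e)\<^sup>2" \<theta>] by (simp add: ennreal_mult ac_simps)
    qed simp
    also have "\<dots> = ennreal (\<Sum>e\<in>H. (x e powr \<theta>)\<^sup>2 * (v \<bullet> e)\<^sup>2) * ?J"
      by (simp add: sum_distrib_right[symmetric])
    finally show ?thesis .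
  qed
  have "ennreal (\<Sum>e\<in>H. (s e powr \<theta>)\<^sup>2 * (v \<bullet> e)\<^sup>2) * ?J
      = (\<integral>\<^sup>+t. ennreal (\<Sum>e\<in>H. powr_kernel \<theta> ((s e)\<^sup>2) t * (v \<bullet> e)\<^sup>2) \<partial>lborel)"
    using H s by (intro int[symmetric]) auto
  also have "\<dots> \<le> (\<integral>\<^sup>+t. ennreal (\<Sum>f\<in>G. powr_kernel \<theta> ((u f)\<^sup>2) t * (v \<bullet> f)\<^sup>2) \<partial>lborel)"
  proof (intro nn_integral_mono ennreal_leI)
    fix t :: real
    show "(\<Sum>e\<in>H. powr_kernel \<theta> ((s e)\<^sup>2) t * (v \<bullet> e)\<^sup>2) \<le> (\<Sum>f\<in>G. powr_kernel \<theta> ((u f)\<^sup>2) t * (v \<bullet> f)\<^sup>2)"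
    proof (cases "t > 0")
      case True
      then show ?thesis
        using mult_left_mono[OF resolvent_mono[OF True G v H], of "t powr (\<theta> - 1)"]
        by (simp add: powr_kernel_def sum_distrib_left mult.assoc)
    qed (simp add: powr_kernel_def)
  qed
  also have "\<dots> = ennreal (\<Sum>f\<in>G. (u f powr \<theta>)\<^sup>2 * (v \<bullet> f)\<^sup>2) * ?J"
    using G u by (intro int) auto
  finally show ?thesis
    using powr_kernel_integral_pos_finite[OF \<theta>]
    by (simp add: ennreal_mult_le_mult_iff mult.commute[of _ ?J] ennreal_le_iff sum_nonneg)
qed

text \<open>Hypothesis \<open>le\<close> compares the squares of the two operators as quadratic
  forms, so the resolvent argument runs on squared eigenvalues. Vectors with finitely many
  coordinates in \<open>F\<close> are treated directly, the others by continuity along their partial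
  sums.\<close>

theorem loewner_heinz:
  assumes \<theta>: "0 \<le> \<theta>" "\<theta> < 1"
  shows "norm (diag_op E (\<lambda>e. s e powr \<theta>) v) \<le> norm (diag_op F (\<lambda>f. u f powr \<theta>) v)"
proof -
  have sK: "\<And>e. e \<in> E \<Longrightarrow> \<bar>s e powr \<theta>\<bar> \<le> K powr \<theta>"
    using s \<theta> by (auto intro!: powr_mono2 simp: less_imp_le)
  have uK: "\<And>f. f \<in> F \<Longrightarrow> \<bar>u f powr \<theta>\<bar> \<le> K powr \<theta>"
    using u \<theta> by (auto intro!: powr_mono2 simp: less_imp_le)
  have fin: "norm (diag_op E (\<lambda>e. s e powr \<theta>) v) \<le> norm (diag_op F (\<lambda>f. u f powr \<theta>) v)"
    if G: "finite G" "G \<subseteq> F" and v: "v = (\<Sum>f\<in>G. (v \<bullet> f) *\<^sub>R f)" for G v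
  proof (cases "\<theta> = 0")
    \<comment> \<open>At \<theta> = 0 the kernel is not integrable; there both sides equal the norm
      of the vector.\<close>
    case True
    have "((\<lambda>e. (s e powr 0)\<^sup>2 * (v \<bullet> e)\<^sup>2) has_sum (norm v)\<^sup>2) E"
      using parseval[OF E, of v] by (subst has_sum_cong) (auto dest: s(1))
    note 1 = this
    have 2: "((\<lambda>f. (u f powr 0)\<^sup>2 * (v \<bullet> f)\<^sup>2) has_sum (norm v)\<^sup>2) F"
      using parseval[OF F, of v] by (subst has_sum_cong) (auto dest: u(1))
    have 3: "((\<lambda>e. (s e powr \<theta>)\<^sup>2 * (v \<bullet> e)\<^sup>2) has_sum (norm (diag_op E (\<lambda>e. s e powr \<theta>) v))\<^sup>2) E"
      by (rule diag_op_norm_has_sum[OF E sK])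
    have 4: "((\<lambda>f. (u f powr \<theta>)\<^sup>2 * (v \<bullet> f)\<^sup>2) has_sum (norm (diag_op F (\<lambda>f. u f powr \<theta>) v))\<^sup>2) F"
      by (rule diag_op_norm_has_sum[OF F uK])
    have "(norm v)\<^sup>2 = (norm (diag_op E (\<lambda>e. s e powr \<theta>) v))\<^sup>2"
      unfolding True by (rule has_sum_unique[OF 1 3[unfolded True]])
    moreover have "(norm v)\<^sup>2 = (norm (diag_op F (\<lambda>f. u f powr \<theta>) v))\<^sup>2"
      unfolding True by (rule has_sum_unique[OF 2 4[unfolded True]])
    ultimately show ?thesis by simp
  next
    case False
    with \<theta> have \<theta>': "0 < \<theta>" by simp
    have "(norm (diag_op E (\<lambda>e. s e powr \<theta>) v))\<^sup>2 \<le> (\<Sum>f\<in>G. (u f powr \<theta>)\<^sup>2 * (v \<bullet> f)\<^sup>2)"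
    proof (rule has_sum_le_finite_sums[OF diag_op_norm_has_sum[OF E sK]])
      fix H assume "finite H" "H \<subseteq> E"
      then show "(\<Sum>e\<in>H. (s e powr \<theta>)\<^sup>2 * (v \<bullet> e)\<^sup>2) \<le> (\<Sum>f\<in>G. (u f powr \<theta>)\<^sup>2 * (v \<bullet> f)\<^sup>2)"
        by (rule powr_mono_finite[OF \<theta>' \<theta>(2) G v])
    qed
    also have "\<dots> \<le> (norm (diag_op F (\<lambda>f. u f powr \<theta>) v))\<^sup>2"
      by (rule finite_sum_le_has_sum[OF diag_op_norm_has_sum[OF F uK] G]) auto
    finally show ?thesis by (rule power2_le_imp_le) simp
  qed
  note oF = orthonormal_inner[OF is_onb_orthonormal[OF F]]
  let ?P = "\<lambda>G. \<Sum>f\<in>G. (v \<bullet> f) *\<^sub>R f"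
  have lim: "(?P \<longlongrightarrow> v) (finite_subsets_at_top F)"
    using onb_has_sum[OF F, of v] unfolding has_sum_def .
  show ?thesis
  proof (rule tendsto_le)
    show "((\<lambda>G. norm (diag_op F (\<lambda>f. u f powr \<theta>) (?P G))) \<longlongrightarrow> norm (diag_op F (\<lambda>f. u f powr \<theta>) v)) (finite_subsets_at_top F)"
      by (intro tendsto_norm blinfun.tendsto tendsto_const lim)
    show "((\<lambda>G. norm (diag_op E (\<lambda>f. s f powr \<theta>) (?P G))) \<longlongrightarrow> norm (diag_op E (\<lambda>f. s f powr \<theta>) v)) (finite_subsets_at_top F)"
      by (intro tendsto_norm blinfun.tendsto tendsto_const lim)
    show "\<forall>\<^sub>F G in finite_subsets_at_top F. norm (diag_op E (\<lambda>f. s f powr \<theta>) (?P G)) \<le> norm (diag_op F (\<lambda>f. u f powr \<theta>) (?P G))"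
    proof (rule eventually_finite_subsets_at_top_weakI)
      fix G assume G: "finite G" "G \<subseteq> F"
      have "?P G \<bullet> f = v \<bullet> f" if "f \<in> G" for f
      proof -
        have "?P G \<bullet> f = (\<Sum>g\<in>G. if g = f then v \<bullet> g else 0)"
          unfolding inner_sum_left by (rule sum.cong) (use G that in \<open>auto simp: oF subset_iff\<close>)
        also have "\<dots> = v \<bullet> f" using G that by simp
        finally show ?thesis .
      qed
      then have "?P G = (\<Sum>f\<in>G. (?P G \<bullet> f) *\<^sub>R f)" by simp
      from fin[OF G this] show "norm (diag_op E (\<lambda>f. s f powr \<theta>) (?P G)) \<le> norm (diag_op F (\<lambda>f. u f powr \<theta>) (?P G))" .
    qed
  qed simp
qed

end

section \<open>Perturbation of a resolvent\<close>

lemma norm_diag_op_mono: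
  fixes E :: "'a::{real_inner, banach} set"
  assumes E: "is_onb E"
    and f: "\<And>e. e \<in> E \<Longrightarrow> \<bar>f e\<bar> \<le> K" and g: "\<And>e. e \<in> E \<Longrightarrow> \<bar>g e\<bar> \<le> K'"
    and c: "0 \<le> c" and le: "\<And>e. e \<in> E \<Longrightarrow> \<bar>f e * (v \<bullet> e)\<bar> \<le> c * \<bar>g e * (w \<bullet> e)\<bar>"
  shows "norm (diag_op E f v) \<le> c * norm (diag_op E g w)"
proof (rule power2_le_imp_le)
  have "(f e)\<^sup>2 * (v \<bullet> e)\<^sup>2 \<le> c\<^sup>2 * ((g e)\<^sup>2 * (w \<bullet> e)\<^sup>2)" if "e \<in> E" for e
  proof -
    have "\<bar>f e * (v \<bullet> e)\<bar>\<^sup>2 \<le> (c * \<bar>g e * (w \<bullet> e)\<bar>)\<^sup>2" by (rule power_mono[OF le[OF that]]) simp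
    then show ?thesis by (simp add: power_mult_distrib)
  qed
  note termwise = this
  have 1: "((\<lambda>e. (f e)\<^sup>2 * (v \<bullet> e)\<^sup>2) has_sum (norm (diag_op E f v))\<^sup>2) E"
    by (rule diag_op_norm_has_sum[OF E f])
  have 2: "((\<lambda>e. c\<^sup>2 * ((g e)\<^sup>2 * (w \<bullet> e)\<^sup>2)) has_sum c\<^sup>2 * (norm (diag_op E g w))\<^sup>2) E"
    by (rule has_sum_cmult_right[OF diag_op_norm_has_sum[OF E g]])
  have "(norm (diag_op E f v))\<^sup>2 \<le> c\<^sup>2 * (norm (diag_op E g w))\<^sup>2"
    by (rule has_sum_mono[OF 1 2 termwise])
  then show "(norm (diag_op E f v))\<^sup>2 \<le> (c * norm (diag_op E g w))\<^sup>2" by (simp add: power_mult_distrib)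
qed (use c in simp)

lemma diag_op_compose:
  fixes E :: "'a::{real_inner, banach} set"
  assumes E: "is_onb E"
    and f: "\<And>e. e \<in> E \<Longrightarrow> \<bar>f e\<bar> \<le> K" and g: "\<And>e. e \<in> E \<Longrightarrow> \<bar>g e\<bar> \<le> K'"
    and h: "\<And>e. e \<in> E \<Longrightarrow> h e = f e * g e"
  shows "diag_op E f (diag_op E g v) = diag_op E h v"
proof -
  have "\<bar>h e\<bar> \<le> K * K'" if "e \<in> E" for e
    unfolding h[OF that] abs_mult using f[OF that] g[OF that] by (intro mult_mono) auto
  note hK = this
  have 1: "diag_op E f v \<bullet> e = f e * (v \<bullet> e)" if "e \<in> E" for v e
    by (rule diag_op_inner[OF E f that])
  have 2: "diag_op E g v \<bullet> e = g e * (v \<bullet> e)" if "e \<in> E" for v e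
    by (rule diag_op_inner[OF E g that])
  show ?thesis
    by (rule diag_op_eqI[OF E hK]) (simp_all add: 1 2 h)
qed

text \<open>\<open>close\<close> bounds the Hilbert-Schmidt norm of (D - C)(C + lam)^(-1/2) by
  \<open>T\<close>, column by column in the eigenbasis of \<open>C\<close>. With \<open>T\<close> at
  most sqrt lam / 2 the relative perturbation \<Delta> of the resolvent is at most 1/2.\<close>

locale perturbed_operator =
  fixes C D :: "'h::{real_inner, banach} \<Rightarrow>\<^sub>L 'h" and E F :: "'h set"
    and \<mu> \<sigma> :: "'h \<Rightarrow> real" and lam T :: real
  assumes E: "is_onb E" and F: "is_onb F"
    and \<mu>: "\<And>e. e \<in> E \<Longrightarrow> C e = \<mu> e *\<^sub>R e" and \<sigma>: "\<And>f. f \<in> F \<Longrightarrow> D f = \<sigma> f *\<^sub>R f"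
    and \<mu>0: "\<And>e. e \<in> E \<Longrightarrow> 0 \<le> \<mu> e" and \<sigma>0: "\<And>f. f \<in> F \<Longrightarrow> 0 \<le> \<sigma> f"
    and D_sa: "\<And>u v. D u \<bullet> v = u \<bullet> D v"
    and lam: "0 < lam"
    and T0: "0 \<le> T" and T: "T \<le> sqrt lam / 2"
    and close: "\<And>G. finite G \<Longrightarrow> G \<subseteq> E \<Longrightarrow> (\<Sum>e\<in>G. (norm (D e - C e))\<^sup>2 / (\<mu> e + lam)) \<le> T\<^sup>2"
begin

definition \<Delta> :: real where "\<Delta> = T / sqrt lam"

definition a :: "'h \<Rightarrow> real" where "a e = lam / (\<mu> e + lam)"

definition b :: "'h \<Rightarrow> real" where "b f = lam / (\<sigma> f + lam)"

abbreviation A where "A \<equiv> diag_op E a"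

abbreviation B where "B \<equiv> diag_op F b"

lemma \<Delta>: "0 \<le> \<Delta>" "\<Delta> \<le> 1 / 2"
  using T0 T lam by (auto simp: \<Delta>_def field_simps)

lemma a: "e \<in> E \<Longrightarrow> 0 < a e" "e \<in> E \<Longrightarrow> a e \<le> 1"
  using \<mu>0 lam by (auto simp: a_def add_nonneg_pos)

lemma b: "f \<in> F \<Longrightarrow> 0 < b f" "f \<in> F \<Longrightarrow> b f \<le> 1"
  using \<sigma>0 lam by (auto simp: b_def add_nonneg_pos)

lemma a_powr: "0 \<le> x \<Longrightarrow> e \<in> E \<Longrightarrow> \<bar>a e powr x\<bar> \<le> 1"
  using a by (simp add: powr_le1 less_imp_le)

lemma b_powr: "0 \<le> x \<Longrightarrow> f \<in> F \<Longrightarrow> \<bar>b f powr x\<bar> \<le> 1"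
  using b by (simp add: powr_le1 less_imp_le)

lemma a_abs: "e \<in> E \<Longrightarrow> \<bar>a e\<bar> \<le> 1" and b_abs: "f \<in> F \<Longrightarrow> \<bar>b f\<bar> \<le> 1"
  using a b by (auto simp: less_imp_le abs_of_pos)

lemma a_power: "e \<in> E \<Longrightarrow> \<bar>a e ^ k\<bar> \<le> 1" and b_power: "f \<in> F \<Longrightarrow> \<bar>b f ^ k\<bar> \<le> 1"
  using a_abs b_abs by (auto simp: power_abs power_le_one)

lemma A_inner: "e \<in> E \<Longrightarrow> A v \<bullet> e = a e * (v \<bullet> e)" and B_inner: "f \<in> F \<Longrightarrow> B v \<bullet> f = b f * (v \<bullet> f)"
  by (rule diag_op_inner[OF E a_abs], assumption+) (rule diag_op_inner[OF F b_abs], assumption+)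

text \<open>Resolvent identity A - B = (C + lam)^(-1) (D - C) B, tested against an eigenvector of
  \<open>C\<close>; self-adjointness moves D - C to that eigenvector, where \<open>close\<close>
  applies.\<close>

lemma diff_inner:
  assumes e: "e \<in> E"
  shows "(A w - B w) \<bullet> e = (B w \<bullet> (D e - C e)) / (\<mu> e + lam)"
proof -
  let ?u = "B w"
  have "D ?u + lam *\<^sub>R ?u = lam *\<^sub>R w"
  proof (rule onb_eqI[OF F])
    fix f assume f: "f \<in> F"
    have "0 < \<sigma> f + lam" using \<sigma>0[OF f] lam by simp
    then have "(\<sigma> f + lam) * b f = lam" by (simp add: b_def)
    moreover have "(D ?u + lam *\<^sub>R ?u) \<bullet> f = ((\<sigma> f + lam) * b f) * (w \<bullet> f)"
      by (simp add: inner_add_left D_sa \<sigma> f B_inner algebra_simps)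
    ultimately show "(D ?u + lam *\<^sub>R ?u) \<bullet> f = lam *\<^sub>R w \<bullet> f" by simp
  qed
  then have "(D ?u + lam *\<^sub>R ?u) \<bullet> e = lam * (w \<bullet> e)" by simp
  then have 1: "?u \<bullet> D e + lam * (?u \<bullet> e) = lam * (w \<bullet> e)" by (simp add: inner_add_left D_sa)
  have "0 < \<mu> e + lam" using \<mu>0[OF e] lam by simp
  then show ?thesis
    unfolding inner_diff_left A_inner[OF e] inner_diff_right
    using 1 by (simp add: a_def \<mu> e field_simps)
qed

text \<open>Squaring the resolvent identity produces two factors \<mu> e + lam: one is bounded below
  by lam, the other is the weight in \<open>close\<close>.\<close>

lemma norm_diff_le: "norm (A w - B w) \<le> \<Delta> * norm (B w)"
proof (rule power2_le_imp_le)
  let ?u = "B w"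
  show "(norm (A w - B w))\<^sup>2 \<le> (\<Delta> * norm ?u)\<^sup>2"
  proof (rule has_sum_le_finite_sums[OF parseval[OF E]])
    fix G assume G: "finite G" "G \<subseteq> E"
    have "(\<Sum>e\<in>G. ((A w - B w) \<bullet> e)\<^sup>2) \<le> (\<Sum>e\<in>G. ((norm ?u)\<^sup>2 / lam) * ((norm (D e - C e))\<^sup>2 / (\<mu> e + lam)))"
    proof (rule sum_mono)
      fix e assume "e \<in> G"
      then have e: "e \<in> E" using G by blast
      have p: "0 < \<mu> e + lam" "lam \<le> \<mu> e + lam" using \<mu>0[OF e] lam by auto
      have "(?u \<bullet> (D e - C e))\<^sup>2 \<le> (norm ?u * norm (D e - C e))\<^sup>2"
        using Cauchy_Schwarz_ineq2[of ?u "D e - C e"] by (metis abs_ge_zero power2_abs power_mono)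
      then have "((A w - B w) \<bullet> e)\<^sup>2 \<le> ((norm ?u)\<^sup>2 * (norm (D e - C e))\<^sup>2) / ((\<mu> e + lam) * (\<mu> e + lam))"
        unfolding diff_inner[OF e] using p
        by (simp add: power_divide power_mult_distrib power2_eq_square[of "\<mu> e + lam"] divide_right_mono)
      also have "\<dots> \<le> ((norm ?u)\<^sup>2 * (norm (D e - C e))\<^sup>2) / (lam * (\<mu> e + lam))"
        using p lam by (intro divide_left_mono mult_right_mono mult_pos_pos) auto
      finally show "((A w - B w) \<bullet> e)\<^sup>2 \<le> ((norm ?u)\<^sup>2 / lam) * ((norm (D e - C e))\<^sup>2 / (\<mu> e + lam))"
        by simp
    qed
    also have "\<dots> = ((norm ?u)\<^sup>2 / lam) * (\<Sum>e\<in>G. (norm (D e - C e))\<^sup>2 / (\<mu> e + lam))"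
      by (rule sum_distrib_left[symmetric])
    also have "\<dots> \<le> ((norm ?u)\<^sup>2 / lam) * T\<^sup>2"
      using lam by (intro mult_left_mono close G) auto
    also have "\<dots> = (\<Delta> * norm ?u)\<^sup>2"
      using lam by (simp add: \<Delta>_def power_mult_distrib power_divide)
    finally show "(\<Sum>e\<in>G. ((A w - B w) \<bullet> e)\<^sup>2) \<le> (\<Delta> * norm ?u)\<^sup>2" .
  qed
qed (use \<Delta> in simp)

lemma A_contraction: "norm (A w) \<le> norm w"
proof -
  have "norm (A w) \<le> \<bar>1\<bar> * norm w" by (rule norm_diag_op_le[OF E a_abs])
  then show ?thesis by simp
qed

text \<open>norm (B w) is at most norm (A w) plus half of itself, and that half is absorbed on the
  left.\<close>

lemma B_le_A: "norm (B w) \<le> 2 * norm (A w)"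
proof -
  have "norm (B w) \<le> norm (A w) + norm (A w - B w)"
    using norm_triangle_ineq2[of "B w" "A w"] by (simp add: norm_minus_commute)
  also have "norm (A w - B w) \<le> (1 / 2) * norm (B w)"
    using norm_diff_le \<Delta>(2) by (rule order_trans[OF _ mult_right_mono]) simp
  finally show ?thesis by simp
qed

text \<open>Loewner-Heinz for \<open>B\<close> and 2 A. Powers above 1 do not preserve operator
  inequalities, which is why integer exponents are treated by telescoping.\<close>

lemma B_powr_le:
  assumes \<theta>: "0 \<le> \<theta>" "\<theta> < 1"
  shows "norm (diag_op F (\<lambda>f. b f powr \<theta>) w) \<le> 2 powr \<theta> * norm (diag_op E (\<lambda>e. a e powr \<theta>) w)"
proof -
  have a2: "\<bar>2 * a e\<bar> \<le> 2" if "e \<in> E" for e using a[OF that] by simp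
  have "norm (diag_op F (\<lambda>f. b f powr \<theta>) w) \<le> norm (diag_op E (\<lambda>e. (2 * a e) powr \<theta>) w)"
  proof (rule loewner_heinz[OF F E, where K = 2])
    fix v
    have "2 *\<^sub>R A v = diag_op E (\<lambda>e. 2 * a e) v"
      by (rule diag_op_eqI[OF E a2]) (simp_all add: A_inner)
    then show "norm (B v) \<le> norm (diag_op E (\<lambda>e. 2 * a e) v)"
      using B_le_A[of v] by (metis norm_scaleR abs_numeral)
    show "b f \<le> 2" if "f \<in> F" for f using b(2)[OF that] by simp
  qed (use a b \<theta> in auto)
  also have "\<dots> \<le> 2 powr \<theta> * norm (diag_op E (\<lambda>e. a e powr \<theta>) w)"
  proof (rule norm_diag_op_mono[OF E _ a_powr[OF \<theta>(1)]])
    fix e assume e: "e \<in> E"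
    show "\<bar>(2 * a e) powr \<theta>\<bar> \<le> 2 powr \<theta>"
      using a[OF e] \<theta> by (auto intro!: powr_mono2)
    show "\<bar>(2 * a e) powr \<theta> * (w \<bullet> e)\<bar> \<le> 2 powr \<theta> * \<bar>a e powr \<theta> * (w \<bullet> e)\<bar>"
      using a[OF e] by (simp add: powr_mult abs_mult)
  qed auto
  finally show ?thesis .
qed

text \<open>A^(k+1) - B^(k+1) = A (A^k - B^k) + (A - B) B^k; both operators are contractions, so
  each step adds one \<Delta>.\<close>

lemma power_diff_le: "norm (diag_op E (\<lambda>e. a e ^ k) h - diag_op F (\<lambda>f. b f ^ k) h) \<le> real k * \<Delta> * norm h"
proof (induction k)
  case 0
  have "h = diag_op E (\<lambda>e. a e ^ 0) h" "h = diag_op F (\<lambda>f. b f ^ 0) h"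
    by (rule diag_op_eqI[OF E a_power[of _ 0]] diag_op_eqI[OF F b_power[of _ 0]]; simp)+
  then show ?case by simp
next
  case (Suc k)
  let ?A = "\<lambda>k. diag_op E (\<lambda>e. a e ^ k)" and ?B = "\<lambda>k. diag_op F (\<lambda>f. b f ^ k)"
  have S1: "A (?A k h) = ?A (Suc k) h" by (rule diag_op_compose[OF E a_abs a_power]) simp_all
  have S2: "B (?B k h) = ?B (Suc k) h" by (rule diag_op_compose[OF F b_abs b_power]) simp_all
  note S = S1[symmetric] S2[symmetric]
  have split: "?A (Suc k) h - ?B (Suc k) h = A (?A k h - ?B k h) + (A (?B k h) - B (?B k h))"
    unfolding S by (simp add: blinfun.diff_right)
  have "norm (?A (Suc k) h - ?B (Suc k) h) \<le> norm (A (?A k h - ?B k h)) + norm (A (?B k h) - B (?B k h))"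
    unfolding split by (rule norm_triangle_ineq)
  also have "\<dots> \<le> real k * \<Delta> * norm h + \<Delta> * norm h"
  proof (rule add_mono)
    show "norm (A (?A k h - ?B k h)) \<le> real k * \<Delta> * norm h"
      by (rule order_trans[OF A_contraction Suc.IH])
    have "norm (A (?B k h) - B (?B k h)) \<le> \<Delta> * norm (B (?B k h))" by (rule norm_diff_le)
    also have "\<dots> \<le> \<Delta> * norm h"
    proof (rule mult_left_mono[OF _ \<Delta>(1)])
      have "norm (?B (Suc k) h) \<le> \<bar>1\<bar> * norm h" by (rule norm_diag_op_le[OF F b_power])
      then show "norm (B (?B k h)) \<le> norm h" unfolding S2 by simp
    qed
    finally show "norm (A (?B k h) - B (?B k h)) \<le> \<Delta> * norm h" .
  qed
  finally show ?case by (simp add: algebra_simps)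
qed

text \<open>With k the integer part, B^\<nu> = B^\<theta> A^k - B^\<theta> (A^k - B^k). Only the
  fractional power is compared by Loewner-Heinz, so the factor is 2 powr \<theta> rather than 2 powr
  \<nu>.\<close>

lemma B_powr_le_bias:
  assumes \<nu>: "0 \<le> \<nu>"
  defines "\<theta> \<equiv> \<nu> - of_int \<lfloor>\<nu>\<rfloor>"
  shows "norm (diag_op F (\<lambda>f. b f powr \<nu>) h)
    \<le> 2 powr \<theta> * norm (diag_op E (\<lambda>e. a e powr \<nu>) h) + of_int \<lfloor>\<nu>\<rfloor> * \<Delta> * norm h"
proof -
  define k where "k = nat \<lfloor>\<nu>\<rfloor>"
  have k: "real k = of_int \<lfloor>\<nu>\<rfloor>" using \<nu> by (simp add: k_def)
  have \<theta>: "0 \<le> \<theta>" "\<theta> < 1" unfolding \<theta>_def by linarith+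
  let ?A = "diag_op E (\<lambda>e. a e ^ k)" and ?B = "diag_op F (\<lambda>f. b f ^ k)"
  let ?A\<theta> = "diag_op E (\<lambda>e. a e powr \<theta>)" and ?B\<theta> = "diag_op F (\<lambda>f. b f powr \<theta>)"
  have split: "x powr \<nu> = x powr \<theta> * x ^ k" if "0 < x" for x :: real
    using that by (simp add: \<theta>_def k[symmetric] powr_diff powr_realpow)
  have B: "?B\<theta> (?B h) = diag_op F (\<lambda>f. b f powr \<nu>) h"
    by (rule diag_op_compose[OF F b_powr[OF \<theta>(1)] b_power]) (simp_all add: split b)
  have A: "?A\<theta> (?A h) = diag_op E (\<lambda>e. a e powr \<nu>) h"
    by (rule diag_op_compose[OF E a_powr[OF \<theta>(1)] a_power]) (simp_all add: split a)
  have diff: "?B\<theta> (?B h) = ?B\<theta> (?A h) - ?B\<theta> (?A h - ?B h)" by (simp add: blinfun.diff_right)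
  have "norm (?B\<theta> (?B h)) \<le> norm (?B\<theta> (?A h)) + norm (?B\<theta> (?A h - ?B h))"
    unfolding diff by (rule norm_triangle_ineq4)
  also have "\<dots> \<le> 2 powr \<theta> * norm (?A\<theta> (?A h)) + real k * \<Delta> * norm h"
  proof (rule add_mono)
    show "norm (?B\<theta> (?A h)) \<le> 2 powr \<theta> * norm (?A\<theta> (?A h))" by (rule B_powr_le[OF \<theta>])
    show "norm (?B\<theta> (?A h - ?B h)) \<le> real k * \<Delta> * norm h"
    proof -
      have "norm (?B\<theta> (?A h - ?B h)) \<le> \<bar>1\<bar> * norm (?A h - ?B h)"
        by (rule norm_diag_op_le[OF F b_powr[OF \<theta>(1)]])
      then show ?thesis using power_diff_le[of k h] by simp
    qed
  qed
  finally show ?thesis unfolding A B k .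
qed

lemma residual_le:
  assumes \<nu>: "0 \<le> \<nu>" and K: "0 \<le> K"
    and r: "\<And>f. f \<in> F \<Longrightarrow> \<bar>r f\<bar> \<le> K * b f powr \<nu>"
  shows "norm (diag_op F r h)
    \<le> K * (2 powr (\<nu> - of_int \<lfloor>\<nu>\<rfloor>) * norm (diag_op E (\<lambda>e. a e powr \<nu>) h) + of_int \<lfloor>\<nu>\<rfloor> * \<Delta> * norm h)"
proof -
  have rK: "\<bar>r f\<bar> \<le> K" if "f \<in> F" for f
    using r[OF that] mult_left_mono[OF b_powr[OF \<nu> that] K] by simp
  have "norm (diag_op F r h) \<le> K * norm (diag_op F (\<lambda>f. b f powr \<nu>) h)"
  proof (rule norm_diag_op_mono[OF F rK b_powr[OF \<nu>] K])
    fix f assume f: "f \<in> F"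
    have "\<bar>r f * (h \<bullet> f)\<bar> \<le> (K * b f powr \<nu>) * \<bar>h \<bullet> f\<bar>"
      unfolding abs_mult by (rule mult_right_mono[OF r[OF f]]) simp
    then show "\<bar>r f * (h \<bullet> f)\<bar> \<le> K * \<bar>b f powr \<nu> * (h \<bullet> f)\<bar>" by (simp add: abs_mult)
  qed
  also have "\<dots> \<le> K * (2 powr (\<nu> - of_int \<lfloor>\<nu>\<rfloor>) * norm (diag_op E (\<lambda>e. a e powr \<nu>) h) + of_int \<lfloor>\<nu>\<rfloor> * \<Delta> * norm h)"
    using K by (intro mult_left_mono B_powr_le_bias \<nu>)
  finally show ?thesis .
qed

text \<open>The square root in the bound on \<open>g\<close> is B^(1/2), which Loewner-Heinz
  replaces by sqrt 2 times A^(1/2); in the eigenbasis of \<open>C\<close> the latter is the weighted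
  sum bounded by \<open>S\<close>. The alternative \<open>m \<bullet> f = 0\<close> is for
  eigenvalue 0, where the regularization function is uncontrolled.\<close>

lemma noise_le:
  assumes K: "0 \<le> K" and g: "\<And>f. f \<in> F \<Longrightarrow> \<bar>g f\<bar> \<le> K'"
    and r: "\<And>f. f \<in> F \<Longrightarrow> m \<bullet> f = 0 \<or> \<bar>g f\<bar> \<le> K * sqrt (b f)"
    and m: "\<And>G. finite G \<Longrightarrow> G \<subseteq> E \<Longrightarrow> (\<Sum>e\<in>G. (m \<bullet> e)\<^sup>2 / (\<mu> e + lam)) \<le> S"
  shows "norm (diag_op F g m) \<le> K * sqrt (2 * lam * S)"
proof -
  have half: "0 \<le> (1 / 2 :: real)" by simp
  have "norm (diag_op F g m) \<le> K * norm (diag_op F (\<lambda>f. b f powr (1 / 2)) m)"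
  proof (rule norm_diag_op_mono[OF F g b_powr[OF half] K])
    fix f assume f: "f \<in> F"
    show "\<bar>g f * (m \<bullet> f)\<bar> \<le> K * \<bar>b f powr (1 / 2) * (m \<bullet> f)\<bar>"
    proof (cases "m \<bullet> f = 0")
      case False
      with r[OF f] have "\<bar>g f\<bar> * \<bar>m \<bullet> f\<bar> \<le> (K * sqrt (b f)) * \<bar>m \<bullet> f\<bar>"
        by (intro mult_right_mono) auto
      then show ?thesis using b[OF f] by (simp add: abs_mult powr_half_sqrt)
    qed simp
  qed
  also have "norm (diag_op F (\<lambda>f. b f powr (1 / 2)) m) \<le> 2 powr (1 / 2) * norm (diag_op E (\<lambda>e. a e powr (1 / 2)) m)"
    by (rule B_powr_le) auto
  also have "norm (diag_op E (\<lambda>e. a e powr (1 / 2)) m) \<le> sqrt (lam * S)"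
  proof (rule real_le_rsqrt)
    show "(norm (diag_op E (\<lambda>e. a e powr (1 / 2)) m))\<^sup>2 \<le> lam * S"
    proof (rule has_sum_le_finite_sums[OF diag_op_norm_has_sum[OF E a_powr[OF half]]])
      fix G assume G: "finite G" "G \<subseteq> E"
      have "(\<Sum>e\<in>G. (a e powr (1 / 2))\<^sup>2 * (m \<bullet> e)\<^sup>2) = (\<Sum>e\<in>G. lam * ((m \<bullet> e)\<^sup>2 / (\<mu> e + lam)))"
      proof (rule sum.cong)
        fix e assume "e \<in> G"
        then have "0 < a e" using G a(1) by blast
        then have "(a e powr (1 / 2))\<^sup>2 = a e" by (simp add: powr_half_sqrt)
        then show "(a e powr (1 / 2))\<^sup>2 * (m \<bullet> e)\<^sup>2 = lam * ((m \<bullet> e)\<^sup>2 / (\<mu> e + lam))"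
          by (simp add: a_def)
      qed simp
      also have "\<dots> \<le> lam * S"
        unfolding sum_distrib_left[symmetric] using lam by (intro mult_left_mono m G) auto
      finally show "(\<Sum>e\<in>G. (a e powr (1 / 2))\<^sup>2 * (m \<bullet> e)\<^sup>2) \<le> lam * S" .
    qed
  qed
  also have "2 powr (1 / 2) * sqrt (lam * S) = sqrt (2 * lam * S)"
    by (simp add: powr_half_sqrt real_sqrt_mult)
  finally show ?thesis using K by (simp add: mult_left_mono)
qed

end

section \<open>Reproducing kernel Hilbert spaces\<close>

lemma inner_eqI:
  fixes u v :: "'a::real_inner"
  assumes "\<And>y. u \<bullet> y = v \<bullet> y"
  shows "u = v"
  using assms[of "u - v"] inner_eq_zero_iff[of "u - v"] by (simp add: inner_diff_left)

lemma rkhs_injD: "is_rkhs K rep \<Longrightarrow> inj rep" by (simp add: is_rkhs_def)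

lemma kernel_Id_apply [simp]: "blinfun_apply (kernel_Id k x t) y = k x t *\<^sub>R y"
  by (simp add: kernel_Id_def blinfun.scaleR_left)

text \<open>\<open>\<kappa> x y\<close> is the section K(., x) y as a vector of the Hilbert space;
  with it the representation map no longer has to be inverted by hand.\<close>

lemma rkhs_kernel_section:
  assumes "is_rkhs (kernel_Id k) rep"
  shows "\<exists>\<kappa>. (\<forall>x y t. rep (\<kappa> x y) t = k t x *\<^sub>R y) \<and> (\<forall>g x y. rep g x \<bullet> y = g \<bullet> \<kappa> x y) \<and>
    (\<forall>x y. \<kappa> x y = inv rep (\<lambda>t. k t x *\<^sub>R y))"
proof (intro exI conjI allI)
  let ?\<kappa> = "\<lambda>x y. inv rep (\<lambda>t. k t x *\<^sub>R y)"
  show "rep (?\<kappa> x y) t = k t x *\<^sub>R y" for x y t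
    using assms by (subst f_inv_into_f) (auto simp: is_rkhs_def)
  show "rep g x \<bullet> y = g \<bullet> ?\<kappa> x y" for g x y
    using assms by (simp add: is_rkhs_def)
qed (rule refl)

text \<open>\<open>feature\<close> fixes the first argument of the kernel, the reproducing property
  the second; symmetry, read off from the Gram representation, identifies the two sections. The
  third part is totality of the feature vectors, by injectivity of \<open>rep\<close>.\<close>

lemma scalar_rkhs_feature:
  fixes rep :: "'h::{real_inner, complete_space} \<Rightarrow> 'x \<Rightarrow> real"
  assumes rk: "is_rkhs (kernel_Id k) rep"
  shows "rep h x = h \<bullet> feature k rep x"
    and "feature k rep x \<bullet> feature k rep t = k x t"
    and "(\<And>x. h \<bullet> feature k rep x = 0) \<Longrightarrow> h = 0"
proof -
  obtain \<kappa> where \<kappa>: "\<And>x y t. rep (\<kappa> x y) t = k t x *\<^sub>R y" "\<And>g x y. rep g x \<bullet> y = g \<bullet> \<kappa> x y"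
    "\<And>x y. \<kappa> x y = inv rep (\<lambda>t. k t x *\<^sub>R y)"
    using rkhs_kernel_section[OF rk] by blast
  have rep: "rep h x = h \<bullet> \<kappa> x 1" for h x using \<kappa>(2)[of h x 1] by simp
  have kk: "k t x = \<kappa> x 1 \<bullet> \<kappa> t 1" for t x using \<kappa>(1)[of x 1 t] by (simp add: rep)
  have sym: "k t x = k x t" for t x by (simp add: kk inner_commute)
  have f: "feature k rep x = \<kappa> x 1" for x
  proof -
    have "k x = (\<lambda>t. k t x *\<^sub>R 1)" by (simp add: sym fun_eq_iff)
    then show ?thesis by (simp add: feature_def \<kappa>(3))
  qed
  show "rep h x = h \<bullet> feature k rep x" by (simp add: rep f)
  show "feature k rep x \<bullet> feature k rep t = k x t" by (simp add: f kk[symmetric] sym)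
  assume "\<And>x. h \<bullet> feature k rep x = 0"
  then have "rep h = rep 0" by (simp add: rep f fun_eq_iff)
  then show "h = 0" using rkhs_injD[OF rk] by (simp add: inj_eq)
qed

context
  fixes k :: "'x \<Rightarrow> 'x \<Rightarrow> real"
    and repH :: "'h::{real_inner, banach} \<Rightarrow> 'x \<Rightarrow> real"
    and repG :: "'g::{real_inner, banach} \<Rightarrow> 'x \<Rightarrow> 'y::{real_inner, banach}"
    and \<phi> :: "'x \<Rightarrow> 'h"
  assumes H: "is_rkhs (kernel_Id k) repH" and G: "is_rkhs (kernel_Id k) repG"
    and \<phi>: "\<phi> = feature k repH"
begin

private lemma dense: "closure (span (range \<phi>)) = UNIV"
proof (rule closed_subspace_eq_UNIV[OF subspace_closure_span closed_closure])
  fix h assume h: "\<And>s. s \<in> closure (span (range \<phi>)) \<Longrightarrow> h \<bullet> s = 0"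
  have "range \<phi> \<subseteq> closure (span (range \<phi>))" using span_superset closure_subset by (rule order_trans)
  then show "h = 0" using scalar_rkhs_feature(3)[OF H] h unfolding \<phi> by blast
qed

text \<open>\<open>\<Gamma> h y\<close> is an elementary tensor; the lemma embeds H tensor Y
  isometrically into the vector-valued space. For fixed y the map is obtained from the closed span
  of the pairs (\<phi> x, \<kappa> x y); working with this relation replaces a well-definedness
  argument on linear combinations by a choice.\<close>

lemma rkhs_tensor:
  shows "\<exists>\<Gamma>. (\<forall>h y x. repG (\<Gamma> h y) x = (h \<bullet> \<phi> x) *\<^sub>R y) \<and>
    (\<forall>h y h' y'. \<Gamma> h y \<bullet> \<Gamma> h' y' = (h \<bullet> h') * (y \<bullet> y'))"
proof -
  obtain \<kappa> where \<kappa>: "\<And>x y t. repG (\<kappa> x y) t = k t x *\<^sub>R y" "\<And>g x y. repG g x \<bullet> y = g \<bullet> \<kappa> x y"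
    using rkhs_kernel_section[OF G] by blast
  have k\<phi>: "k x t = \<phi> x \<bullet> \<phi> t" for x t using scalar_rkhs_feature(2)[OF H] by (simp add: \<phi>)
  define P where "P y = span (range (\<lambda>x. (\<phi> x, \<kappa> x y)))" for y
  have closed_form: "closed {p :: 'h \<times> 'g. snd p \<bullet> w = (fst p \<bullet> v) * c}" for w v c
    by (intro closed_Collect_eq continuous_intros)
  \<comment> \<open>Both sides are linear and continuous in the pair, so the identity passes from
    generators to the closed span. It is used with \<open>w\<close> a kernel section and again with
    \<open>w\<close> the second component of another pair.\<close>
  have form: "closure (P y) \<subseteq> {p. snd p \<bullet> w = (fst p \<bullet> v) * c}"
    if "\<And>x. \<kappa> x y \<bullet> w = (\<phi> x \<bullet> v) * c" for y w v c
  proof (rule closure_minimal[OF _ closed_form])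
    show "P y \<subseteq> {p. snd p \<bullet> w = (fst p \<bullet> v) * c}"
      unfolding P_def
      by (rule span_minimal) (use that in \<open>auto simp: subspace_def inner_simps algebra_simps\<close>)
  qed
  have rep: "snd p \<bullet> \<kappa> t y' = (fst p \<bullet> \<phi> t) * (y \<bullet> y')" if "p \<in> closure (P y)" for p y t y'
  proof -
    have "\<kappa> x y \<bullet> \<kappa> t y' = (\<phi> x \<bullet> \<phi> t) * (y \<bullet> y')" for x
      by (simp add: \<kappa>(2)[symmetric] \<kappa>(1) k\<phi> inner_commute)
    from form[OF this] that show ?thesis by blast
  qed
  have iso: "snd p \<bullet> snd p' = (fst p \<bullet> fst p') * (y \<bullet> y')"
    if p: "p \<in> closure (P y)" and p': "p' \<in> closure (P y')" for p p' y y'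
  proof -
    have "\<kappa> x y \<bullet> snd p' = (\<phi> x \<bullet> fst p') * (y \<bullet> y')" for x
      using rep[OF p', of x y] by (simp add: inner_commute)
    from form[OF this] p show ?thesis by blast
  qed
  have "\<exists>g. (h, g) \<in> closure (P y)" for h y
  proof -
    have "h \<in> closure (span (range \<phi>))" using dense by simp
    then obtain u where u: "\<And>n::nat. u n \<in> span (range \<phi>)" "u \<longlonglongrightarrow> h"
      unfolding closure_sequential by blast
    have "span (range \<phi>) = fst ` P y"
    proof -
      have "range \<phi> = fst ` range (\<lambda>x. (\<phi> x, \<kappa> x y))" by (auto simp: image_image)
      then show ?thesis unfolding P_def using linear_span_image[OF linear_fst] by metis
    qed
    then have "\<exists>g. (u n, g) \<in> P y" for n using u(1)[of n] by force
    then obtain g where g: "\<And>n. (u n, g n) \<in> P y" by metis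
    \<comment> \<open>The isometry identity on differences makes the second components Cauchy
      whenever the first ones are, so the relation is defined on all of H.\<close>
    have "norm (g m - g n) = norm (u m - u n) * norm y" for m n
    proof -
      have "(u m, g m) - (u n, g n) \<in> P y" unfolding P_def
        using g unfolding P_def by (intro span_diff) auto
      then have "(u m - u n, g m - g n) \<in> closure (P y)" using closure_subset by (auto simp: minus_prod_def)
      from iso[OF this this] have "(norm (g m - g n))\<^sup>2 = (norm (u m - u n) * norm y)\<^sup>2"
        by (simp add: power2_norm_eq_inner power_mult_distrib)
      then show ?thesis by (rule power2_eq_imp_eq) auto
    qed
    then have d: "dist (g m) (g n) = dist (u m) (u n) * norm y" for m n by (simp add: dist_norm)
    have "Cauchy g"
    proof (rule metric_CauchyI)
      fix e :: real assume "0 < e"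
      then have "0 < e / (norm y + 1)" by (simp add: add_nonneg_pos)
      then obtain N where N: "\<forall>m\<ge>N. \<forall>n\<ge>N. dist (u m) (u n) < e / (norm y + 1)"
        using LIMSEQ_imp_Cauchy[OF u(2)] unfolding Cauchy_def by blast
      have "dist (g m) (g n) < e" if "m \<ge> N" "n \<ge> N" for m n
      proof -
        have "dist (g m) (g n) \<le> dist (u m) (u n) * (norm y + 1)"
          unfolding d by (intro mult_left_mono) auto
        also have "\<dots> < e"
          using N that by (simp add: pos_less_divide_eq add_nonneg_pos)
        finally show ?thesis .
      qed
      then show "\<exists>N. \<forall>m\<ge>N. \<forall>n\<ge>N. dist (g m) (g n) < e" by blast
    qed
    then obtain l where "g \<longlonglongrightarrow> l" using Cauchy_convergent convergent_def by blast
    then have "(\<lambda>n. (u n, g n)) \<longlonglongrightarrow> (h, l)" using u(2) by (intro tendsto_Pair)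
    then have "(h, l) \<in> closure (P y)"
      unfolding closure_sequential using g by (intro exI[of _ "\<lambda>n. (u n, g n)"]) simp
    then show ?thesis by blast
  qed
  then obtain \<Gamma> where \<Gamma>: "\<And>h y. (h, \<Gamma> h y) \<in> closure (P y)" by metis
  show ?thesis
  proof (intro exI conjI allI)
    show "repG (\<Gamma> h y) x = (h \<bullet> \<phi> x) *\<^sub>R y" for h y x
    proof -
      have "repG (\<Gamma> h y) x \<bullet> y' = (h \<bullet> \<phi> x) *\<^sub>R y \<bullet> y'" for y'
        using rep[OF \<Gamma>[of h y]] by (simp add: \<kappa>(2))
      then show ?thesis by (rule inner_eqI)
    qed
    show "\<Gamma> h y \<bullet> \<Gamma> h' y' = (h \<bullet> h') * (y \<bullet> y')" for h y h' y'
      using iso[OF \<Gamma>[of h y] \<Gamma>[of h' y']] by simp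
  qed
qed

text \<open>The function is represented by the orthogonal series of the tensors
  \<open>\<Gamma> (t y) y\<close> over a basis of the output space, whose terms have norm
  \<open>norm (t y)\<close>. Estimates of the adjoint on finite sets of basis vectors thus give
  membership and norm bound at once.\<close>

lemma rkhs_norm_le:
  assumes F: "is_onb F" and t: "\<And>v y. blinfun_apply T v \<bullet> y = v \<bullet> t y"
    and K: "0 \<le> K" "\<And>Y. finite Y \<Longrightarrow> Y \<subseteq> F \<Longrightarrow> (\<Sum>y\<in>Y. (norm (t y))\<^sup>2) \<le> K\<^sup>2"
  shows "(\<lambda>x. T (\<phi> x)) \<in> range repG \<and> rkhs_norm repG (\<lambda>x. T (\<phi> x)) \<le> K"
proof -
  obtain \<Gamma> where \<Gamma>: "\<And>h y x. repG (\<Gamma> h y) x = (h \<bullet> \<phi> x) *\<^sub>R y"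
    "\<And>h y h' y'. \<Gamma> h y \<bullet> \<Gamma> h' y' = (h \<bullet> h') * (y \<bullet> y')"
    using rkhs_tensor by blast
  obtain \<kappa> where \<kappa>: "\<And>x y t. repG (\<kappa> x y) t = k t x *\<^sub>R y" "\<And>g x y. repG g x \<bullet> y = g \<bullet> \<kappa> x y"
    using rkhs_kernel_section[OF G] by blast
  note oF = orthonormal_inner[OF is_onb_orthonormal[OF F]]
  have n: "(norm (\<Gamma> (t y) y))\<^sup>2 = (norm (t y))\<^sup>2" if "y \<in> F" for y
    using oF[OF that that] by (simp add: power2_norm_eq_inner \<Gamma>(2))
  have s: "(\<lambda>y. (norm (t y))\<^sup>2) summable_on F" "(\<Sum>\<^sub>\<infinity>y\<in>F. (norm (t y))\<^sup>2) \<le> K\<^sup>2"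
    by (rule has_sum_ubound[OF _ K(2)]; simp)+
  have "((\<lambda>y. (norm (\<Gamma> (t y) y))\<^sup>2) has_sum (\<Sum>\<^sub>\<infinity>y\<in>F. (norm (t y))\<^sup>2)) F"
    using has_sum_infsum[OF s(1)] by (subst has_sum_cong[OF n]) auto
  note os = orthogonal_summable[OF _ this]
  define g where "g = (\<Sum>\<^sub>\<infinity>y\<in>F. \<Gamma> (t y) y)"
  have "(\<lambda>y. \<Gamma> (t y) y) summable_on F" by (rule os(1)) (simp add: \<Gamma>(2) oF)
  then have g: "((\<lambda>y. \<Gamma> (t y) y) has_sum g) F" by (simp add: g_def)
  have "(norm g)\<^sup>2 = (\<Sum>\<^sub>\<infinity>y\<in>F. (norm (t y))\<^sup>2)" unfolding g_def by (rule os(2)) (simp add: \<Gamma>(2) oF)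
  then have gK: "norm g \<le> K" using s(2) K(1) by (metis power2_le_imp_le)
  have "repG g x = T (\<phi> x)" for x
  proof -
    have "repG g x \<bullet> y = T (\<phi> x) \<bullet> y" for y
    proof (rule has_sum_unique)
      have "((\<lambda>f. \<Gamma> (t f) f \<bullet> \<kappa> x y) has_sum (g \<bullet> \<kappa> x y)) F"
        by (rule has_sum_bounded_linear[OF bounded_linear_inner_left g])
      moreover have "\<Gamma> (t f) f \<bullet> \<kappa> x y = (T (\<phi> x) \<bullet> f) * (y \<bullet> f)" for f
        by (simp add: \<kappa>(2)[symmetric] \<Gamma>(1) t inner_commute[of "t f"] inner_commute[of f y])
      ultimately show "((\<lambda>f. (T (\<phi> x) \<bullet> f) * (y \<bullet> f)) has_sum (repG g x \<bullet> y)) F"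
        by (simp add: \<kappa>(2))
      show "((\<lambda>f. (T (\<phi> x) \<bullet> f) * (y \<bullet> f)) has_sum (T (\<phi> x) \<bullet> y)) F"
        by (rule onb_inner_has_sum[OF F])
    qed
    then show ?thesis by (rule inner_eqI)
  qed
  then have eq: "(\<lambda>x. T (\<phi> x)) = repG g" by (simp add: fun_eq_iff)
  show ?thesis
    unfolding eq rkhs_norm_def using gK by (simp add: inv_f_f[OF rkhs_injD[OF G]])
qed

end

section \<open>Covariance operators\<close>

lemma bessel:
  fixes v :: "'a::real_inner"
  assumes G: "orthonormal G" "finite G"
  shows "(\<Sum>e\<in>G. (v \<bullet> e)\<^sup>2) \<le> (norm v)\<^sup>2"
proof -
  let ?p = "\<Sum>e\<in>G. (v \<bullet> e) *\<^sub>R e"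
  have "?p \<in> span G" by (intro span_sum span_scale span_base)
  then have "(v - ?p) \<bullet> ?p = 0" by (rule orthonormal_residual[OF G])
  from pythagoras[OF this] have "(norm ?p)\<^sup>2 \<le> (norm v)\<^sup>2" by simp
  moreover have "(norm ?p)\<^sup>2 = (\<Sum>e\<in>G. (norm ((v \<bullet> e) *\<^sub>R e))\<^sup>2)"
    by (rule norm_sum_orthogonal) (simp_all add: G orthonormal_inner[OF G(1)])
  moreover have "\<dots> = (\<Sum>e\<in>G. (v \<bullet> e)\<^sup>2)"
    using G(1) by (intro sum.cong) (auto simp: orthonormal_def)
  ultimately show ?thesis by simp
qed

text \<open>The trace bound is required on every finite orthonormal system, so it is available in
  any basis; on singletons it bounds each eigenvalue by \<open>K\<close>.\<close>

locale positive_trace_class =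
  fixes A :: "'h::{real_inner, banach} \<Rightarrow>\<^sub>L 'h" and K :: real
  assumes sa: "\<And>u v. A u \<bullet> v = u \<bullet> A v" and pos: "\<And>v. 0 \<le> A v \<bullet> v"
    and trace: "\<And>G. finite G \<Longrightarrow> orthonormal G \<Longrightarrow> (\<Sum>e\<in>G. A e \<bullet> e) \<le> K"
begin

text \<open>Positivity of the form at v - A v / norm A. It converts the trace bound into a
  Hilbert-Schmidt bound and thereby provides an eigenbasis.\<close>

lemma norm_square_le: "(norm (A v))\<^sup>2 \<le> norm A * (A v \<bullet> v)"
proof (cases "norm A = 0")
  case True
  then show ?thesis by simp
next
  case False
  then have p: "norm A > 0" by simp
  define t where "t = - 1 / norm A"
  have "A (A v) \<bullet> A v \<le> norm (A (A v)) * norm (A v)" by (rule norm_cauchy_schwarz)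
  also have "\<dots> \<le> (norm A * norm (A v)) * norm (A v)"
    by (intro mult_right_mono norm_blinfun) simp
  finally have q: "A (A v) \<bullet> A v \<le> norm A * (norm (A v))\<^sup>2" by (simp add: power2_eq_square)
  have "0 \<le> A (v + t *\<^sub>R A v) \<bullet> (v + t *\<^sub>R A v)" by (rule pos)
  also have "\<dots> = A v \<bullet> v + 2 * t * (norm (A v))\<^sup>2 + t\<^sup>2 * (A (A v) \<bullet> A v)"
    by (simp add: blinfun.add_right blinfun.scaleR_right inner_simps sa[of "A v" v]
        power2_norm_eq_inner[symmetric] power2_eq_square[of t] algebra_simps)
  also have "\<dots> \<le> A v \<bullet> v + 2 * t * (norm (A v))\<^sup>2 + t\<^sup>2 * (norm A * (norm (A v))\<^sup>2)"
    by (intro add_left_mono mult_left_mono q) simp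
  also have "\<dots> = A v \<bullet> v - (norm (A v))\<^sup>2 / norm A"
    using p by (simp add: t_def field_simps power2_eq_square)
  finally show ?thesis using p by (simp add: field_simps)
qed

lemma onb: "is_onb (eigenbasis A)"
  and eigenvector: "e \<in> eigenbasis A \<Longrightarrow> A e = (A e \<bullet> e) *\<^sub>R e"
proof -
  have sub: "orthonormal G" if "G \<subseteq> some_onb" for G :: "'h set"
    using is_onb_orthonormal[OF some_onb] that pairwise_mono unfolding orthonormal_def by blast
  have "(\<lambda>e. (norm (A e))\<^sup>2) summable_on some_onb"
  proof (rule has_sum_ubound(1))
    fix G :: "'h set" assume G: "finite G" "G \<subseteq> some_onb"
    have "(\<Sum>e\<in>G. (norm (A e))\<^sup>2) \<le> (\<Sum>e\<in>G. norm A * (A e \<bullet> e))"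
      by (intro sum_mono norm_square_le)
    also have "\<dots> \<le> norm A * K"
      unfolding sum_distrib_left[symmetric] by (intro mult_left_mono trace G sub) simp
    finally show "(\<Sum>e\<in>G. (norm (A e))\<^sup>2) \<le> norm A * K" .
  qed simp
  note eb = eigenbasis[OF some_onb this sa pos]
  show "is_onb (eigenbasis A)" by (rule eb(1))
  show "e \<in> eigenbasis A \<Longrightarrow> A e = (A e \<bullet> e) *\<^sub>R e" by (rule eb(2))
qed

definition ev :: "'h \<Rightarrow> real" where "ev e = A e \<bullet> e"

lemma ev_nonneg: "0 \<le> ev e" by (simp add: ev_def pos)

lemma ev_eigen: "e \<in> eigenbasis A \<Longrightarrow> A e = ev e *\<^sub>R e" unfolding ev_def by (rule eigenvector)

lemma finite_ev_le: "finite G \<Longrightarrow> G \<subseteq> eigenbasis A \<Longrightarrow> (\<Sum>e\<in>G. ev e) \<le> K"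
  unfolding ev_def
  by (rule trace) (use is_onb_orthonormal[OF onb] pairwise_mono in \<open>unfold orthonormal_def, blast+\<close>)

lemma ev_le: "e \<in> eigenbasis A \<Longrightarrow> ev e \<le> K"
  using finite_ev_le[of "{e}"] by simp

lemma ev_inner: "e \<in> eigenbasis A \<Longrightarrow> A v \<bullet> e = ev e * (v \<bullet> e)"
  unfolding sa by (simp add: ev_eigen)

lemma op_fun_eq: "op_fun f A = diag_op (eigenbasis A) (\<lambda>e. f (ev e))"
  by (simp add: op_fun_diag ev_def)

lemma op_inverse_eq:
  assumes lam: "0 < lam"
  shows "op_inverse (A + lam *\<^sub>R id_blinfun) = diag_op (eigenbasis A) (\<lambda>e. 1 / (ev e + lam))"
proof -
  let ?T = "A + lam *\<^sub>R id_blinfun" and ?S = "diag_op (eigenbasis A) (\<lambda>e. 1 / (ev e + lam))"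
  have b: "\<bar>1 / (ev e + lam)\<bar> \<le> 1 / lam" for e
    using ev_nonneg[of e] lam by (simp add: frac_le)
  have S: "?S v \<bullet> e = (1 / (ev e + lam)) * (v \<bullet> e)" if "e \<in> eigenbasis A" for v e
    by (rule diag_op_inner[OF onb b that])
  have T: "?T v \<bullet> e = (ev e + lam) * (v \<bullet> e)" if "e \<in> eigenbasis A" for v e
    using that by (simp add: blinfun.add_left blinfun.scaleR_left inner_simps ev_inner algebra_simps)
  have p: "ev e + lam \<noteq> 0" for e using ev_nonneg[of e] lam by linarith
  have 1: "?T o\<^sub>L ?S = id_blinfun"
    by (rule blinfun_eqI, rule onb_eqI[OF onb]) (simp add: T S p del: blinfun_apply_blinfun_compose add: blinfun_compose.rep_eq)
  have 2: "?S o\<^sub>L ?T = id_blinfun"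
    by (rule blinfun_eqI, rule onb_eqI[OF onb]) (simp add: T S p del: blinfun_apply_blinfun_compose add: blinfun_compose.rep_eq)
  show ?thesis
    unfolding op_inverse_def
  proof (rule the_equality)
    show "?T o\<^sub>L ?S = id_blinfun \<and> ?S o\<^sub>L ?T = id_blinfun" using 1 2 by blast
    fix R assume R: "?T o\<^sub>L R = id_blinfun \<and> R o\<^sub>L ?T = id_blinfun"
    show "R = ?S"
    proof (rule blinfun_eqI)
      fix v
      have "R v = ?S (?T (R v))" using arg_cong[OF 2, of "\<lambda>U. blinfun_apply U (R v)"] by simp
      also have "?T (R v) = v" using arg_cong[OF conjunct1[OF R], of "\<lambda>U. blinfun_apply U v"] by simp
      finally show "R v = ?S v" .
    qed
  qed
qed

text \<open>The trace is taken in a fixed basis while the eigenvalues belong to another one; the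
  nonnegative double sum of \<open>ev e / (ev e + lam)\<close> times (e . x)^2 over both bases
  connects them.\<close>

lemma eff_dim_has_sum:
  assumes lam: "0 < lam"
  shows "((\<lambda>e. ev e / (ev e + lam)) has_sum eff_dim A lam) (eigenbasis A)"
proof -
  let ?E = "eigenbasis A" and ?w = "\<lambda>e. ev e / (ev e + lam)"
  have p: "0 < ev e + lam" for e using ev_nonneg[of e] lam by linarith
  have w0: "0 \<le> ?w e" for e using ev_nonneg[of e] p[of e] by simp
  have w1: "\<bar>?w e\<bar> \<le> 1" for e using ev_nonneg[of e] p[of e] lam by simp
  have "?w summable_on ?E"
  proof (rule has_sum_ubound(1)[OF w0])
    fix G assume G: "finite G" "G \<subseteq> ?E"
    have "(\<Sum>e\<in>G. ?w e) \<le> (\<Sum>e\<in>G. ev e / lam)"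
      using ev_nonneg lam p by (intro sum_mono divide_left_mono) auto
    also have "\<dots> \<le> K / lam"
      unfolding sum_divide_distrib[symmetric] using lam finite_ev_le[OF G] by (intro divide_right_mono) auto
    finally show "(\<Sum>e\<in>G. ?w e) \<le> K / lam" .
  qed
  then have total: "(?w has_sum (\<Sum>\<^sub>\<infinity>e\<in>?E. ?w e)) ?E" by simp
  have b: "\<bar>1 / (ev e + lam)\<bar> \<le> 1 / lam" for e
    using ev_nonneg[of e] lam by (simp add: frac_le)
  have op: "A o\<^sub>L op_inverse (A + lam *\<^sub>R id_blinfun) = diag_op ?E ?w"
  proof (rule blinfun_eqI)
    fix v
    have "(A o\<^sub>L op_inverse (A + lam *\<^sub>R id_blinfun)) v \<bullet> e = ?w e * (v \<bullet> e)" if e: "e \<in> ?E" for e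
      unfolding op_inverse_eq[OF lam] using diag_op_inner[OF onb b e, where v = v] e by (simp add: ev_inner)
    then show "(A o\<^sub>L op_inverse (A + lam *\<^sub>R id_blinfun)) v = diag_op ?E ?w v"
      by (rule diag_op_eqI[OF onb w1])
  qed
  have "((\<lambda>x. diag_op ?E ?w x \<bullet> x) has_sum (\<Sum>\<^sub>\<infinity>e\<in>?E. ?w e)) some_onb"
  proof (rule nonneg_double_has_sum[OF _ _ _ total])
    fix e assume e: "e \<in> ?E"
    have "((\<lambda>x. (e \<bullet> x)\<^sup>2) has_sum 1) some_onb"
      using parseval[OF some_onb, of e] onb e by (simp add: is_onb_def)
    then show "((\<lambda>x. ?w e * (e \<bullet> x)\<^sup>2) has_sum ?w e) some_onb"
      using has_sum_cmult_right[of "\<lambda>x. (e \<bullet> x)\<^sup>2" some_onb 1 "?w e"] by simp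
  next
    fix x :: 'h
    show "((\<lambda>e. ?w e * (e \<bullet> x)\<^sup>2) has_sum (diag_op ?E ?w x \<bullet> x)) ?E"
      using diag_op_inner_has_sum[OF onb w1, where u = x and v = x]
      by (simp add: power2_eq_square inner_commute[of x] mult.assoc)
  qed (intro mult_nonneg_nonneg w0 zero_le_power2)
  then have "op_trace (A o\<^sub>L op_inverse (A + lam *\<^sub>R id_blinfun)) = (\<Sum>\<^sub>\<infinity>e\<in>?E. ?w e)"
    unfolding op_trace_def op by (rule infsumI)
  with total show ?thesis by (simp add: eff_dim_def)
qed

end

lemma tensor_op_apply [simp]: "tensor_op a a' v = (v \<bullet> a') *\<^sub>R a"
proof -
  have "bounded_linear (\<lambda>v. (v \<bullet> a') *\<^sub>R a)"
    by (rule bounded_linear_scaleR_const[OF bounded_linear_inner_left])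
  then show ?thesis by (simp add: tensor_op_def bounded_linear_Blinfun_apply)
qed

lemma emp_cov_X_apply:
  "emp_cov_X n \<beta> \<phi> z v = (1 / real n) *\<^sub>R (\<Sum>i<n. (\<beta> (fst (z i)) * (v \<bullet> \<phi> (fst (z i)))) *\<^sub>R \<phi> (fst (z i)))"
  by (simp add: emp_cov_X_def blinfun.scaleR_left blinfun.sum_left)

lemma emp_cov_YX_apply:
  "emp_cov_YX n \<beta> \<phi> z v = (1 / real n) *\<^sub>R (\<Sum>i<n. (\<beta> (fst (z i)) * (v \<bullet> \<phi> (fst (z i)))) *\<^sub>R snd (z i))"
  by (simp add: emp_cov_YX_def blinfun.scaleR_left blinfun.sum_left)

lemma emp_cov_X_inner:
  "emp_cov_X n \<beta> \<phi> z u \<bullet> v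
    = (1 / real n) * (\<Sum>i<n. \<beta> (fst (z i)) * (u \<bullet> \<phi> (fst (z i))) * (v \<bullet> \<phi> (fst (z i))))"
  by (simp add: emp_cov_X_apply inner_sum_left inner_commute[of v])

lemma emp_cov_X_positive_trace_class:
  fixes \<phi> :: "'x \<Rightarrow> 'h::{real_inner, banach}"
  assumes \<beta>: "\<And>x. 0 \<le> \<beta> x" "\<And>x. \<beta> x \<le> b" and \<phi>: "\<And>x. (norm (\<phi> x))\<^sup>2 \<le> \<kappa>\<^sup>2" and n: "1 \<le> n"
  shows "positive_trace_class (emp_cov_X n \<beta> \<phi> z) (b * \<kappa>\<^sup>2)"
proof
  let ?x = "\<lambda>i. fst (z i)"
  show "emp_cov_X n \<beta> \<phi> z u \<bullet> v = u \<bullet> emp_cov_X n \<beta> \<phi> z v" for u v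
    by (simp add: emp_cov_X_inner inner_commute[of u] mult.commute mult.left_commute)
  show "0 \<le> emp_cov_X n \<beta> \<phi> z v \<bullet> v" for v
  proof -
    have "0 \<le> \<beta> (?x i) * (v \<bullet> \<phi> (?x i)) * (v \<bullet> \<phi> (?x i))" for i
      using \<beta>(1) by (simp add: mult.assoc)
    then show ?thesis by (simp add: emp_cov_X_inner sum_nonneg)
  qed
  fix G :: "'h set" assume G: "finite G" "orthonormal G"
  have "(\<Sum>e\<in>G. emp_cov_X n \<beta> \<phi> z e \<bullet> e) = (1 / real n) * (\<Sum>i<n. \<beta> (?x i) * (\<Sum>e\<in>G. (\<phi> (?x i) \<bullet> e)\<^sup>2))"
    unfolding emp_cov_X_inner sum_distrib_left[symmetric]
    by (subst sum.swap) (simp add: sum_distrib_left power2_eq_square inner_commute mult.assoc)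
  also have "\<dots> \<le> (1 / real n) * (\<Sum>i<n. b * \<kappa>\<^sup>2)"
  proof (intro mult_left_mono sum_mono)
    fix i
    have "0 \<le> b" using \<beta> order_trans by blast
    moreover have "(\<Sum>e\<in>G. (\<phi> (?x i) \<bullet> e)\<^sup>2) \<le> \<kappa>\<^sup>2"
      using bessel[OF G(2,1)] \<phi> by (rule order_trans)
    ultimately show "\<beta> (?x i) * (\<Sum>e\<in>G. (\<phi> (?x i) \<bullet> e)\<^sup>2) \<le> b * \<kappa>\<^sup>2"
      using \<beta> by (intro mult_mono) (auto intro: sum_nonneg)
  qed simp
  also have "\<dots> = b * \<kappa>\<^sup>2" using n by simp
  finally show "(\<Sum>e\<in>G. emp_cov_X n \<beta> \<phi> z e \<bullet> e) \<le> b * \<kappa>\<^sup>2" .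
qed

text \<open>\<open>cov_op\<close> is a \<open>Blinfun\<close> of a pointwise integral, so its values
  become accessible once that integral is shown to be bounded and linear in the vector, which
  boundedness of the feature map provides.\<close>

lemma cov_op_inner:
  fixes \<phi> :: "'x::topological_space \<Rightarrow> 'h::{real_inner, banach, second_countable_topology}"
  assumes m: "prob_space m" "sets m = sets borel" and \<phi>: "\<phi> \<in> borel_measurable borel"
    and bound: "\<And>x. norm (\<phi> x) \<le> \<kappa>"
  shows "cov_op m \<phi> u \<bullet> v = (\<integral>x. (u \<bullet> \<phi> x) * (v \<bullet> \<phi> x) \<partial>m)"
proof -
  interpret prob_space m by (rule m(1))
  have [measurable_cong]: "sets m = sets borel" by (rule m(2))
  note [measurable] = \<phi>
  have \<kappa>: "0 \<le> \<kappa>" using bound norm_ge_zero order_trans by blast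
  have nb: "norm ((w \<bullet> \<phi> x) *\<^sub>R \<phi> x) \<le> norm w * \<kappa> * \<kappa>" for w x
  proof -
    have "\<bar>w \<bullet> \<phi> x\<bar> \<le> norm w * \<kappa>"
      using Cauchy_Schwarz_ineq2[of w "\<phi> x"] mult_left_mono[OF bound norm_ge_zero[of w]] by (rule order_trans)
    then show ?thesis using bound \<kappa> by (simp add: mult_mono)
  qed
  have int: "integrable m (\<lambda>x. (w \<bullet> \<phi> x) *\<^sub>R \<phi> x)" for w
    by (rule integrable_const_bound[where B = "norm w * \<kappa> * \<kappa>"]) (use nb in auto)
  have "bounded_linear (\<lambda>w. \<integral>x. (w \<bullet> \<phi> x) *\<^sub>R \<phi> x \<partial>m)"
  proof (rule bounded_linear_intro[where K = "\<kappa> * \<kappa>"])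
    fix w w' :: 'h and r :: real
    show "(\<integral>x. ((w + w') \<bullet> \<phi> x) *\<^sub>R \<phi> x \<partial>m) = (\<integral>x. (w \<bullet> \<phi> x) *\<^sub>R \<phi> x \<partial>m) + (\<integral>x. (w' \<bullet> \<phi> x) *\<^sub>R \<phi> x \<partial>m)"
      using int by (simp add: inner_add_left scaleR_add_left)
    show "(\<integral>x. (r *\<^sub>R w \<bullet> \<phi> x) *\<^sub>R \<phi> x \<partial>m) = r *\<^sub>R (\<integral>x. (w \<bullet> \<phi> x) *\<^sub>R \<phi> x \<partial>m)"
      using int[of w] by (simp flip: scaleR_scaleR)
    have "norm (\<integral>x. (w \<bullet> \<phi> x) *\<^sub>R \<phi> x \<partial>m) \<le> (\<integral>x. norm ((w \<bullet> \<phi> x) *\<^sub>R \<phi> x) \<partial>m)"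
      by (rule integral_norm_bound)
    also have "\<dots> \<le> (\<integral>x. norm w * \<kappa> * \<kappa> \<partial>m)"
      by (rule integral_mono[OF integrable_norm[OF int] _ nb]) simp
    finally show "norm (\<integral>x. (w \<bullet> \<phi> x) *\<^sub>R \<phi> x \<partial>m) \<le> norm w * (\<kappa> * \<kappa>)"
      by (simp add: prob_space mult.assoc)
  qed
  then have "cov_op m \<phi> u = (\<integral>x. (u \<bullet> \<phi> x) *\<^sub>R \<phi> x \<partial>m)"
    by (simp add: cov_op_def op_expectation_def bounded_linear_Blinfun_apply)
  then show ?thesis
    using integral_inner_left[OF int[of u], of v] by (simp add: inner_commute)
qed

lemma cov_op_positive_trace_class:
  fixes \<phi> :: "'x::topological_space \<Rightarrow> 'h::{real_inner, banach, second_countable_topology}"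
  assumes m: "prob_space m" "sets m = sets borel" and \<phi>: "\<phi> \<in> borel_measurable borel"
    and bound: "\<And>x. norm (\<phi> x) \<le> \<kappa>"
  shows "positive_trace_class (cov_op m \<phi>) (\<kappa>\<^sup>2)"
proof
  interpret prob_space m by (rule m(1))
  have [measurable_cong]: "sets m = sets borel" by (rule m(2))
  note [measurable] = \<phi>
  note inner = cov_op_inner[OF m \<phi> bound]
  show "cov_op m \<phi> u \<bullet> v = u \<bullet> cov_op m \<phi> v" for u v
    by (simp add: inner inner_commute[of u] mult.commute)
  show "0 \<le> cov_op m \<phi> v \<bullet> v" for v
    unfolding inner by (intro integral_nonneg_AE) auto
  fix G :: "'h set" assume G: "finite G" "orthonormal G"
  have sq: "(\<Sum>e\<in>G. (\<phi> x \<bullet> e)\<^sup>2) \<le> \<kappa>\<^sup>2" for x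
    using bessel[OF G(2,1)] power_mono[OF bound norm_ge_zero] by (rule order_trans)
  have le: "(\<phi> x \<bullet> e)\<^sup>2 \<le> \<kappa>\<^sup>2" if "e \<in> G" for e x
    by (rule order_trans[OF member_le_sum[OF that _ G(1), where f = "\<lambda>e. (\<phi> x \<bullet> e)\<^sup>2"] sq]) simp
  have int: "integrable m (\<lambda>x. (\<phi> x \<bullet> e)\<^sup>2)" if "e \<in> G" for e
    by (rule integrable_const_bound[where B = "\<kappa>\<^sup>2"]) (use le[OF that] in auto)
  have "(\<Sum>e\<in>G. cov_op m \<phi> e \<bullet> e) = (\<integral>x. (\<Sum>e\<in>G. (\<phi> x \<bullet> e)\<^sup>2) \<partial>m)"
  proof -
    have "cov_op m \<phi> e \<bullet> e = (\<integral>x. (\<phi> x \<bullet> e)\<^sup>2 \<partial>m)" for e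
      by (simp add: inner power2_eq_square inner_commute[of e])
    then show ?thesis using int by simp
  qed
  also have "\<dots> \<le> (\<integral>x. \<kappa>\<^sup>2 \<partial>m)"
    by (rule integral_mono) (use int sq in auto)
  finally show "(\<Sum>e\<in>G. cov_op m \<phi> e \<bullet> e) \<le> \<kappa>\<^sup>2" by (simp add: prob_space)
qed

section \<open>Regularization families\<close>

text \<open>Since \<open>g lam\<close> is bounded by B / lam, the residual tends to 1 as \<sigma>
  tends to 0. As a consequence \<gamma> also dominates the residual at \<sigma> = 0, a point outside
  the range in the definition of the family.\<close>

lemma regularization_gamma_ge_1:
  assumes reg: "regularization_family s g B D \<gamma>" and lam: "0 < lam" "lam \<le> s"
  shows "1 \<le> \<gamma>"
proof (rule ccontr)
  assume "\<not> 1 \<le> \<gamma>"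
  then have \<gamma>: "\<gamma> < 1" by simp
  have B: "0 < B" using reg by (simp add: regularization_family_def)
  \<comment> \<open>Small enough that \<sigma> * g has absolute value at most (1 - \<gamma>) / 2,
    and at most \<open>s\<close> so that the family bounds apply.\<close>
  define \<sigma> where "\<sigma> = min s ((1 - \<gamma>) * lam / (2 * B))"
  have \<sigma>: "0 < \<sigma>" "\<sigma> \<le> s" "\<sigma> \<le> (1 - \<gamma>) * lam / (2 * B)"
    using \<gamma> B lam by (auto simp: \<sigma>_def)
  then have g: "\<bar>g lam \<sigma>\<bar> \<le> B / lam" "\<bar>1 - \<sigma> * g lam \<sigma>\<bar> \<le> \<gamma>"
    using reg lam by (auto simp: regularization_family_def)
  have "\<bar>\<sigma> * g lam \<sigma>\<bar> \<le> ((1 - \<gamma>) * lam / (2 * B)) * (B / lam)"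
    unfolding abs_mult using \<sigma> g(1) by (intro mult_mono) auto
  also have "\<dots> = (1 - \<gamma>) / 2" using B lam by (simp add: field_simps)
  finally show False using g(2) \<gamma> by (simp add: abs_le_iff)
qed

lemma qualification_constant_nonneg:
  assumes q: "qualification_bound s g \<nu> \<gamma>\<^sub>\<nu>" and lam: "0 < lam" "lam \<le> s"
  shows "0 \<le> \<gamma>\<^sub>\<nu>"
proof -
  have "0 \<le> \<bar>1 - s * g lam s\<bar> * s powr \<nu>" by simp
  also have "\<dots> \<le> \<gamma>\<^sub>\<nu> * lam powr \<nu>" using q lam by (auto simp: qualification_bound_def)
  finally show ?thesis using lam by (simp add: zero_le_mult_iff)
qed

text \<open>Merges two bounds into a power of the resolvent function: \<sigma> + lam is at most
  twice the larger summand, and \<gamma> serves for \<sigma> <= lam,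
  \<open>\<gamma>\<^sub>\<nu>\<close> beyond.\<close>

lemma residual_function_le:
  assumes reg: "regularization_family s g B D \<gamma>" and q: "qualification_bound s g \<nu> \<gamma>\<^sub>\<nu>"
    and lam: "0 < lam" "lam \<le> s" and \<nu>: "0 < \<nu>" and \<sigma>: "0 \<le> \<sigma>" "\<sigma> \<le> s"
  shows "\<bar>1 - \<sigma> * g lam \<sigma>\<bar> \<le> 2 powr \<nu> * (\<gamma>\<^sub>\<nu> + \<gamma>) * (lam / (\<sigma> + lam)) powr \<nu>"
proof -
  let ?r = "\<bar>1 - \<sigma> * g lam \<sigma>\<bar>"
  have \<gamma>1: "1 \<le> \<gamma>" by (rule regularization_gamma_ge_1[OF reg lam])
  have \<gamma>\<nu>: "0 \<le> \<gamma>\<^sub>\<nu>" by (rule qualification_constant_nonneg[OF q lam])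
  have r\<gamma>: "?r \<le> \<gamma>"
    using reg lam \<sigma> \<gamma>1 by (cases "\<sigma> = 0") (auto simp: regularization_family_def)
  have "?r * (\<sigma> + lam) powr \<nu> \<le> 2 powr \<nu> * (\<gamma>\<^sub>\<nu> + \<gamma>) * lam powr \<nu>"
  proof (cases "\<sigma> \<le> lam")
    case True
    then have "(\<sigma> + lam) powr \<nu> \<le> (2 * lam) powr \<nu>" using \<sigma> \<nu> lam by (intro powr_mono2) auto
    also have "\<dots> = 2 powr \<nu> * lam powr \<nu>" using lam by (simp add: powr_mult)
    finally have "?r * (\<sigma> + lam) powr \<nu> \<le> \<gamma> * (2 powr \<nu> * lam powr \<nu>)"
      using r\<gamma> \<gamma>1 by (intro mult_mono) auto
    also have "\<dots> \<le> (\<gamma>\<^sub>\<nu> + \<gamma>) * (2 powr \<nu> * lam powr \<nu>)" using \<gamma>\<nu> by (intro mult_right_mono) auto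
    finally show ?thesis by (simp add: mult_ac)
  next
    case False
    then have "(\<sigma> + lam) powr \<nu> \<le> (2 * \<sigma>) powr \<nu>" using \<sigma> \<nu> lam by (intro powr_mono2) auto
    also have "\<dots> = 2 powr \<nu> * \<sigma> powr \<nu>" using \<sigma> by (simp add: powr_mult)
    finally have "?r * (\<sigma> + lam) powr \<nu> \<le> ?r * (2 powr \<nu> * \<sigma> powr \<nu>)"
      by (intro mult_left_mono) auto
    also have "\<dots> = 2 powr \<nu> * (?r * \<sigma> powr \<nu>)" by (simp add: mult_ac)
    also have "\<dots> \<le> 2 powr \<nu> * (\<gamma>\<^sub>\<nu> * lam powr \<nu>)"
      using q lam \<sigma> False by (intro mult_left_mono) (auto simp: qualification_bound_def)
    also have "\<dots> \<le> 2 powr \<nu> * ((\<gamma>\<^sub>\<nu> + \<gamma>) * lam powr \<nu>)"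
      using \<gamma>1 by (intro mult_left_mono mult_right_mono) auto
    finally show ?thesis by (simp add: mult_ac)
  qed
  moreover have "0 < (\<sigma> + lam) powr \<nu>" using \<sigma> lam by simp
  ultimately show ?thesis
    using \<sigma> lam by (simp add: powr_divide pos_le_divide_eq)
qed

text \<open>\<sigma> g^2 is at most D B / lam and lam g^2 at most B^2 / lam, together at most (B +
  D)^2 / lam. The root of the resolvent function on the right is what Loewner-Heinz at exponent 1/2
  handles.\<close>

lemma regularization_function_le:
  assumes reg: "regularization_family s g B D \<gamma>"
    and lam: "0 < lam" "lam \<le> s" and \<sigma>: "0 < \<sigma>" "\<sigma> \<le> s"
  shows "\<bar>g lam \<sigma>\<bar> \<le> (B + D) / lam * sqrt (lam / (\<sigma> + lam))"
proof -
  have BD: "0 < B" "0 < D" and g: "\<bar>\<sigma> * g lam \<sigma>\<bar> \<le> D" "\<bar>g lam \<sigma>\<bar> \<le> B / lam"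
    using reg lam \<sigma> by (auto simp: regularization_family_def)
  have sq: "\<bar>g lam \<sigma>\<bar> * \<bar>g lam \<sigma>\<bar> = (g lam \<sigma>)\<^sup>2" by (simp add: power2_eq_square)
  have "(g lam \<sigma>)\<^sup>2 * (\<sigma> + lam) = \<bar>\<sigma> * g lam \<sigma>\<bar> * \<bar>g lam \<sigma>\<bar> + lam * \<bar>g lam \<sigma>\<bar> * \<bar>g lam \<sigma>\<bar>"
    unfolding abs_mult mult.assoc sq using \<sigma> by (simp add: algebra_simps)
  also have "\<dots> \<le> D * (B / lam) + lam * (B / lam) * (B / lam)"
    using g BD lam by (intro add_mono mult_mono) auto
  also have "\<dots> = (B * D + B\<^sup>2) / lam" using lam by (simp add: power2_eq_square field_simps)
  also have "\<dots> \<le> (B + D)\<^sup>2 / lam"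
    using BD lam by (intro divide_right_mono) (auto simp: power2_eq_square algebra_simps)
  finally have "(g lam \<sigma>)\<^sup>2 \<le> (B + D)\<^sup>2 / lam / (\<sigma> + lam)"
    using \<sigma> lam by (simp add: pos_le_divide_eq mult_ac)
  also have "\<dots> = ((B + D) / lam)\<^sup>2 * (lam / (\<sigma> + lam))"
    using \<sigma> lam by (simp add: power2_eq_square)
  also have "\<dots> = ((B + D) / lam * sqrt (lam / (\<sigma> + lam)))\<^sup>2"
    unfolding power_mult_distrib using \<sigma> lam by (subst real_sqrt_pow2) simp_all
  finally have "\<bar>g lam \<sigma>\<bar>\<^sup>2 \<le> ((B + D) / lam * sqrt (lam / (\<sigma> + lam)))\<^sup>2" by simp
  then show ?thesis by (rule power2_le_imp_le) (use BD \<sigma> lam in simp)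
qed

lemma index_function_mono:
  assumes "index_function \<psi>" "0 \<le> x" "x \<le> y"
  shows "\<psi> x \<le> \<psi> y" "0 \<le> \<psi> x"
proof -
  have s: "strict_mono_on {0..} \<psi>" and 0: "\<psi> 0 = 0" using assms by (auto simp: index_function_def)
  note m = strict_mono_on_leD[OF s]
  show "\<psi> x \<le> \<psi> y" using assms by (intro m) auto
  show "0 \<le> \<psi> x" using m[of 0 x] 0 assms by auto
qed

lemma index_function_pos:
  assumes "index_function \<psi>" "0 < x"
  shows "0 < \<psi> x"
proof -
  have s: "strict_mono_on {0..} \<psi>" and 0: "\<psi> 0 = 0" using assms by (auto simp: index_function_def)
  show ?thesis using strict_mono_onD[OF s, of 0 x] 0 assms by auto
qed

text \<open>For \<sigma> <= lam monotonicity of \<psi> gives the constant 1; for larger \<sigma> the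
  resolvent function is at most lam / \<sigma> and the covering condition at t = lam gives 1 /
  c.\<close>

lemma covered_index_function_le:
  assumes \<psi>: "index_function \<psi>" and cov: "covers s \<nu> \<psi> c"
    and lam: "0 < lam" "lam \<le> s" and \<nu>: "0 < \<nu>" and \<sigma>: "0 \<le> \<sigma>" "\<sigma> \<le> s"
  shows "(lam / (\<sigma> + lam)) powr \<nu> * \<psi> \<sigma> \<le> max 1 (1 / c) * \<psi> lam"
proof (cases "\<sigma> \<le> lam")
  case True
  have "(lam / (\<sigma> + lam)) powr \<nu> \<le> 1" using \<sigma> lam \<nu> by (intro powr_le1) auto
  then have "(lam / (\<sigma> + lam)) powr \<nu> * \<psi> \<sigma> \<le> 1 * \<psi> lam"
    using index_function_mono[OF \<psi> \<sigma>(1) True] by (intro mult_mono) auto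
  also have "\<dots> \<le> max 1 (1 / c) * \<psi> lam"
    using index_function_pos[OF \<psi> lam(1)] by (intro mult_right_mono) auto
  finally show ?thesis .
next
  case False
  have c: "0 < c" using cov by (simp add: covers_def)
  have pos: "0 < \<psi> lam" "0 < \<psi> \<sigma>" using index_function_pos[OF \<psi>] lam False by auto
  have "c * (lam powr \<nu> / \<psi> lam) \<le> (INF \<sigma>\<in>{lam..s}. \<sigma> powr \<nu> / \<psi> \<sigma>)"
    using cov lam by (simp add: covers_def)
  also have "\<dots> \<le> \<sigma> powr \<nu> / \<psi> \<sigma>"
  proof (rule cINF_lower)
    show "bdd_below ((\<lambda>\<sigma>. \<sigma> powr \<nu> / \<psi> \<sigma>) ` {lam..s})"
    proof (rule bdd_belowI2)
      fix x assume "x \<in> {lam..s}"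
      then have "0 < \<psi> x" using lam by (intro index_function_pos[OF \<psi>]) auto
      then show "0 \<le> x powr \<nu> / \<psi> x" by simp
    qed
  qed (use False \<sigma> in auto)
  finally have "(lam powr \<nu> / \<sigma> powr \<nu>) * \<psi> \<sigma> \<le> (1 / c) * \<psi> lam"
    using c pos lam False by (simp add: field_simps)
  moreover have "(lam / (\<sigma> + lam)) powr \<nu> \<le> (lam / \<sigma>) powr \<nu>"
    using False lam \<nu> by (intro powr_mono2 divide_left_mono) auto
  then have "(lam / (\<sigma> + lam)) powr \<nu> * \<psi> \<sigma> \<le> (lam powr \<nu> / \<sigma> powr \<nu>) * \<psi> \<sigma>"
    using pos False lam by (intro mult_right_mono) (auto simp: powr_divide)
  moreover have "(1 / c) * \<psi> lam \<le> max 1 (1 / c) * \<psi> lam" using pos by (intro mult_right_mono) auto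
  ultimately show ?thesis by linarith
qed

section \<open>Concentration of empirical means\<close>

text \<open>This is cosh of the square root of u, as an everywhere convergent series without the
  root. It will be applied to squared norms, which are affine in the inner product with an increment
  of given norm.\<close>

definition cosh_sqrt :: "real \<Rightarrow> real" where
  "cosh_sqrt u = (\<Sum>n. u ^ n / fact (2 * n))"

lemma cosh_sqrt_sums: "(\<lambda>n. u ^ n / fact (2 * n)) sums cosh_sqrt u" for u :: real
proof -
  have "summable (\<lambda>n. norm (u ^ n / fact (2 * n)))"
  proof (rule summable_comparison_test')
    show "summable (\<lambda>n. \<bar>u\<bar> ^ n / fact n)" using summable_exp[of "\<bar>u\<bar>"] by (simp add: divide_inverse mult.commute)
    show "norm (norm (u ^ n / fact (2 * n))) \<le> \<bar>u\<bar> ^ n / fact n" for n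
      by (simp add: power_abs) (intro divide_left_mono fact_mono; simp)
  qed
  then show ?thesis unfolding cosh_sqrt_def by (rule summable_sums[OF summable_norm_cancel])
qed

lemma cosh_sqrt_power2: "cosh_sqrt (x\<^sup>2) = cosh x"
proof -
  have "(\<lambda>n. if even n then x ^ n /\<^sub>R fact n else 0) sums cosh x" by (rule cosh_converges)
  moreover have "(\<lambda>n. if even n then x ^ n /\<^sub>R fact n else 0) sums cosh x \<longleftrightarrow>
        (\<lambda>n. (\<lambda>n. if even n then x ^ n /\<^sub>R fact n else 0) (2 * n)) sums cosh x"
    by (rule sums_mono_reindex[symmetric]) (auto simp: strict_mono_def elim!: evenE)
  ultimately have "(\<lambda>n. x ^ (2 * n) /\<^sub>R fact (2 * n)) sums cosh x" by simp
  then have "(\<lambda>n. (x\<^sup>2) ^ n / fact (2 * n)) sums cosh x"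
    by (simp add: power_mult[symmetric] divide_inverse mult.commute[of _ "inverse _"])
  then show ?thesis using cosh_sqrt_sums sums_unique2 by blast
qed

text \<open>Every monomial of the series is convex on the half line and has a positive
  coefficient.\<close>

lemma convex_on_cosh_sqrt: "convex_on {0..} cosh_sqrt"
proof (rule convex_onI)
  fix t x y :: real assume t: "0 < t" "t < 1" and xy: "x \<in> {0..}" "y \<in> {0..}"
  have "((1 - t) *\<^sub>R x + t *\<^sub>R y) ^ n / fact (2 * n)
      \<le> (1 - t) * (x ^ n / fact (2 * n)) + t * (y ^ n / fact (2 * n))" for n
  proof -
    have "convex_on {0..} (\<lambda>x::real. x ^ n)"
      using convex_power_odd convex_on_subset[OF convex_power_even] by (cases "even n") auto
    then have "((1 - t) *\<^sub>R x + t *\<^sub>R y) ^ n \<le> (1 - t) * x ^ n + t * y ^ n"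
      using convex_onD t xy by (metis less_imp_le)
    then show ?thesis
      by (simp add: add_divide_distrib[symmetric] divide_right_mono)
  qed
  then show "cosh_sqrt ((1 - t) *\<^sub>R x + t *\<^sub>R y) \<le> (1 - t) * cosh_sqrt x + t * cosh_sqrt y"
    by (rule sums_le[OF _ cosh_sqrt_sums
        sums_add[OF sums_mult[OF cosh_sqrt_sums] sums_mult[OF cosh_sqrt_sums]]])
qed simp

lemma sinh_ge_self: "0 \<le> r \<Longrightarrow> r \<le> sinh r" for r :: real
proof -
  assume r: "0 \<le> r"
  have "sinh 0 - 0 \<le> sinh r - r"
  proof (rule DERIV_nonneg_imp_nondecreasing[OF r])
    fix x :: real
    show "\<exists>y. ((\<lambda>x. sinh x - x) has_real_derivative y) (at x) \<and> 0 \<le> y"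
      by (rule exI[of _ "cosh x - 1"]) (auto intro!: derivative_eq_intros simp: cosh_real_ge_1)
  qed
  then show ?thesis by simp
qed

text \<open>The left side is a convex function of \<open>c\<close>, the right side is affine in \<open>c\<close>, so it suffices
  to compare them for \<open>c = r\<close> and \<open>c = - r\<close>, where the left side is \<open>cosh (a \<plusminus> r)\<close>.\<close>

lemma cosh_step:
  fixes a r c :: real
  assumes a: "0 \<le> a" and r: "0 \<le> r" and c: "\<bar>c\<bar> \<le> r"
  shows "cosh_sqrt (a\<^sup>2 + 2 * a * c + r\<^sup>2) \<le> cosh a + sinh a * c + cosh a * (exp r - 1 - r)"
proof -
  have e: "exp r = cosh r + sinh r" by (simp add: cosh_plus_sinh)
  have m: "sinh a * (sinh r - r) \<le> cosh a * (sinh r - r)" "- (sinh a * (sinh r - r)) \<le> cosh a * (sinh r - r)"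
  proof -
    have "\<bar>sinh a\<bar> \<le> cosh a" using sinh_less_cosh_real[of a] sinh_less_cosh_real[of "-a"] by simp
    then have "\<bar>sinh a\<bar> * (sinh r - r) \<le> cosh a * (sinh r - r)"
      using sinh_ge_self[OF r] by (intro mult_right_mono) auto
    moreover have "sinh a \<ge> 0" using a by simp
    moreover have "0 \<le> sinh a * (sinh r - r)" using a sinh_ge_self[OF r] by simp
    ultimately show "sinh a * (sinh r - r) \<le> cosh a * (sinh r - r)" "- (sinh a * (sinh r - r)) \<le> cosh a * (sinh r - r)"
      by auto
  qed
  have p: "cosh (a + r) \<le> cosh a + sinh a * r + cosh a * (exp r - 1 - r)"
    using m(1) unfolding cosh_add e by (simp add: algebra_simps)
  have n: "cosh (a - r) \<le> cosh a - sinh a * r + cosh a * (exp r - 1 - r)"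
    using m(2) unfolding cosh_diff e by (simp add: algebra_simps)
  show ?thesis
  proof (cases "r = 0")
    case True
    with c show ?thesis by (simp add: cosh_sqrt_power2)
  next
    case False
    \<comment> \<open>The weight that writes c as the convex combination (1 - t) * (- r) + t *
      r.\<close>
    define t where "t = (r + c) / (2 * r)"
    have t: "0 \<le> t" "t \<le> 1" using False r c by (auto simp: t_def field_simps)
    have c': "c = t * r - (1 - t) * r" using False by (simp add: t_def field_simps)
    have "a\<^sup>2 + 2 * a * c + r\<^sup>2 = (1 - t) *\<^sub>R (a - r)\<^sup>2 + t *\<^sub>R (a + r)\<^sup>2"
      unfolding c' by (simp add: power2_eq_square algebra_simps)
    then have "cosh_sqrt (a\<^sup>2 + 2 * a * c + r\<^sup>2) \<le> (1 - t) * cosh_sqrt ((a - r)\<^sup>2) + t * cosh_sqrt ((a + r)\<^sup>2)"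
      using convex_onD[OF convex_on_cosh_sqrt t, of "(a - r)\<^sup>2" "(a + r)\<^sup>2"] by simp
    also have "\<dots> = (1 - t) * cosh (a - r) + t * cosh (a + r)" by (simp add: cosh_sqrt_power2)
    also have "\<dots> \<le> (1 - t) * (cosh a - sinh a * r + cosh a * (exp r - 1 - r))
        + t * (cosh a + sinh a * r + cosh a * (exp r - 1 - r))"
      using t p n by (intro add_mono mult_left_mono) auto
    also have "\<dots> = cosh a + sinh a * c + cosh a * (exp r - 1 - r)"
      unfolding c' by (simp add: algebra_simps)
    finally show ?thesis .
  qed
qed

lemma L2_set_power2: "(L2_set f I)\<^sup>2 = (\<Sum>i\<in>I. (f i)\<^sup>2)"
  by (simp add: L2_set_def sum_nonneg)

lemma L2_set_add_power2:
  "(L2_set (\<lambda>i. f i + g i) I)\<^sup>2 = (L2_set f I)\<^sup>2 + 2 * (\<Sum>i\<in>I. f i * g i) + (L2_set g I)\<^sup>2"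
  by (simp add: L2_set_power2 power2_sum sum.distrib sum_distrib_left algebra_simps)

lemma abs_sum_mult_le_L2: "\<bar>\<Sum>i\<in>I. f i * g i\<bar> \<le> L2_set f I * L2_set g I"
proof -
  have "\<bar>\<Sum>i\<in>I. f i * g i\<bar> \<le> (\<Sum>i\<in>I. \<bar>f i\<bar> * \<bar>g i\<bar>)"
    by (rule order_trans[OF sum_abs]) (simp add: abs_mult)
  also have "\<dots> \<le> L2_set f I * L2_set g I" by (rule L2_set_mult_ineq)
  finally show ?thesis .
qed

text \<open>\<open>cosh_step\<close> with c the component of \<open>g\<close> along
  \<open>f\<close>; the bound 1 on the increment turns exp r - 1 - r into r^2. The coefficient
  \<open>s\<close> depends only on \<open>f\<close>, so the last term is linear in \<open>g\<close>
  and has mean 0 for a centred increment.\<close>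

lemma cosh_L2_set_add:
  fixes f g :: "'i \<Rightarrow> real" and I :: "'i set"
  defines "s \<equiv> (if L2_set f I = 0 then 0 else sinh (L2_set f I) / L2_set f I)"
  assumes g: "L2_set g I \<le> 1"
  shows "cosh (L2_set (\<lambda>i. f i + g i) I)
      \<le> cosh (L2_set f I) * (1 + (L2_set g I)\<^sup>2) + s * (\<Sum>i\<in>I. f i * g i)"
proof -
  let ?a = "L2_set f I" and ?r = "L2_set g I" and ?d = "\<Sum>i\<in>I. f i * g i"
  have er: "exp ?r - 1 - ?r \<le> ?r\<^sup>2"
    using exp_bound[of ?r] g by (simp add: L2_set_nonneg)
  define c where "c = (if ?a = 0 then 0 else ?d / ?a)"
  have d: "\<bar>?d\<bar> \<le> ?a * ?r" by (rule abs_sum_mult_le_L2)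
  have ac: "?a * c = ?d" using d by (auto simp: c_def)
  have cr: "\<bar>c\<bar> \<le> ?r"
  proof (cases "?a = 0")
    case False
    then have "0 < ?a" using L2_set_nonneg[of f I] by linarith
    with d show ?thesis by (simp add: c_def pos_divide_le_eq mult.commute)
  qed (simp add: c_def L2_set_nonneg)
  have "cosh (L2_set (\<lambda>i. f i + g i) I) = cosh_sqrt (?a\<^sup>2 + 2 * ?a * c + ?r\<^sup>2)"
    using ac by (simp add: cosh_sqrt_power2[symmetric] L2_set_add_power2 mult.assoc)
  also have "\<dots> \<le> cosh ?a + sinh ?a * c + cosh ?a * (exp ?r - 1 - ?r)"
    by (rule cosh_step) (use cr in \<open>auto simp: L2_set_nonneg\<close>)
  also have "\<dots> \<le> cosh ?a + sinh ?a * c + cosh ?a * ?r\<^sup>2"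
    using er by (intro add_left_mono mult_left_mono) (auto intro: order_trans[OF _ cosh_real_ge_1])
  also have "sinh ?a * c = s * ?d" by (auto simp: s_def c_def)
  finally show ?thesis by (simp add: algebra_simps)
qed

section \<open>Tail bounds for sums of independent bounded vectors\<close>

context prob_space
begin

context
  fixes I :: "'i set" and \<xi> :: "'i \<Rightarrow> 'a \<Rightarrow> real" and v :: real
  assumes I: "finite I"
    and \<xi>[measurable]: "\<And>i. \<xi> i \<in> borel_measurable M"
    and bounded: "AE z in M. L2_set (\<lambda>i. \<xi> i z) I \<le> 1"
    and centred: "\<And>i. i \<in> I \<Longrightarrow> (\<integral>z. \<xi> i z \<partial>M) = 0"
    and variance: "(\<integral>z. (L2_set (\<lambda>i. \<xi> i z) I)\<^sup>2 \<partial>M) \<le> v"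
begin

private lemma L2_meas[measurable]: "(\<lambda>z. L2_set (\<lambda>i. f i + \<xi> i z) I) \<in> borel_measurable M"
  "(\<lambda>z. L2_set (\<lambda>i. \<xi> i z) I) \<in> borel_measurable M"
  unfolding L2_set_def by measurable

private lemma integrable_coord: "i \<in> I \<Longrightarrow> integrable M (\<xi> i)"
proof (rule integrable_const_bound[where B = 1])
  assume i: "i \<in> I"
  show "AE z in M. norm (\<xi> i z) \<le> 1"
    using bounded
  proof eventually_elim
    case (elim z)
    have "norm (\<xi> i z) \<le> L2_set (\<lambda>i. \<bar>\<xi> i z\<bar>) I"
      using member_le_L2_set[OF I i, of "\<lambda>i. \<bar>\<xi> i z\<bar>"] by simp
    also have "\<dots> = L2_set (\<lambda>i. \<xi> i z) I" by (simp add: L2_set_def)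
    also note elim
    finally show ?case .
  qed
qed simp

private lemma integrable_sq: "integrable M (\<lambda>z. (L2_set (\<lambda>i. \<xi> i z) I)\<^sup>2)"
proof (rule integrable_const_bound[where B = 1])
  show "AE z in M. norm ((L2_set (\<lambda>i. \<xi> i z) I)\<^sup>2) \<le> 1"
    using bounded by eventually_elim (simp add: power_le_one L2_set_nonneg)
qed measurable

private lemma v_nonneg: "0 \<le> v"
  by (rule order_trans[OF _ variance]) (simp add: integral_nonneg_AE)

private lemma integral_step:
  "integrable M (\<lambda>z. a + b * (L2_set (\<lambda>i. \<xi> i z) I)\<^sup>2 + s * (\<Sum>i\<in>I. f i * \<xi> i z))"
  "(\<integral>z. a + b * (L2_set (\<lambda>i. \<xi> i z) I)\<^sup>2 + s * (\<Sum>i\<in>I. f i * \<xi> i z) \<partial>M)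
     = a + b * (\<integral>z. (L2_set (\<lambda>i. \<xi> i z) I)\<^sup>2 \<partial>M)"
  using integrable_coord integrable_sq centred by (auto simp: prob_space)

text \<open>Integrating \<open>cosh_L2_set_add\<close> over the new sample, centring removes the
  linear term and the quadratic one contributes at most \<open>v\<close>.\<close>

private lemma cosh_step_integral:
  "(\<integral>\<^sup>+z. ennreal (cosh (L2_set (\<lambda>i. f i + \<xi> i z) I)) \<partial>M) \<le> ennreal (cosh (L2_set f I) * (1 + v))"
proof -
  define a where "a = cosh (L2_set f I)"
  define s where "s = (if L2_set f I = 0 then 0 else sinh (L2_set f I) / L2_set f I)"
  let ?R = "\<lambda>z. a + a * (L2_set (\<lambda>i. \<xi> i z) I)\<^sup>2 + s * (\<Sum>i\<in>I. f i * \<xi> i z)"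
  have AE: "AE z in M. cosh (L2_set (\<lambda>i. f i + \<xi> i z) I) \<le> ?R z"
    using bounded
  proof eventually_elim
    case (elim z)
    from cosh_L2_set_add[OF this, of f] show ?case by (simp add: a_def s_def algebra_simps)
  qed
  then have "(\<integral>\<^sup>+z. ennreal (cosh (L2_set (\<lambda>i. f i + \<xi> i z) I)) \<partial>M) \<le> (\<integral>\<^sup>+z. ennreal (?R z) \<partial>M)"
    by (intro nn_integral_mono_AE) (auto intro: ennreal_leI)
  also have "\<dots> = ennreal (\<integral>z. ?R z \<partial>M)"
  proof (rule nn_integral_eq_integral[OF integral_step(1)])
    show "AE z in M. 0 \<le> ?R z"
      using AE by eventually_elim (rule order_trans[rotated], auto)
  qed
  also have "(\<integral>z. ?R z \<partial>M) = a + a * (\<integral>z. (L2_set (\<lambda>i. \<xi> i z) I)\<^sup>2 \<partial>M)" by (rule integral_step(2))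
  also have "\<dots> \<le> a + a * v"
    using variance by (intro add_left_mono mult_left_mono) (auto simp: a_def)
  also have "a + a * v = cosh (L2_set f I) * (1 + v)" by (simp add: a_def algebra_simps)
  finally show ?thesis by (simp add: ennreal_leI)
qed

private lemma square_step_integral:
  "(\<integral>\<^sup>+z. ennreal ((L2_set (\<lambda>i. f i + \<xi> i z) I)\<^sup>2) \<partial>M) \<le> ennreal ((L2_set f I)\<^sup>2 + v)"
proof -
  let ?R = "\<lambda>z. (L2_set f I)\<^sup>2 + 1 * (L2_set (\<lambda>i. \<xi> i z) I)\<^sup>2 + 2 * (\<Sum>i\<in>I. f i * \<xi> i z)"
  have eq: "(L2_set (\<lambda>i. f i + \<xi> i z) I)\<^sup>2 = ?R z" for z by (simp add: L2_set_add_power2)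
  have "(\<integral>\<^sup>+z. ennreal ((L2_set (\<lambda>i. f i + \<xi> i z) I)\<^sup>2) \<partial>M) = ennreal (\<integral>z. ?R z \<partial>M)"
    unfolding eq
  proof (rule nn_integral_eq_integral[OF integral_step(1)])
    show "AE z in M. 0 \<le> ?R z" unfolding eq[symmetric] by simp
  qed
  also have "\<dots> \<le> ennreal ((L2_set f I)\<^sup>2 + v)"
    unfolding integral_step(2) using variance by (intro ennreal_leI) simp
  finally show ?thesis .
qed

private lemma prod_sf: "product_sigma_finite (\<lambda>_::nat. M)"
  by standard

private lemma sum_meas[measurable]:
  "(\<lambda>z. L2_set (\<lambda>i. \<Sum>j<n. \<xi> i (z j)) I) \<in> borel_measurable (Pi\<^sub>M {..<n} (\<lambda>_. M))"
proof -
  have [measurable]: "(\<lambda>z. \<xi> i (z j)) \<in> borel_measurable (Pi\<^sub>M {..<n} (\<lambda>_. M))" if "j < n" for i j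
    by (rule measurable_compose[OF _ \<xi>[of i]], rule measurable_component_singleton) (simp add: that)
  have [measurable]: "(\<lambda>z. \<Sum>j<n. \<xi> i (z j)) \<in> borel_measurable (Pi\<^sub>M {..<n} (\<lambda>_. M))" for i
    by (rule borel_measurable_sum) simp
  show ?thesis unfolding L2_set_def by measurable
qed

text \<open>Fubini in the last coordinate of the sample, for a general function of the norm so that
  it serves both cosh and the square.\<close>

private lemma integral_Suc:
  assumes [measurable]: "h \<in> borel_measurable borel"
  shows "(\<integral>\<^sup>+z. ennreal (h (L2_set (\<lambda>i. \<Sum>j<Suc n. \<xi> i (z j)) I)) \<partial>(Pi\<^sub>M {..<Suc n} (\<lambda>_. M)))
    = (\<integral>\<^sup>+x. \<integral>\<^sup>+y. ennreal (h (L2_set (\<lambda>i. (\<Sum>j<n. \<xi> i (x j)) + \<xi> i y) I)) \<partial>M \<partial>(Pi\<^sub>M {..<n} (\<lambda>_. M)))"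
proof -
  interpret product_sigma_finite "\<lambda>_::nat. M" by (rule prod_sf)
  have S: "{..<Suc n} = insert n {..<n}" by auto
  have meas: "(\<lambda>z. ennreal (h (L2_set (\<lambda>i. \<Sum>j<Suc n. \<xi> i (z j)) I))) \<in> borel_measurable (Pi\<^sub>M {..<Suc n} (\<lambda>_. M))"
    by measurable
  have eq: "(\<Sum>j<Suc n. \<xi> i ((x(n := y)) j)) = (\<Sum>j<n. \<xi> i (x j)) + \<xi> i y" for i x y
    by simp
  have "(\<integral>\<^sup>+z. ennreal (h (L2_set (\<lambda>i. \<Sum>j<Suc n. \<xi> i (z j)) I)) \<partial>(Pi\<^sub>M {..<Suc n} (\<lambda>_. M)))
    = (\<integral>\<^sup>+x. \<integral>\<^sup>+y. ennreal (h (L2_set (\<lambda>i. \<Sum>j<Suc n. \<xi> i ((x(n := y)) j)) I)) \<partial>M \<partial>(Pi\<^sub>M {..<n} (\<lambda>_. M)))"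
    unfolding S by (rule product_nn_integral_insert[OF _ _ meas[unfolded S]]) auto
  then show ?thesis unfolding eq .
qed

private lemma cosh_integral:
  fixes n :: nat
  shows "(\<integral>\<^sup>+z. ennreal (cosh (L2_set (\<lambda>i. \<Sum>j<n. \<xi> i (z j)) I)) \<partial>(Pi\<^sub>M {..<n} (\<lambda>_. M))) \<le> ennreal ((1 + v) ^ n)"
proof (induction n)
  case 0
  interpret P: prob_space "Pi\<^sub>M {} (\<lambda>_::nat. M)" by (rule prob_space_PiM) (rule prob_space_axioms)
  show ?case by (simp add: L2_set_def P.emeasure_space_1)
next
  case (Suc n)
  have [measurable]: "(cosh :: real \<Rightarrow> real) \<in> borel_measurable borel"
    by (intro borel_measurable_continuous_onI continuous_intros)
  have "(\<integral>\<^sup>+z. ennreal (cosh (L2_set (\<lambda>i. \<Sum>j<Suc n. \<xi> i (z j)) I)) \<partial>(Pi\<^sub>M {..<Suc n} (\<lambda>_. M)))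
    \<le> (\<integral>\<^sup>+x. ennreal (cosh (L2_set (\<lambda>i. (\<Sum>j<n. \<xi> i (x j))) I)) * ennreal (1 + v) \<partial>(Pi\<^sub>M {..<n} (\<lambda>_. M)))"
    unfolding integral_Suc[OF \<open>cosh \<in> _\<close>] using v_nonneg
    by (intro nn_integral_mono order_trans[OF cosh_step_integral]) (simp add: ennreal_mult)
  also have "\<dots> = (\<integral>\<^sup>+x. ennreal (cosh (L2_set (\<lambda>i. (\<Sum>j<n. \<xi> i (x j))) I)) \<partial>(Pi\<^sub>M {..<n} (\<lambda>_. M))) * ennreal (1 + v)"
    by (rule nn_integral_multc) measurable
  also have "\<dots> \<le> ennreal ((1 + v) ^ n) * ennreal (1 + v)"
    by (rule mult_right_mono[OF Suc]) simp
  also have "\<dots> = ennreal ((1 + v) ^ Suc n)"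
    using v_nonneg by (subst ennreal_mult[symmetric]) (simp_all add: mult.commute)
  finally show ?case .
qed

private lemma square_integral:
  fixes n :: nat
  shows "(\<integral>\<^sup>+z. ennreal ((L2_set (\<lambda>i. \<Sum>j<n. \<xi> i (z j)) I)\<^sup>2) \<partial>(Pi\<^sub>M {..<n} (\<lambda>_. M))) \<le> ennreal (real n * v)"
proof (induction n)
  case 0
  show ?case by (simp add: L2_set_def)
next
  case (Suc n)

  interpret P: prob_space "Pi\<^sub>M {..<n} (\<lambda>_. M)" by (rule prob_space_PiM) (rule prob_space_axioms)
  have [measurable]: "(\<lambda>x::real. x\<^sup>2) \<in> borel_measurable borel" by measurable
  have "(\<integral>\<^sup>+z. ennreal ((L2_set (\<lambda>i. \<Sum>j<Suc n. \<xi> i (z j)) I)\<^sup>2) \<partial>(Pi\<^sub>M {..<Suc n} (\<lambda>_. M)))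
    \<le> (\<integral>\<^sup>+x. ennreal ((L2_set (\<lambda>i. (\<Sum>j<n. \<xi> i (x j))) I)\<^sup>2) + ennreal v \<partial>(Pi\<^sub>M {..<n} (\<lambda>_. M)))"
    unfolding integral_Suc[OF \<open>(\<lambda>x::real. x\<^sup>2) \<in> _\<close>] using v_nonneg
    by (intro nn_integral_mono order_trans[OF square_step_integral]) simp
  also have "\<dots> = (\<integral>\<^sup>+x. ennreal ((L2_set (\<lambda>i. (\<Sum>j<n. \<xi> i (x j))) I)\<^sup>2) \<partial>(Pi\<^sub>M {..<n} (\<lambda>_. M))) + ennreal v"
    by (subst nn_integral_add) (simp_all add: P.emeasure_space_1)
  also have "\<dots> \<le> ennreal (real n * v) + ennreal v"
    by (rule add_right_mono[OF Suc])
  also have "\<dots> = ennreal (real (Suc n) * v)"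
    using v_nonneg by (simp add: ennreal_plus[symmetric] algebra_simps del: ennreal_plus)
  finally show ?case .
qed

text \<open>Markov's inequality with a free comparison function: cosh gives the exponential tail,
  the square gives Chebyshev's inequality.\<close>

private lemma markov:
  fixes n :: nat
  assumes int: "(\<integral>\<^sup>+z. ennreal (h (L2_set (\<lambda>i. \<Sum>j<n. \<xi> i (z j)) I)) \<partial>(Pi\<^sub>M {..<n} (\<lambda>_. M))) \<le> ennreal K"
    and h: "\<And>x. t < x \<Longrightarrow> c \<le> h x" and c: "0 < c" and K: "0 \<le> K"
  shows "measure (Pi\<^sub>M {..<n} (\<lambda>_. M)) {z \<in> space (Pi\<^sub>M {..<n} (\<lambda>_. M)). t < L2_set (\<lambda>i. \<Sum>j<n. \<xi> i (z j)) I} \<le> K / c"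
proof -
  let ?P = "Pi\<^sub>M {..<n} (\<lambda>_. M)"
  let ?A = "{z \<in> space ?P. t < L2_set (\<lambda>i. \<Sum>j<n. \<xi> i (z j)) I}"
  interpret P: prob_space ?P by (rule prob_space_PiM) (rule prob_space_axioms)
  have [measurable]: "?A \<in> sets ?P" by measurable
  have "ennreal c * emeasure ?P ?A = (\<integral>\<^sup>+z. ennreal c * indicator ?A z \<partial>?P)"
    by (simp add: nn_integral_cmult)
  also have "\<dots> \<le> (\<integral>\<^sup>+z. ennreal (h (L2_set (\<lambda>i. \<Sum>j<n. \<xi> i (z j)) I)) \<partial>?P)"
    using h by (intro nn_integral_mono) (auto simp: indicator_def intro!: ennreal_leI)
  also note int
  finally have "ennreal (c * measure ?P ?A) \<le> ennreal K"
    using c by (simp add: P.emeasure_eq_measure ennreal_mult)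
  then have "c * measure ?P ?A \<le> K" using K by (simp add: ennreal_le_iff)
  then show ?thesis using c by (simp add: field_simps)
qed

text \<open>When n v <= 1 the bound (1 + v)^n on the cosh moment is at most e, while cosh exceeds
  exp t / 2 beyond t. The second moment bound is kept as well because it is the sharper one for
  moderate t.\<close>

lemma centred_sum_tail:
  fixes n :: nat
  assumes nv: "real n * v \<le> 1" and t: "0 < t"
  defines "A \<equiv> {z \<in> space (Pi\<^sub>M {..<n} (\<lambda>_. M)). t < L2_set (\<lambda>i. \<Sum>j<n. \<xi> i (z j)) I}"
  shows "A \<in> sets (Pi\<^sub>M {..<n} (\<lambda>_. M))"
    and "measure (Pi\<^sub>M {..<n} (\<lambda>_. M)) A \<le> 2 * exp (1 - t)"
    and "measure (Pi\<^sub>M {..<n} (\<lambda>_. M)) A \<le> 1 / t\<^sup>2"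
proof -
  show "A \<in> sets (Pi\<^sub>M {..<n} (\<lambda>_. M))" unfolding A_def by measurable
  have "measure (Pi\<^sub>M {..<n} (\<lambda>_. M)) A \<le> (1 + v) ^ n / (exp t / 2)"
    unfolding A_def
  proof (rule markov[OF cosh_integral])
    fix x assume "t < x"
    then have "exp t \<le> exp x + exp (- x)" by (simp add: add_increasing2)
    then show "exp t / 2 \<le> cosh x" by (simp add: cosh_def)
  qed (use v_nonneg in auto)
  also have "(1 + v) ^ n \<le> exp v ^ n" using v_nonneg by (intro power_mono exp_ge_add_one_self) auto
  also have "\<dots> = exp (real n * v)" by (simp add: exp_of_nat_mult)
  also have "\<dots> \<le> exp 1" using nv by simp
  also have "exp 1 / (exp t / 2) = 2 * exp (1 - t)" by (simp add: exp_diff)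
  finally show "measure (Pi\<^sub>M {..<n} (\<lambda>_. M)) A \<le> 2 * exp (1 - t)" by (simp add: divide_right_mono)
  have "measure (Pi\<^sub>M {..<n} (\<lambda>_. M)) A \<le> (real n * v) / t\<^sup>2"
    unfolding A_def
    by (rule markov[OF square_integral]) (use t v_nonneg in \<open>auto intro: power_mono\<close>)
  also have "\<dots> \<le> 1 / t\<^sup>2" using nv t by (intro divide_right_mono) auto
  finally show "measure (Pi\<^sub>M {..<n} (\<lambda>_. M)) A \<le> 1 / t\<^sup>2" .
qed

end

end

lemma L2_set_mono_subset:
  assumes "finite J" "I \<subseteq> J"
  shows "L2_set f I \<le> L2_set f J"
  unfolding L2_set_def using assms by (intro real_sqrt_le_mono sum_mono2) auto

context prob_space
begin

text \<open>Centring at most doubles the bound \<open>R\<close>, so division by c = 2 R + \<sigma>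
  sqrt n makes the centred variables bounded by 1 with n times their variance at most 1. A deviation
  a T of the mean corresponds to 2 a L for the normalised sum, since T = 2 L c / n.\<close>

lemma empirical_mean_tail:
  fixes I :: "'i set" and \<xi> :: "'i \<Rightarrow> 'a \<Rightarrow> real" and n :: nat
  assumes I: "finite I"
    and \<xi>[measurable]: "\<And>i. \<xi> i \<in> borel_measurable M"
    and bounded: "AE z in M. L2_set (\<lambda>i. \<xi> i z) I \<le> R"
    and second: "(\<integral>z. (L2_set (\<lambda>i. \<xi> i z) I)\<^sup>2 \<partial>M) \<le> \<sigma>\<^sup>2"
    and R: "0 \<le> R" and \<sigma>: "0 \<le> \<sigma>" and n: "1 \<le> n" and L: "0 < L" and a: "0 < a"
  defines "T \<equiv> 2 * (2 * R / n + \<sigma> / sqrt n) * L"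
    and "dev \<equiv> \<lambda>z. L2_set (\<lambda>i. (\<Sum>j<n. \<xi> i (z j)) / n - (\<integral>z. \<xi> i z \<partial>M)) I"
  defines "A \<equiv> {z \<in> space (Pi\<^sub>M {..<n} (\<lambda>_. M)). a * T < dev z}"
  shows "A \<in> sets (Pi\<^sub>M {..<n} (\<lambda>_. M))"
    and "measure (Pi\<^sub>M {..<n} (\<lambda>_. M)) A \<le> 2 * exp (1 - 2 * a * L)"
    and "measure (Pi\<^sub>M {..<n} (\<lambda>_. M)) A \<le> 1 / (2 * a * L)\<^sup>2"
proof -
  let ?P = "Pi\<^sub>M {..<n} (\<lambda>_. M)"
  interpret P: prob_space ?P by (rule prob_space_PiM) (rule prob_space_axioms)
  define m where "m i = (\<integral>z. \<xi> i z \<partial>M)" for i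
  let ?X = "\<lambda>z. L2_set (\<lambda>i. \<xi> i z) I"
  have [measurable]: "?X \<in> borel_measurable M" unfolding L2_set_def by measurable
  have coord: "AE z in M. norm (\<xi> i z) \<le> R" if i: "i \<in> I" for i
    using bounded
  proof eventually_elim
    case (elim z)
    have "norm (\<xi> i z) \<le> L2_set (\<lambda>i. \<bar>\<xi> i z\<bar>) I"
      using member_le_L2_set[OF I i, of "\<lambda>i. \<bar>\<xi> i z\<bar>"] by simp
    also have "\<dots> = ?X z" by (simp add: L2_set_def)
    also note elim
    finally show ?case .
  qed
  have int: "integrable M (\<xi> i)" if "i \<in> I" for i
    by (rule integrable_const_bound[OF coord[OF that]]) simp
  have intX: "integrable M (\<lambda>z. (?X z)\<^sup>2)"
  proof (rule integrable_const_bound[where B = "R\<^sup>2"])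
    show "AE z in M. norm ((?X z)\<^sup>2) \<le> R\<^sup>2"
      using bounded by eventually_elim (simp add: power_mono L2_set_nonneg)
  qed measurable
  have mm: "(\<integral>z. (\<Sum>i\<in>I. m i * \<xi> i z) \<partial>M) = (L2_set m I)\<^sup>2"
    using int by (simp add: L2_set_power2) (simp add: m_def power2_eq_square)
  \<comment> \<open>The squared norm of the mean is the expectation of its inner product with \<xi>,
    hence at most L2_set m I * R.\<close>
  have mR: "L2_set m I \<le> R"
  proof -
    have "(L2_set m I)\<^sup>2 \<le> (\<integral>z. L2_set m I * R \<partial>M)"
      unfolding mm[symmetric]
    proof (rule integral_mono_AE)
      show "AE z in M. (\<Sum>i\<in>I. m i * \<xi> i z) \<le> L2_set m I * R"
        using bounded
      proof eventually_elim
        case (elim z)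
        have "(\<Sum>i\<in>I. m i * \<xi> i z) \<le> L2_set m I * ?X z"
          using abs_sum_mult_le_L2[of m "\<lambda>i. \<xi> i z" I] by linarith
        also have "\<dots> \<le> L2_set m I * R" using elim by (intro mult_left_mono L2_set_nonneg)
        finally show ?case .
      qed
    qed (use int in auto)
    then have "L2_set m I * L2_set m I \<le> L2_set m I * R" by (simp add: prob_space power2_eq_square)
    then show ?thesis
      using R L2_set_nonneg[of m I] by (cases "L2_set m I = 0") (auto simp: mult_le_cancel_left)
  qed
  have centred_le: "L2_set (\<lambda>i. \<xi> i z - m i) I \<le> 2 * R" if "?X z \<le> R" for z
  proof -
    have "L2_set (\<lambda>i. \<xi> i z + - m i) I \<le> ?X z + L2_set (\<lambda>i. - m i) I"
      by (rule L2_set_triangle_ineq)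
    also have "L2_set (\<lambda>i. - m i) I = L2_set m I" by (simp add: L2_set_def)
    finally show ?thesis using mR that by simp
  qed
  have var: "(\<integral>z. (L2_set (\<lambda>i. \<xi> i z - m i) I)\<^sup>2 \<partial>M) \<le> \<sigma>\<^sup>2"
  proof -
    have e: "(L2_set (\<lambda>i. \<xi> i z - m i) I)\<^sup>2 = (?X z)\<^sup>2 - 2 * (\<Sum>i\<in>I. m i * \<xi> i z) + (L2_set m I)\<^sup>2" for z
      by (simp add: L2_set_power2 power2_diff sum.distrib sum_subtractf sum_distrib_left algebra_simps)
    have "(\<integral>z. (L2_set (\<lambda>i. \<xi> i z - m i) I)\<^sup>2 \<partial>M)
        = (\<integral>z. (?X z)\<^sup>2 \<partial>M) - 2 * (L2_set m I)\<^sup>2 + (L2_set m I)\<^sup>2"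
      unfolding e mm[symmetric] using int intX by (simp add: prob_space)
    also have "\<dots> \<le> \<sigma>\<^sup>2" using second zero_le_power2[of "L2_set m I"] by linarith
    finally show ?thesis .
  qed
  have [measurable]: "(\<lambda>z. \<xi> i (z j)) \<in> borel_measurable ?P" if "j < n" for i j
    by (rule measurable_compose[OF _ \<xi>[of i]], rule measurable_component_singleton) (simp add: that)
  have [measurable]: "(\<lambda>z. \<Sum>j<n. \<xi> i (z j)) \<in> borel_measurable ?P" for i
    by (rule borel_measurable_sum) simp
  have dev_meas[measurable]: "dev \<in> borel_measurable ?P"
    unfolding dev_def L2_set_def by measurable
  show "A \<in> sets ?P" unfolding A_def by measurable
  have "measure ?P A \<le> 2 * exp (1 - 2 * a * L) \<and> measure ?P A \<le> 1 / (2 * a * L)\<^sup>2"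
  proof (cases "2 * R + \<sigma> * sqrt n = 0")
    \<comment> \<open>Here R = 0: all coordinates vanish almost surely and there is nothing to
      normalise by.\<close>
    case True
    then have "R = 0" using R \<sigma> n by (simp add: add_nonneg_eq_0_iff)
    have z: "AE y in M. \<forall>i\<in>I. \<xi> i y = 0"
    proof -
      have "AE y in M. \<xi> i y = 0" if "i \<in> I" for i
        using coord[OF that] \<open>R = 0\<close> by simp
      then show ?thesis using I by (simp add: AE_finite_all)
    qed
    have m0: "m i = 0" if "i \<in> I" for i
      unfolding m_def by (rule integral_eq_zero_AE) (use z that in \<open>auto elim: eventually_mono\<close>)
    have "AE z in ?P. \<forall>i\<in>I. \<xi> i (z j) = 0" if "j < n" for j
      by (rule AE_PiM_component[where M = "\<lambda>_. M" and i = j and P = "\<lambda>y. \<forall>i\<in>I. \<xi> i y = 0"])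
        (use that z prob_space_axioms in auto)
    then have "AE z in ?P. \<forall>j<n. \<forall>i\<in>I. \<xi> i (z j) = 0"
      by (simp add: AE_all_countable)
    then have "AE z in ?P. dev z = 0"
    proof eventually_elim
      case (elim z)
      then have "(\<Sum>j<n. \<xi> i (z j)) / n - m i = 0" if "i \<in> I" for i
        using that by (simp add: m0)
      then show ?case unfolding dev_def m_def[symmetric] by (simp add: L2_set_def)
    qed
    moreover have "0 \<le> a * T" using R \<sigma> a L unfolding T_def by simp
    ultimately have "AE z in ?P. z \<in> A \<longrightarrow> z \<in> {}"
      unfolding A_def by (auto elim!: eventually_mono)
    from P.finite_measure_mono_AE[OF this] have "measure ?P A \<le> 0" by simp
    moreover have "0 \<le> 2 * exp (1 - 2 * a * L)" "0 \<le> 1 / (2 * a * L)\<^sup>2" by auto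
    ultimately show ?thesis by linarith
  next
    case False
    define c where "c = 2 * R + \<sigma> * sqrt n"
    have c: "c > 0" using False R \<sigma> unfolding c_def by (metis add_nonneg_nonneg mult_nonneg_nonneg
          order_less_le real_sqrt_ge_zero of_nat_0_le_iff zero_le_numeral)
    define \<eta> where "\<eta> i z = (1 / c) * (\<xi> i z - m i)" for i z
    have [measurable]: "\<eta> i \<in> borel_measurable M" for i unfolding \<eta>_def by measurable
    have L2\<eta>: "L2_set (\<lambda>i. \<eta> i z) I = (1 / c) * L2_set (\<lambda>i. \<xi> i z - m i) I" for z
      unfolding \<eta>_def using c by (intro L2_set_right_distrib[symmetric]) simp
    have 1: "AE z in M. L2_set (\<lambda>i. \<eta> i z) I \<le> 1"
      using bounded
    proof eventually_elim
      case (elim z)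
      have "L2_set (\<lambda>i. \<xi> i z - m i) I \<le> c"
        using centred_le[OF elim] \<sigma> by (simp add: c_def add_increasing2)
      then show ?case unfolding L2\<eta> using c by simp
    qed
    have 2: "(\<integral>z. \<eta> i z \<partial>M) = 0" if "i \<in> I" for i
      unfolding \<eta>_def using int[OF that] by (simp add: m_def prob_space)
    have 3: "(\<integral>z. (L2_set (\<lambda>i. \<eta> i z) I)\<^sup>2 \<partial>M) \<le> (\<sigma> / c)\<^sup>2"
      unfolding L2\<eta> using var by (simp add: power_mult_distrib power_divide divide_right_mono)
    have 4: "real n * (\<sigma> / c)\<^sup>2 \<le> 1"
    proof -
      have "(\<sigma> * sqrt n)\<^sup>2 \<le> c\<^sup>2"
        using R \<sigma> unfolding c_def by (intro power_mono) auto
      then show ?thesis using c by (simp add: power_mult_distrib power_divide field_simps)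
    qed
    have eq: "L2_set (\<lambda>i. \<Sum>j<n. \<eta> i (z j)) I = (n / c) * dev z" for z
    proof -
      have "(\<Sum>j<n. \<eta> i (z j)) = (n / c) * ((\<Sum>j<n. \<xi> i (z j)) / n - m i)" for i
      proof -
        have "(\<Sum>j<n. \<eta> i (z j)) = (1 / c) * ((\<Sum>j<n. \<xi> i (z j)) - n * m i)"
          unfolding \<eta>_def sum_distrib_left[symmetric] by (simp add: sum_subtractf)
        also have "\<dots> = (n / c) * ((\<Sum>j<n. \<xi> i (z j)) / n - m i)"
          using n c by (simp add: field_simps)
        finally show ?thesis .
      qed
      then have "L2_set (\<lambda>i. \<Sum>j<n. \<eta> i (z j)) I
          = L2_set (\<lambda>i. (n / c) * ((\<Sum>j<n. \<xi> i (z j)) / n - m i)) I" by presburger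
      also have "\<dots> = (n / c) * dev z"
        unfolding dev_def m_def using c by (intro L2_set_right_distrib[symmetric]) simp
      finally show ?thesis .
    qed
    have nn: "sqrt n * sqrt n = real n" by simp
    have "T = 2 * L * (c / n)"
      unfolding T_def c_def using n nn by (simp add: field_simps)
    then have aT: "(n / c) * (a * T) = 2 * a * L" using c n by (simp add: field_simps)
    have "0 < n / c" using c n by simp
    then have T: "a * T < x \<longleftrightarrow> 2 * a * L < (n / c) * x" for x
      unfolding aT[symmetric] by (rule mult_less_cancel_left_pos[symmetric])
    have A: "A = {z \<in> space ?P. 2 * a * L < L2_set (\<lambda>i. \<Sum>j<n. \<eta> i (z j)) I}"
      unfolding A_def eq T ..
    show ?thesis
      unfolding A using centred_sum_tail(2,3)[OF I _ 1 2 3 4, of "2 * a * L"] a L by simp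
  qed
  then show "measure ?P A \<le> 2 * exp (1 - 2 * a * L)" "measure ?P A \<le> 1 / (2 * a * L)\<^sup>2" by auto
qed

text \<open>An enumeration exhausts \<open>I\<close> by finite sets \<open>J m\<close>. The
  exceptional sets increase with m, so continuity from below bounds their union by the same
  \<epsilon>, with no union bound over m; every finite subset of \<open>I\<close> lies in some
  \<open>J m\<close>.\<close>

lemma exhausting_event:
  fixes D :: "'i set \<Rightarrow> 'a \<Rightarrow> real"
  assumes I: "countable I"
    and sets: "\<And>J. finite J \<Longrightarrow> J \<subseteq> I \<Longrightarrow> {z \<in> space M. T < D J z} \<in> sets M"
    and bound: "\<And>J. finite J \<Longrightarrow> J \<subseteq> I \<Longrightarrow> measure M {z \<in> space M. T < D J z} \<le> \<epsilon>"
    and mono: "\<And>J J' z. finite J' \<Longrightarrow> J \<subseteq> J' \<Longrightarrow> J' \<subseteq> I \<Longrightarrow> D J z \<le> D J' z"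
  shows "\<exists>\<Omega>\<in>sets M. 1 - \<epsilon> \<le> measure M \<Omega> \<and> (\<forall>z\<in>\<Omega>. \<forall>J. finite J \<and> J \<subseteq> I \<longrightarrow> D J z \<le> T)"
proof -
  define J where "J m = {i \<in> I. to_nat_on I i < m}" for m
  have finJ: "finite (J m)" for m
  proof (rule inj_on_finite)
    show "inj_on (to_nat_on I) (J m)"
      using inj_on_to_nat_on[OF I] by (rule inj_on_subset) (auto simp: J_def)
    show "to_nat_on I ` J m \<subseteq> {..<m}" by (auto simp: J_def)
  qed simp
  have JI: "J m \<subseteq> I" for m by (auto simp: J_def)
  let ?A = "\<lambda>m. {z \<in> space M. T < D (J m) z}"
  have inc: "incseq ?A"
  proof (rule incseq_SucI, clarify)
    fix m z assume "T < D (J m) z"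
    also have "D (J m) z \<le> D (J (Suc m)) z"
      by (rule mono[OF finJ _ JI]) (auto simp: J_def)
    finally show "T < D (J (Suc m)) z" .
  qed
  have "(\<lambda>m. measure M (?A m)) \<longlonglongrightarrow> measure M (\<Union>m. ?A m)"
    using sets[OF finJ JI] inc by (intro finite_Lim_measure_incseq) auto
  then have "measure M (\<Union>m. ?A m) \<le> \<epsilon>"
    by (rule LIMSEQ_le_const2) (use bound[OF finJ JI] in auto)
  moreover have U: "(\<Union>m. ?A m) \<in> sets M" using sets[OF finJ JI] by auto
  ultimately have "1 - \<epsilon> \<le> measure M (space M - (\<Union>m. ?A m))" by (simp add: prob_compl)
  moreover have "D K z \<le> T" if z: "z \<in> space M - (\<Union>m. ?A m)" and K: "finite K" "K \<subseteq> I" for z K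
  proof -
    obtain m where m: "\<forall>i\<in>to_nat_on I ` K. i < m"
      using K(1) finite_nat_set_iff_bounded[of "to_nat_on I ` K"] by auto
    then have "K \<subseteq> J m" using K(2) by (auto simp: J_def)
    then have "D K z \<le> D (J m) z" by (rule mono[OF finJ _ JI])
    also have "\<dots> \<le> T" using z by (auto simp: not_less)
    finally show ?thesis .
  qed
  ultimately show ?thesis using U by (intro bexI[of _ "space M - (\<Union>m. ?A m)"]) auto
qed

end

section \<open>The deterministic error bound\<close>

text \<open>Passes from bounds on finite rectangles to complete rows; this is how events stated in
  finitely many coordinates become bounds on norms.\<close>

lemma sum_double_bounded:
  fixes w :: "'i \<Rightarrow> 'j \<Rightarrow> real"
  assumes G: "finite G" and rows: "\<And>i. i \<in> G \<Longrightarrow> (w i has_sum r i) J"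
    and le: "\<And>H. finite H \<Longrightarrow> H \<subseteq> J \<Longrightarrow> (\<Sum>(i, j)\<in>G \<times> H. w i j) \<le> S"
  shows "(\<Sum>i\<in>G. r i) \<le> S"
proof (rule has_sum_le_finite_sums)
  show "((\<lambda>j. \<Sum>i\<in>G. w i j) has_sum (\<Sum>i\<in>G. r i)) J"
    using G rows by (induction G rule: finite_induct) (auto intro: has_sum_add)
  fix H assume H: "finite H" "H \<subseteq> J"
  show "(\<Sum>j\<in>H. \<Sum>i\<in>G. w i j) \<le> S"
    using le[OF H] by (subst sum.swap) (simp add: sum.cartesian_product)
qed

lemma op_fun_index_bound:
  assumes "positive_trace_class C K" "index_function \<psi>" "e \<in> eigenbasis C"
  shows "\<bar>\<psi> (positive_trace_class.ev C e)\<bar> \<le> \<psi> K"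
proof -
  interpret positive_trace_class C K by (rule assms(1))
  show ?thesis using index_function_mono[OF assms(2) ev_nonneg ev_le[OF assms(3)]] by simp
qed

text \<open>The adjoint of the product is the adjoint of \<open>T\<close> followed by
  \<open>op_fun \<psi> C\<close>, which is bounded because \<psi> is at most \<psi> K on the
  eigenvalues.\<close>

lemma hilbert_schmidt_compose_op_fun:
  fixes C :: "'h::{real_inner, banach} \<Rightarrow>\<^sub>L 'h" and T :: "'h \<Rightarrow>\<^sub>L 'y::{real_inner, banach}"
  assumes C: "positive_trace_class C K" and \<psi>: "index_function \<psi>" and hs: "hilbert_schmidt T"
  shows "hilbert_schmidt (T o\<^sub>L op_fun \<psi> C)"
proof -
  interpret C: positive_trace_class C K by (rule C)
  obtain t where t: "\<And>v y. T v \<bullet> y = v \<bullet> t y" using ex_adjoint by blast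
  let ?P = "op_fun \<psi> C"
  have adj: "(T o\<^sub>L ?P) v \<bullet> y = v \<bullet> ?P (t y)" for v y
  proof -
    have "?P u \<bullet> v = u \<bullet> ?P v" for u v
      unfolding C.op_fun_eq by (rule diag_op_self_adjoint[OF C.onb op_fun_index_bound[OF C \<psi>]])
    then show ?thesis by (simp add: t)
  qed
  have "norm (?P v) \<le> \<bar>\<psi> K\<bar> * norm v" for v
    unfolding C.op_fun_eq by (rule norm_diag_op_le[OF C.onb op_fun_index_bound[OF C \<psi>]])
  then have le: "(norm (?P v))\<^sup>2 \<le> \<bar>\<psi> K\<bar>\<^sup>2 * (norm v)\<^sup>2" for v
    by (metis norm_ge_zero power_mono power_mult_distrib)
  have "(\<lambda>y. (norm (t y))\<^sup>2) summable_on some_onb"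
    using hs_norm_adjoint(1)[OF some_onb t] hs by blast
  then have sum: "(\<lambda>y. \<bar>\<psi> K\<bar>\<^sup>2 * (norm (t y))\<^sup>2) summable_on some_onb"
    by (rule summable_on_cmult_right)
  have "(\<lambda>y. (norm (?P (t y)))\<^sup>2) summable_on some_onb"
  proof (rule has_sum_ubound(1))
    fix Y :: "'y set" assume Y: "finite Y" "Y \<subseteq> some_onb"
    have "(\<Sum>y\<in>Y. (norm (?P (t y)))\<^sup>2) \<le> (\<Sum>y\<in>Y. \<bar>\<psi> K\<bar>\<^sup>2 * (norm (t y))\<^sup>2)"
      by (intro sum_mono le)
    also have "\<dots> \<le> (\<Sum>\<^sub>\<infinity>y\<in>some_onb. \<bar>\<psi> K\<bar>\<^sup>2 * (norm (t y))\<^sup>2)"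
      by (rule finite_sum_le_infsum[OF sum Y]) simp
    finally show "(\<Sum>y\<in>Y. (norm (?P (t y)))\<^sup>2) \<le> (\<Sum>\<^sub>\<infinity>y\<in>some_onb. \<bar>\<psi> K\<bar>\<^sup>2 * (norm (t y))\<^sup>2)" .
  qed simp
  then show ?thesis using hs_norm_adjoint(1)[OF some_onb adj] by blast
qed

context
  fixes k :: "'x \<Rightarrow> 'x \<Rightarrow> real"
    and repH :: "'h::{real_inner, banach} \<Rightarrow> 'x \<Rightarrow> real"
    and repG :: "'g::{real_inner, banach} \<Rightarrow> 'x \<Rightarrow> 'y::{real_inner, banach}"
    and \<phi> :: "'x \<Rightarrow> 'h" and \<beta> :: "'x \<Rightarrow> real" and z :: "nat \<Rightarrow> 'x \<times> 'y"
    and C :: "'h \<Rightarrow>\<^sub>L 'h" and C\<^sub>o Cstar :: "'h \<Rightarrow>\<^sub>L 'y"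
    and g :: "real \<Rightarrow> real \<Rightarrow> real" and \<psi> :: "real \<Rightarrow> real" and n :: nat
    and s b \<kappa> B D \<gamma> \<nu> \<gamma>\<^sub>\<nu> c lam KC T\<^sub>1 T\<^sub>2 :: real
  assumes H: "is_rkhs (kernel_Id k) repH" and G: "is_rkhs (kernel_Id k) repG"
    and \<phi>: "\<phi> = feature k repH"
    and C: "positive_trace_class C KC" "KC \<le> s"
    and \<beta>: "\<And>x. 0 \<le> \<beta> x" "\<And>x. \<beta> x \<le> b" and \<phi>\<kappa>: "\<And>x. (norm (\<phi> x))\<^sup>2 \<le> \<kappa>\<^sup>2"
    and n: "1 \<le> n" and bs: "b * \<kappa>\<^sup>2 \<le> s"
    and reg: "regularization_family s g B D \<gamma>" and q: "qualification_bound s g \<nu> \<gamma>\<^sub>\<nu>" and \<nu>: "0 < \<nu>"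
    and lam: "0 < lam" "lam \<le> s"
    and T1: "0 \<le> T\<^sub>1" "T\<^sub>1 \<le> sqrt lam / 2" and T2: "0 \<le> T\<^sub>2"
    and \<psi>: "index_function \<psi>" and cov: "covers s \<nu> \<psi> c"
    and hs: "hilbert_schmidt C\<^sub>o" and Cstar: "Cstar = C\<^sub>o o\<^sub>L op_fun \<psi> C"
begin

private abbreviation "E \<equiv> eigenbasis C"
private abbreviation "Ch \<equiv> emp_cov_X n \<beta> \<phi> z"

interpretation C: positive_trace_class C KC by (rule C(1))
interpretation Ch: positive_trace_class Ch "b * \<kappa>\<^sup>2"
  by (rule emp_cov_X_positive_trace_class[OF \<beta> \<phi>\<kappa> n])

private lemma C_ev: "e \<in> E \<Longrightarrow> C.ev e \<le> s" and Ch_ev: "f \<in> eigenbasis Ch \<Longrightarrow> Ch.ev f \<le> s"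
  using C.ev_le C(2) Ch.ev_le bs by (auto intro: order_trans)

private lemma \<psi>_bound: "e \<in> E \<Longrightarrow> \<bar>\<psi> (C.ev e)\<bar> \<le> \<psi> KC"
  by (rule op_fun_index_bound[OF C(1) \<psi>])

text \<open>The approximation, resolvent and noise contributions to \<open>norm (t y)\<close> are
  each square summable over y; Minkowski's inequality adds their Hilbert-Schmidt norms. The event
  \<open>ev1\<close> supplies the locale \<open>perturbed_operator\<close>, \<open>ev2\<close> the
  bound on the noise.\<close>

lemma estimator_error_bound:
  assumes ev1: "\<And>J. finite J \<Longrightarrow> J \<subseteq> E \<times> E \<Longrightarrow>
      (\<Sum>(e', e)\<in>J. ((Ch e - C e) \<bullet> e')\<^sup>2 / (C e \<bullet> e + lam)) \<le> T\<^sub>1\<^sup>2"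
    and ev2: "\<And>J. finite J \<Longrightarrow> J \<subseteq> some_onb \<times> E \<Longrightarrow>
      (\<Sum>(y, e)\<in>J. ((1 / real n) * (\<Sum>i<n. \<beta> (fst (z i)) * ((Cstar (\<phi> (fst (z i))) - snd (z i)) \<bullet> y) * (\<phi> (fst (z i)) \<bullet> e)))\<^sup>2
          / (C e \<bullet> e + lam)) \<le> T\<^sub>2\<^sup>2"
  shows "(\<lambda>x. Cstar (\<phi> x) - estimator g lam n \<beta> \<phi> z x) \<in> range repG \<and>
    rkhs_norm repG (\<lambda>x. Cstar (\<phi> x) - estimator g lam n \<beta> \<phi> z x)
      \<le> 2 powr \<nu> * (\<gamma>\<^sub>\<nu> + \<gamma>) * (2 powr (\<nu> - of_int \<lfloor>\<nu>\<rfloor>) * (max 1 (1 / c) * \<psi> lam * hs_norm C\<^sub>o)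
          + of_int \<lfloor>\<nu>\<rfloor> * (T\<^sub>1 / sqrt lam) * hs_norm Cstar)
        + (B + D) / lam * sqrt (2 * lam) * T\<^sub>2"
proof -
  let ?F = "eigenbasis Ch"
  let ?Gop = "op_fun (g lam) Ch"
  let ?x = "\<lambda>i. fst (z i)"
  let ?Y = "some_onb :: 'y set"
  interpret P: perturbed_operator C Ch E ?F C.ev Ch.ev lam T\<^sub>1
  proof
    show "is_onb E" "is_onb ?F" by (rule C.onb Ch.onb)+
    fix S assume S: "finite S" "S \<subseteq> E"
    show "(\<Sum>e\<in>S. (norm (Ch e - C e))\<^sup>2 / (C.ev e + lam)) \<le> T\<^sub>1\<^sup>2"
    proof (rule sum_double_bounded[OF S(1)])
      fix e
      have "((\<lambda>e'. ((Ch e - C e) \<bullet> e')\<^sup>2 * (1 / (C.ev e + lam))) has_sum ((norm (Ch e - C e))\<^sup>2 * (1 / (C.ev e + lam)))) E"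
        by (rule has_sum_cmult_left[OF parseval[OF C.onb]])
      then show "((\<lambda>e'. ((Ch e - C e) \<bullet> e')\<^sup>2 / (C.ev e + lam)) has_sum ((norm (Ch e - C e))\<^sup>2 / (C.ev e + lam))) E"
        by simp
      fix S' assume "finite S'" "S' \<subseteq> E"
      then have "(\<Sum>(e', e)\<in>S' \<times> S. ((Ch e - C e) \<bullet> e')\<^sup>2 / (C e \<bullet> e + lam)) \<le> T\<^sub>1\<^sup>2"
        using S by (intro ev1) auto
      then show "(\<Sum>(e, e')\<in>S \<times> S'. ((Ch e - C e) \<bullet> e')\<^sup>2 / (C.ev e + lam)) \<le> T\<^sub>1\<^sup>2"
        unfolding sum.cartesian_product[symmetric] C.ev_def by (subst sum.swap)
    qed
  qed (use T1 lam C.ev_nonneg Ch.ev_nonneg C.ev_eigen Ch.ev_eigen Ch.sa in auto)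
  obtain a where a: "\<And>v y. C\<^sub>o v \<bullet> y = v \<bullet> a y" using ex_adjoint by blast
  define h where "h y = op_fun \<psi> C (a y)" for y
  have h: "Cstar v \<bullet> y = v \<bullet> h y" for v y
    unfolding Cstar h_def blinfun_apply_blinfun_compose a C.op_fun_eq
    by (rule diag_op_self_adjoint[OF C.onb \<psi>_bound])
  \<comment> \<open>Adjoint of the empirical mean of \<beta> (Cstar \<phi> - y) tensor \<phi>; with
    this sign the adjoint of the empirical cross covariance is Ch (h y) - m y.\<close>
  define m where "m y = (1 / real n) *\<^sub>R (\<Sum>i<n. (\<beta> (?x i) * ((Cstar (\<phi> (?x i)) - snd (z i)) \<bullet> y)) *\<^sub>R \<phi> (?x i))" for y
  define r where "r f = 1 - Ch.ev f * g lam (Ch.ev f)" for f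
  define t where "t y = diag_op ?F r (h y) + ?Gop (m y)" for y
  define Kr where "Kr = 2 powr \<nu> * (\<gamma>\<^sub>\<nu> + \<gamma>)"
  have \<gamma>1: "1 \<le> \<gamma>" by (rule regularization_gamma_ge_1[OF reg lam])
  have \<gamma>\<nu>: "0 \<le> \<gamma>\<^sub>\<nu>" by (rule qualification_constant_nonneg[OF q lam])
  have BD: "0 < B" "0 < D" using reg by (auto simp: regularization_family_def)
  have Kr: "0 \<le> Kr" using \<gamma>1 \<gamma>\<nu> by (simp add: Kr_def)
  have r: "\<bar>r f\<bar> \<le> Kr * P.b f powr \<nu>" if "f \<in> ?F" for f
    unfolding r_def Kr_def P.b_def
    by (rule residual_function_le[OF reg q lam \<nu> Ch.ev_nonneg Ch_ev[OF that]])
  have rK: "\<bar>r f\<bar> \<le> Kr" if "f \<in> ?F" for f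
  proof -
    have "Kr * P.b f powr \<nu> \<le> Kr * 1"
      using P.b[OF that] \<nu> Kr by (intro mult_left_mono powr_le1) auto
    with r[OF that] show ?thesis by simp
  qed
  \<comment> \<open>0 may be an eigenvalue, and \<open>g lam 0\<close> is unconstrained. The maximum
    only makes the multiplier bounded; it does not enter the final estimate.\<close>
  define Kg where "Kg = max \<bar>g lam 0\<bar> (B / lam)"
  have gK: "\<bar>g lam (Ch.ev f)\<bar> \<le> Kg" if "f \<in> ?F" for f
  proof (cases "Ch.ev f = 0")
    case False
    then have "Ch.ev f \<in> {0<..s}" using Ch.ev_nonneg[of f] Ch_ev[OF that] by auto
    then have "\<bar>g lam (Ch.ev f)\<bar> \<le> B / lam" using reg lam by (auto simp: regularization_family_def)
    then show ?thesis by (simp add: Kg_def)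
  qed (simp add: Kg_def)
  have Gop: "?Gop v \<bullet> f = g lam (Ch.ev f) * (v \<bullet> f)" if "f \<in> ?F" for f v
    unfolding Ch.op_fun_eq by (rule diag_op_inner[OF Ch.onb gK that])
  have Gsa: "?Gop u \<bullet> v = u \<bullet> ?Gop v" for u v
    unfolding Ch.op_fun_eq by (rule diag_op_self_adjoint[OF Ch.onb gK])
  have Rop: "diag_op ?F r v \<bullet> f = r f * (v \<bullet> f)" if "f \<in> ?F" for f v
    by (rule diag_op_inner[OF Ch.onb rK that])
  define T where "T = Cstar - (emp_cov_YX n \<beta> \<phi> z o\<^sub>L ?Gop)"
  have T: "Cstar (\<phi> x) - estimator g lam n \<beta> \<phi> z x = T (\<phi> x)" for x
    by (simp add: T_def estimator_def blinfun.diff_left)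
  have YX: "emp_cov_YX n \<beta> \<phi> z v \<bullet> y = v \<bullet> (Ch (h y) - m y)" for v y
  proof -
    have 1: "v \<bullet> Ch (h y) = (1 / real n) * (\<Sum>i<n. \<beta> (?x i) * (v \<bullet> \<phi> (?x i)) * (Cstar (\<phi> (?x i)) \<bullet> y))"
      by (simp add: Ch.sa[symmetric] emp_cov_X_inner h inner_commute[of "h y"])
    have 2: "v \<bullet> m y = (1 / real n) * (\<Sum>i<n. \<beta> (?x i) * ((Cstar (\<phi> (?x i)) - snd (z i)) \<bullet> y) * (v \<bullet> \<phi> (?x i)))"
      by (simp add: m_def inner_sum_right)
    have 3: "emp_cov_YX n \<beta> \<phi> z v \<bullet> y = (1 / real n) * (\<Sum>i<n. \<beta> (?x i) * (v \<bullet> \<phi> (?x i)) * (snd (z i) \<bullet> y))"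
      by (simp add: emp_cov_YX_apply inner_sum_left)
    show ?thesis
      unfolding inner_diff_right 1 2 3 right_diff_distrib[symmetric] sum_subtractf[symmetric]
      by (intro arg_cong[where f = "\<lambda>x. (1 / real n) * x"] sum.cong refl)
        (simp add: inner_diff_left algebra_simps)
  qed
  have t: "T v \<bullet> y = v \<bullet> t y" for v y
  proof -
    have "h y - ?Gop (Ch (h y) - m y) = t y"
    proof (rule onb_eqI[OF Ch.onb])
      fix f assume f: "f \<in> ?F"
      show "(h y - ?Gop (Ch (h y) - m y)) \<bullet> f = t y \<bullet> f"
        unfolding t_def inner_diff_left inner_add_left Gop[OF f] Rop[OF f] Ch.ev_inner[OF f]
        by (simp add: r_def algebra_simps)
    qed
    then show ?thesis
      by (simp add: T_def blinfun.diff_left inner_diff_left h YX Gsa inner_diff_right[symmetric])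
  qed
  \<comment> \<open>Eigenvalue 0 means that a sum of nonnegative terms vanishes, so every sample of
    nonzero weight has its feature orthogonal to \<open>f\<close>, and \<open>m y\<close> is
    orthogonal to \<open>f\<close> too.\<close>
  have m_ker: "m y \<bullet> f = 0 \<or> \<bar>g lam (Ch.ev f)\<bar> \<le> (B + D) / lam * sqrt (P.b f)" if f: "f \<in> ?F" for y f
  proof (cases "Ch.ev f = 0")
    case True
    then have "(\<Sum>i<n. \<beta> (?x i) * (f \<bullet> \<phi> (?x i)) * (f \<bullet> \<phi> (?x i))) = 0"
      using n by (simp add: Ch.ev_def emp_cov_X_inner)
    moreover have "0 \<le> \<beta> (?x i) * (f \<bullet> \<phi> (?x i)) * (f \<bullet> \<phi> (?x i))" for i
      using \<beta>(1) by (simp add: mult.assoc)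
    ultimately have "\<forall>i<n. \<beta> (?x i) * (f \<bullet> \<phi> (?x i)) * (f \<bullet> \<phi> (?x i)) = 0"
      by (simp add: sum_nonneg_eq_0_iff)
    then have "\<beta> (?x i) = 0 \<or> \<phi> (?x i) \<bullet> f = 0" if "i < n" for i
      using that by (auto simp: inner_commute)
    then have "(\<Sum>i<n. \<beta> (?x i) * ((Cstar (\<phi> (?x i)) - snd (z i)) \<bullet> y) * (\<phi> (?x i) \<bullet> f)) = 0"
      by (intro sum.neutral) auto
    then show ?thesis by (simp add: m_def inner_sum_left)
  next
    case False
    then have "0 < Ch.ev f" using Ch.ev_nonneg[of f] by linarith
    then show ?thesis
      using regularization_function_le[OF reg lam _ Ch_ev[OF f]] by (simp add: P.b_def)
  qed
  \<comment> \<open>Squared norm of (C + lam)^(-1/2) m y, which the noise event controls after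
    summation over y.\<close>
  define S where "S y = (\<Sum>\<^sub>\<infinity>e\<in>E. (m y \<bullet> e)\<^sup>2 / (C.ev e + lam))" for y
  have pe: "0 < C.ev e + lam" for e using C.ev_nonneg[of e] lam by linarith
  have m_coord: "m y \<bullet> e = (1 / real n) * (\<Sum>i<n. \<beta> (?x i) * ((Cstar (\<phi> (?x i)) - snd (z i)) \<bullet> y) * (\<phi> (?x i) \<bullet> e))" for y e
    by (simp add: m_def inner_sum_left)
  have S: "((\<lambda>e. (m y \<bullet> e)\<^sup>2 / (C.ev e + lam)) has_sum S y) E" for y
  proof -
    have "(\<lambda>e. 1 / (C.ev e + lam) * (m y \<bullet> e)\<^sup>2) summable_on E"
    proof (rule has_sum_mult_bounded(1)[OF _ parseval[OF C.onb]])
      show "1 / (C.ev e + lam) \<le> 1 / lam" for e using C.ev_nonneg[of e] lam by (simp add: frac_le)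
    qed (use pe in \<open>auto simp: less_imp_le\<close>)
    then show ?thesis by (simp add: S_def)
  qed
  have S0: "0 \<le> S y" for y by (rule has_sum_nonneg[OF S]) (use pe in \<open>simp add: less_imp_le\<close>)
  have S_sum: "(\<Sum>y\<in>Y. S y) \<le> T\<^sub>2\<^sup>2" if Y: "finite Y" "Y \<subseteq> ?Y" for Y
  proof (rule sum_double_bounded[OF Y(1) S])
    fix S' assume "finite S'" "S' \<subseteq> E"
    then show "(\<Sum>(y, e)\<in>Y \<times> S'. (m y \<bullet> e)\<^sup>2 / (C.ev e + lam)) \<le> T\<^sub>2\<^sup>2"
      using Y ev2[of "Y \<times> S'"] unfolding m_coord C.ev_def by blast
  qed
  let ?\<theta> = "\<nu> - of_int \<lfloor>\<nu>\<rfloor>"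
  let ?c1 = "Kr * 2 powr ?\<theta> * (max 1 (1 / c) * \<psi> lam)"
  let ?c2 = "Kr * (of_int \<lfloor>\<nu>\<rfloor> * P.\<Delta>)"
  let ?c3 = "(B + D) / lam * sqrt (2 * lam)"
  have \<psi>lam: "0 < \<psi> lam" by (rule index_function_pos[OF \<psi> lam(1)])
  have fl: "0 \<le> real_of_int \<lfloor>\<nu>\<rfloor>" using \<nu> by simp
  have c_nonneg: "0 \<le> ?c1" "0 \<le> ?c2" "0 \<le> ?c3"
    using Kr \<psi>lam fl P.\<Delta>(1) BD lam by auto
  \<comment> \<open>\<open>h y\<close> carries the factor \<psi>(C), which commutes with the
    resolvent power, so the covering bound applies eigenvalue by eigenvalue.\<close>
  have approx: "norm (diag_op E (\<lambda>e. P.a e powr \<nu>) (h y)) \<le> max 1 (1 / c) * \<psi> lam * norm (a y)" for y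
  proof -
    have av: "\<bar>P.a e powr \<nu>\<bar> \<le> 1" if "e \<in> E" for e using P.a_powr[OF _ that] \<nu> by simp
    have w: "\<bar>P.a e powr \<nu> * \<psi> (C.ev e)\<bar> \<le> max 1 (1 / c) * \<psi> lam" if "e \<in> E" for e
      using covered_index_function_le[OF \<psi> cov lam \<nu> C.ev_nonneg C_ev[OF that]]
        index_function_mono(2)[OF \<psi> C.ev_nonneg[of e] order_refl]
      by (simp add: P.a_def abs_mult)
    have "diag_op E (\<lambda>e. P.a e powr \<nu>) (h y) = diag_op E (\<lambda>e. P.a e powr \<nu> * \<psi> (C.ev e)) (a y)"
      unfolding h_def C.op_fun_eq by (rule diag_op_compose[OF C.onb av \<psi>_bound]) simp_all
    also have "norm \<dots> \<le> \<bar>max 1 (1 / c) * \<psi> lam\<bar> * norm (a y)"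
      by (rule norm_diag_op_le[OF C.onb w])
    finally show ?thesis using \<psi>lam by simp
  qed
  have t_le: "norm (t y) \<le> ?c1 * norm (a y) + (?c2 * norm (h y) + ?c3 * sqrt (S y))" for y
  proof -
    have "norm (diag_op ?F r (h y)) \<le> Kr * (2 powr ?\<theta> * norm (diag_op E (\<lambda>e. P.a e powr \<nu>) (h y)) + of_int \<lfloor>\<nu>\<rfloor> * P.\<Delta> * norm (h y))"
      by (rule P.residual_le[OF _ Kr r]) (use \<nu> in auto)
    also have "\<dots> \<le> Kr * (2 powr ?\<theta> * (max 1 (1 / c) * \<psi> lam * norm (a y)) + of_int \<lfloor>\<nu>\<rfloor> * P.\<Delta> * norm (h y))"
      using Kr approx by (intro mult_left_mono add_right_mono) auto
    finally have 1: "norm (diag_op ?F r (h y)) \<le> ?c1 * norm (a y) + ?c2 * norm (h y)"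
      by (simp add: algebra_simps)
    have "norm (?Gop (m y)) \<le> (B + D) / lam * sqrt (2 * lam * S y)"
      unfolding Ch.op_fun_eq
    proof (rule P.noise_le[OF _ gK m_ker])
      show "0 \<le> (B + D) / lam" using BD lam by simp
      fix S' assume "finite S'" "S' \<subseteq> E"
      then show "(\<Sum>e\<in>S'. (m y \<bullet> e)\<^sup>2 / (C.ev e + lam)) \<le> S y"
        by (rule finite_sum_le_has_sum[OF S]) (use pe in \<open>simp add: less_imp_le\<close>)
    qed
    also have "\<dots> = ?c3 * sqrt (S y)" by (simp add: real_sqrt_mult)
    finally have 2: "norm (?Gop (m y)) \<le> ?c3 * sqrt (S y)" .
    have "norm (t y) \<le> norm (diag_op ?F r (h y)) + norm (?Gop (m y))"
      unfolding t_def by (rule norm_triangle_ineq)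
    with 1 2 show ?thesis by linarith
  qed
  have hs_le: "L2_set (\<lambda>y. norm (u y)) Y \<le> hs_norm U"
    if U: "hilbert_schmidt U" "\<And>v y. blinfun_apply U v \<bullet> y = v \<bullet> u y" and Y: "finite Y" "Y \<subseteq> ?Y"
    for U :: "'h \<Rightarrow>\<^sub>L 'y" and u Y
    unfolding L2_set_def hs_norm_adjoint(2)[OF some_onb U(2)]
    using hs_norm_adjoint(1)[OF some_onb U(2)] U(1) Y
    by (intro real_sqrt_le_mono finite_sum_le_infsum) auto
  let ?K = "?c1 * hs_norm C\<^sub>o + (?c2 * hs_norm Cstar + ?c3 * T\<^sub>2)"
  have hs0: "0 \<le> hs_norm U" for U :: "'h \<Rightarrow>\<^sub>L 'y"
    unfolding hs_norm_def by (intro real_sqrt_ge_zero infsum_nonneg) simp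
  have "(\<lambda>x. T (\<phi> x)) \<in> range repG \<and> rkhs_norm repG (\<lambda>x. T (\<phi> x)) \<le> ?K"
  proof (rule rkhs_norm_le[OF H G \<phi> some_onb t])
    show "0 \<le> ?K"
      by (intro add_nonneg_nonneg mult_nonneg_nonneg[OF c_nonneg(1) hs0]
          mult_nonneg_nonneg[OF c_nonneg(2) hs0] mult_nonneg_nonneg[OF c_nonneg(3) T2])
    fix Y assume Y: "finite Y" "Y \<subseteq> ?Y"
    have "L2_set (\<lambda>y. norm (t y)) Y \<le> L2_set (\<lambda>y. ?c1 * norm (a y) + (?c2 * norm (h y) + ?c3 * sqrt (S y))) Y"
      by (rule L2_set_mono[OF t_le]) simp
    also have "\<dots> \<le> L2_set (\<lambda>y. ?c1 * norm (a y)) Y + L2_set (\<lambda>y. ?c2 * norm (h y) + ?c3 * sqrt (S y)) Y"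
      by (rule L2_set_triangle_ineq)
    also have "\<dots> \<le> L2_set (\<lambda>y. ?c1 * norm (a y)) Y
        + (L2_set (\<lambda>y. ?c2 * norm (h y)) Y + L2_set (\<lambda>y. ?c3 * sqrt (S y)) Y)"
      by (intro add_left_mono L2_set_triangle_ineq)
    also have "\<dots> = ?c1 * L2_set (\<lambda>y. norm (a y)) Y
        + (?c2 * L2_set (\<lambda>y. norm (h y)) Y + ?c3 * L2_set (\<lambda>y. sqrt (S y)) Y)"
      unfolding L2_set_right_distrib[OF c_nonneg(1)] L2_set_right_distrib[OF c_nonneg(2)] L2_set_right_distrib[OF c_nonneg(3)] ..
    also have "\<dots> \<le> ?K"
    proof (intro add_mono mult_left_mono c_nonneg)
      show "L2_set (\<lambda>y. norm (a y)) Y \<le> hs_norm C\<^sub>o" by (rule hs_le[OF hs a Y])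
      show "L2_set (\<lambda>y. norm (h y)) Y \<le> hs_norm Cstar" by (rule hs_le[OF hilbert_schmidt_compose_op_fun[OF C(1) \<psi> hs, folded Cstar] h Y])
      show "L2_set (\<lambda>y. sqrt (S y)) Y \<le> T\<^sub>2"
        unfolding L2_set_def using S0 S_sum[OF Y] T2 by (intro real_le_lsqrt) (auto intro: sum_nonneg)
    qed
    finally have "(L2_set (\<lambda>y. norm (t y)) Y)\<^sup>2 \<le> ?K\<^sup>2" by (rule power_mono) (rule L2_set_nonneg)
    then show "(\<Sum>y\<in>Y. (norm (t y))\<^sup>2) \<le> ?K\<^sup>2" by (simp add: L2_set_def sum_nonneg)
  qed
  moreover have "?K = 2 powr \<nu> * (\<gamma>\<^sub>\<nu> + \<gamma>) * (2 powr ?\<theta> * (max 1 (1 / c) * \<psi> lam * hs_norm C\<^sub>o)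
      + of_int \<lfloor>\<nu>\<rfloor> * (T\<^sub>1 / sqrt lam) * hs_norm Cstar) + (B + D) / lam * sqrt (2 * lam) * T\<^sub>2"
    unfolding Kr_def P.\<Delta>_def by (simp add: algebra_simps)
  ultimately show ?thesis unfolding T by simp
qed

end

section \<open>The random events\<close>

text \<open>Cauchy-Schwarz on each coordinate T v . y = v . t y, summed by Parseval's identity. It
  bounds Cstar \<phi> uniformly, which is the second summand of \<open>M\<close>.\<close>

lemma hs_norm_bound:
  fixes T :: "'a::{real_inner, banach} \<Rightarrow>\<^sub>L 'b::{real_inner, banach}"
  assumes "hilbert_schmidt T"
  shows "norm (T v) \<le> hs_norm T * norm v"
proof -
  obtain t where t: "\<And>v y. T v \<bullet> y = v \<bullet> t y" using ex_adjoint by blast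
  have sum: "(\<lambda>y. (norm (t y))\<^sup>2) summable_on some_onb"
    using hs_norm_adjoint(1)[OF some_onb t] assms by blast
  have hs: "hs_norm T = sqrt (\<Sum>\<^sub>\<infinity>y\<in>some_onb. (norm (t y))\<^sup>2)"
    by (rule hs_norm_adjoint(2)[OF some_onb t])
  have "(norm (T v))\<^sup>2 \<le> (norm v)\<^sup>2 * (\<Sum>\<^sub>\<infinity>y\<in>some_onb. (norm (t y))\<^sup>2)"
  proof (rule has_sum_mono[OF parseval[OF some_onb] has_sum_cmult_right[OF has_sum_infsum[OF sum]]])
    fix y
    have "\<bar>v \<bullet> t y\<bar>\<^sup>2 \<le> (norm v * norm (t y))\<^sup>2" by (rule power_mono[OF Cauchy_Schwarz_ineq2]) simp
    then show "(T v \<bullet> y)\<^sup>2 \<le> (norm v)\<^sup>2 * (norm (t y))\<^sup>2" by (simp add: t power_mult_distrib)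
  qed
  also have "\<dots> = (hs_norm T * norm v)\<^sup>2"
    unfolding hs by (simp add: power_mult_distrib infsum_nonneg mult.commute)
  finally show ?thesis
    by (rule power2_le_imp_le) (simp add: hs infsum_nonneg)
qed

lemma hs_norm_nonneg: "0 \<le> hs_norm T"
  unfolding hs_norm_def by (intro real_sqrt_ge_zero infsum_nonneg) simp

text \<open>The random operators \<open>\<beta>(x) u(z) \<otimes> (C + lam)\<^bsup>-1/2\<^esup> \<phi>(x)\<close>, written in coordinates with
  respect to an eigenbasis \<open>E\<close> of \<open>C\<close> and an orthonormal system \<open>W\<close>: the covariance
  operators are the case \<open>u(z) = \<phi>(x)\<close>, the noise is the case \<open>u(z) = C\<^sub>* \<phi>(x) - y\<close>.\<close>

lemma (in prob_space) weighted_tensor_deviation: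
  fixes \<beta> :: "'a \<Rightarrow> real" and u :: "'a \<Rightarrow> 'w::real_inner" and \<phi> :: "'a \<Rightarrow> 'h::real_inner"
    and W :: "'w set" and E :: "'h set" and \<mu> :: "'h \<Rightarrow> real" and n :: nat
  defines "\<zeta> \<equiv> \<lambda>(w, e) z. \<beta> z * (u z \<bullet> w) * (\<phi> z \<bullet> e)"
  assumes \<beta>[measurable]: "\<beta> \<in> borel_measurable M"
    and u[measurable]: "\<And>w. (\<lambda>z. u z \<bullet> w) \<in> borel_measurable M"
    and \<phi>[measurable]: "\<And>e. (\<lambda>z. \<phi> z \<bullet> e) \<in> borel_measurable M"
    and \<beta>b: "\<And>z. 0 \<le> \<beta> z" "\<And>z. \<beta> z \<le> b" and um: "AE z in M. norm (u z) \<le> m" and \<phi>\<kappa>: "\<And>z. norm (\<phi> z) \<le> \<kappa>"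
    and m: "0 \<le> m"
    and W: "countable W" "orthonormal W" and E: "countable E" "orthonormal E"
    and \<mu>: "\<And>e. e \<in> E \<Longrightarrow> 0 \<le> \<mu> e" "\<And>e. e \<in> E \<Longrightarrow> (\<integral>z. \<beta> z * (\<phi> z \<bullet> e)\<^sup>2 \<partial>M) = \<mu> e"
    and N: "\<And>G. finite G \<Longrightarrow> G \<subseteq> E \<Longrightarrow> (\<Sum>e\<in>G. \<mu> e / (\<mu> e + lam)) \<le> N"
    and lam: "0 < lam" and n: "1 \<le> n" and L: "0 < L" and a: "0 < a"
    and \<epsilon>: "2 * exp (1 - 2 * a * L) \<le> \<epsilon> \<or> 1 / (2 * a * L)\<^sup>2 \<le> \<epsilon>"
  defines "T \<equiv> 2 * (2 * (b * m * \<kappa> / sqrt lam) / n + sqrt (b * m\<^sup>2 * N) / sqrt n) * L"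
  shows "\<exists>\<Omega>\<in>sets (Pi\<^sub>M {..<n} (\<lambda>_. M)). 1 - \<epsilon> \<le> measure (Pi\<^sub>M {..<n} (\<lambda>_. M)) \<Omega> \<and>
    (\<forall>z\<in>\<Omega>. \<forall>J. finite J \<and> J \<subseteq> W \<times> E \<longrightarrow>
      (\<Sum>i\<in>J. ((1 / real n) * (\<Sum>j<n. \<zeta> i (z j)) - (\<integral>z. \<zeta> i z \<partial>M))\<^sup>2 / (\<mu> (snd i) + lam)) \<le> (a * T)\<^sup>2)"
proof -
  let ?P = "Pi\<^sub>M {..<n} (\<lambda>_. M)"
  interpret P: prob_space ?P by (rule prob_space_PiM) (rule prob_space_axioms)
  define \<xi> where "\<xi> i z = \<zeta> i z / sqrt (\<mu> (snd i) + lam)" for i z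
  define D where "D J z = L2_set (\<lambda>i. (\<Sum>j<n. \<xi> i (z j)) / n - (\<integral>z. \<xi> i z \<partial>M)) J" for J z
  define R where "R = b * m * \<kappa> / sqrt lam"
  have b: "0 \<le> b" and \<kappa>: "0 \<le> \<kappa>" using \<beta>b \<phi>\<kappa> norm_ge_zero order_trans by blast+
  have N0: "0 \<le> N" using N[of "{}"] by simp
  have pos: "0 < \<mu> e + lam" if "e \<in> E" for e using \<mu>(1)[OF that] lam by simp
  have \<xi>m[measurable]: "\<xi> i \<in> borel_measurable M" for i
    unfolding \<xi>_def \<zeta>_def by (cases i) simp
  have tail: "{z \<in> space ?P. a * T < D J z} \<in> sets ?P \<and> measure ?P {z \<in> space ?P. a * T < D J z} \<le> \<epsilon>"
    if J: "finite J" "J \<subseteq> W \<times> E" for J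
  proof -
    let ?W = "fst ` J" and ?E = "snd ` J"
    have fin: "finite ?W" "finite ?E" using J by auto
    have sub: "?W \<subseteq> W" "?E \<subseteq> E" using J by auto
    then have on: "orthonormal ?W" "orthonormal ?E"
      using W(2) E(2) pairwise_mono unfolding orthonormal_def by blast+
    have le: "(L2_set (\<lambda>i. \<xi> i z) J)\<^sup>2 \<le> (b * m\<^sup>2) * (\<Sum>e\<in>?E. \<beta> z * (\<phi> z \<bullet> e)\<^sup>2 / (\<mu> e + lam))"
      if z: "norm (u z) \<le> m" for z
    proof -
      have \<xi>2: "(\<xi> (w, e) z)\<^sup>2 = (\<beta> z)\<^sup>2 * (u z \<bullet> w)\<^sup>2 * ((\<phi> z \<bullet> e)\<^sup>2 / (\<mu> e + lam))" if "e \<in> E" for w e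
        using pos[OF that] by (simp add: \<xi>_def \<zeta>_def power_divide power_mult_distrib)
      have "(L2_set (\<lambda>i. \<xi> i z) J)\<^sup>2 = (\<Sum>i\<in>J. (\<xi> i z)\<^sup>2)" by (rule L2_set_power2)
      \<comment> \<open>Enlarging \<open>J\<close> to the product of its projections lets the sum
        factorise.\<close>
      also have "\<dots> \<le> (\<Sum>i\<in>?W \<times> ?E. (\<xi> i z)\<^sup>2)"
        by (rule sum_mono2) (use fin in \<open>auto simp: rev_image_eqI\<close>)
      also have "\<dots> = (\<Sum>w\<in>?W. \<Sum>e\<in>?E. (\<xi> (w, e) z)\<^sup>2)" by (simp add: sum.cartesian_product)
      also have "\<dots> = (\<Sum>w\<in>?W. \<Sum>e\<in>?E. (\<beta> z)\<^sup>2 * (u z \<bullet> w)\<^sup>2 * ((\<phi> z \<bullet> e)\<^sup>2 / (\<mu> e + lam)))"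
        by (intro sum.cong refl \<xi>2) (use sub in auto)
      also have "\<dots> = (\<Sum>w\<in>?W. (u z \<bullet> w)\<^sup>2) * (\<beta> z * (\<Sum>e\<in>?E. \<beta> z * (\<phi> z \<bullet> e)\<^sup>2 / (\<mu> e + lam)))"
        unfolding sum_distrib_right by (simp add: sum_distrib_left power2_eq_square mult_ac)
      \<comment> \<open>Only one of the two factors \<beta> z is bounded by b. The other stays
        inside because \<beta> (\<phi> . e)^2 has expectation \<mu> e, which is how the effective
        dimension enters the variance.\<close>
      also have "\<dots> \<le> m\<^sup>2 * (b * (\<Sum>e\<in>?E. \<beta> z * (\<phi> z \<bullet> e)\<^sup>2 / (\<mu> e + lam)))"
      proof (rule mult_mono)
        have "(\<Sum>w\<in>?W. (u z \<bullet> w)\<^sup>2) \<le> (norm (u z))\<^sup>2" by (rule bessel[OF on(1) fin(1)])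
        also have "\<dots> \<le> m\<^sup>2" using z by (intro power_mono) auto
        finally show "(\<Sum>w\<in>?W. (u z \<bullet> w)\<^sup>2) \<le> m\<^sup>2" .
        have s0: "0 \<le> (\<Sum>e\<in>?E. \<beta> z * (\<phi> z \<bullet> e)\<^sup>2 / (\<mu> e + lam))"
          using sub pos \<beta>b by (intro sum_nonneg divide_nonneg_nonneg mult_nonneg_nonneg) (auto intro: less_imp_le)
        then show "\<beta> z * (\<Sum>e\<in>?E. \<beta> z * (\<phi> z \<bullet> e)\<^sup>2 / (\<mu> e + lam)) \<le> b * (\<Sum>e\<in>?E. \<beta> z * (\<phi> z \<bullet> e)\<^sup>2 / (\<mu> e + lam))"
          using \<beta>b by (intro mult_right_mono)
        show "0 \<le> \<beta> z * (\<Sum>e\<in>?E. \<beta> z * (\<phi> z \<bullet> e)\<^sup>2 / (\<mu> e + lam))" using s0 \<beta>b by simp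
      qed simp
      finally show ?thesis by (simp add: mult_ac)
    qed
    have \<phi>sq: "(\<Sum>e\<in>?E. \<beta> z * (\<phi> z \<bullet> e)\<^sup>2 / (\<mu> e + lam)) \<le> b * \<kappa>\<^sup>2 / lam" for z
    proof -
      have "(\<Sum>e\<in>?E. \<beta> z * (\<phi> z \<bullet> e)\<^sup>2 / (\<mu> e + lam)) \<le> (\<Sum>e\<in>?E. b * (\<phi> z \<bullet> e)\<^sup>2 / lam)"
        using \<beta>b b sub \<mu> lam by (intro sum_mono frac_le mult_right_mono) auto
      also have "\<dots> = (b / lam) * (\<Sum>e\<in>?E. (\<phi> z \<bullet> e)\<^sup>2)" by (simp add: sum_distrib_left)
      also have "\<dots> \<le> (b / lam) * \<kappa>\<^sup>2"
      proof (rule mult_left_mono)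
        have "(\<Sum>e\<in>?E. (\<phi> z \<bullet> e)\<^sup>2) \<le> (norm (\<phi> z))\<^sup>2" by (rule bessel[OF on(2) fin(2)])
        also have "\<dots> \<le> \<kappa>\<^sup>2" using \<phi>\<kappa> by (intro power_mono) auto
        finally show "(\<Sum>e\<in>?E. (\<phi> z \<bullet> e)\<^sup>2) \<le> \<kappa>\<^sup>2" .
      qed (use b lam in simp)
      finally show ?thesis by simp
    qed
    have 1: "AE z in M. L2_set (\<lambda>i. \<xi> i z) J \<le> R"
      using um
    proof eventually_elim
      case (elim z)
      have "(L2_set (\<lambda>i. \<xi> i z) J)\<^sup>2 \<le> (b * m\<^sup>2) * (b * \<kappa>\<^sup>2 / lam)"
        using le[OF elim] \<phi>sq[of z] b by (meson order_trans mult_left_mono mult_nonneg_nonneg zero_le_power2)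
      also have "\<dots> = R\<^sup>2" using lam by (simp add: R_def power_divide power_mult_distrib power2_eq_square)
      finally show ?case by (rule power2_le_imp_le) (use b m \<kappa> lam in \<open>simp add: R_def\<close>)
    qed
    have int: "integrable M (\<lambda>z. \<beta> z * (\<phi> z \<bullet> e)\<^sup>2)" for e
    proof (rule integrable_const_bound[where B = "b * (\<kappa> * norm e)\<^sup>2"])
      have "\<beta> z * (\<phi> z \<bullet> e)\<^sup>2 \<le> b * (\<kappa> * norm e)\<^sup>2" for z
      proof (rule mult_mono)
        have "\<bar>\<phi> z \<bullet> e\<bar> \<le> \<kappa> * norm e"
          using Cauchy_Schwarz_ineq2 mult_right_mono[OF \<phi>\<kappa> norm_ge_zero] by (rule order_trans)
        then have "\<bar>\<phi> z \<bullet> e\<bar>\<^sup>2 \<le> (\<kappa> * norm e)\<^sup>2" by (rule power_mono) simp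
        then show "(\<phi> z \<bullet> e)\<^sup>2 \<le> (\<kappa> * norm e)\<^sup>2" by simp
      qed (use \<beta>b b in auto)
      then show "AE z in M. norm (\<beta> z * (\<phi> z \<bullet> e)\<^sup>2) \<le> b * (\<kappa> * norm e)\<^sup>2"
        using \<beta>b by (simp add: abs_mult)
    qed measurable
    have 2: "(\<integral>z. (L2_set (\<lambda>i. \<xi> i z) J)\<^sup>2 \<partial>M) \<le> (sqrt (b * m\<^sup>2 * N))\<^sup>2"
    proof -
      have "(\<integral>z. (L2_set (\<lambda>i. \<xi> i z) J)\<^sup>2 \<partial>M) \<le> (\<integral>z. (b * m\<^sup>2) * (\<Sum>e\<in>?E. \<beta> z * (\<phi> z \<bullet> e)\<^sup>2 / (\<mu> e + lam)) \<partial>M)"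
      proof (rule integral_mono_AE)
        show "integrable M (\<lambda>z. (L2_set (\<lambda>i. \<xi> i z) J)\<^sup>2)"
        proof (rule integrable_const_bound[where B = "R\<^sup>2"])
          show "AE z in M. norm ((L2_set (\<lambda>i. \<xi> i z) J)\<^sup>2) \<le> R\<^sup>2"
            using 1 by eventually_elim (simp add: power_mono L2_set_nonneg)
          show "(\<lambda>z. (L2_set (\<lambda>i. \<xi> i z) J)\<^sup>2) \<in> borel_measurable M"
            unfolding L2_set_power2 by measurable
        qed
        show "AE z in M. (L2_set (\<lambda>i. \<xi> i z) J)\<^sup>2 \<le> (b * m\<^sup>2) * (\<Sum>e\<in>?E. \<beta> z * (\<phi> z \<bullet> e)\<^sup>2 / (\<mu> e + lam))"
          using um by eventually_elim (rule le)
      qed (use int in auto)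
      also have "\<dots> = (b * m\<^sup>2) * (\<Sum>e\<in>?E. \<mu> e / (\<mu> e + lam))"
        using int \<mu>(2) sub by (simp add: subset_iff)
      also have "\<dots> \<le> (b * m\<^sup>2) * N" using b fin sub by (intro mult_left_mono N) auto
      finally show ?thesis using b N0 by simp
    qed
    have R0: "0 \<le> R" using b m \<kappa> lam by (simp add: R_def)
    have T: "T = 2 * (2 * R / n + sqrt (b * m\<^sup>2 * N) / sqrt n) * L" by (simp add: T_def R_def)
    have sq0: "0 \<le> sqrt (b * m\<^sup>2 * N)" using b N0 by simp
    note tail = empirical_mean_tail[OF J(1) \<xi>m 1 2 R0 sq0 n L a, folded T]
    show ?thesis
      unfolding D_def using tail \<epsilon> by auto
  qed
  have "\<exists>\<Omega>\<in>sets ?P. 1 - \<epsilon> \<le> measure ?P \<Omega> \<and> (\<forall>z\<in>\<Omega>. \<forall>J. finite J \<and> J \<subseteq> W \<times> E \<longrightarrow> D J z \<le> a * T)"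
  proof (rule P.exhausting_event)
    show "countable (W \<times> E)" using W E by auto
    show "D J z \<le> D J' z" if "finite J'" "J \<subseteq> J'" for J J' z
      unfolding D_def by (rule L2_set_mono_subset[OF that])
  qed (use tail in auto)
  then obtain \<Omega> where \<Omega>: "\<Omega> \<in> sets ?P" "1 - \<epsilon> \<le> measure ?P \<Omega>"
    and \<Omega>D: "\<forall>z\<in>\<Omega>. \<forall>J. finite J \<and> J \<subseteq> W \<times> E \<longrightarrow> D J z \<le> a * T" by blast
  have "(\<Sum>i\<in>J. ((1 / real n) * (\<Sum>j<n. \<zeta> i (z j)) - (\<integral>z. \<zeta> i z \<partial>M))\<^sup>2 / (\<mu> (snd i) + lam)) \<le> (a * T)\<^sup>2"
    if "z \<in> \<Omega>" "finite J" "J \<subseteq> W \<times> E" for z J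
  proof -
    have "(\<Sum>i\<in>J. ((1 / real n) * (\<Sum>j<n. \<zeta> i (z j)) - (\<integral>z. \<zeta> i z \<partial>M))\<^sup>2 / (\<mu> (snd i) + lam)) = (D J z)\<^sup>2"
      unfolding D_def L2_set_power2
    proof (rule sum.cong)
      fix i assume "i \<in> J"
      then have p: "0 < \<mu> (snd i) + lam" using pos that by auto
      have "(\<Sum>j<n. \<xi> i (z j)) / n - (\<integral>z. \<xi> i z \<partial>M)
          = ((1 / real n) * (\<Sum>j<n. \<zeta> i (z j)) - (\<integral>z. \<zeta> i z \<partial>M)) / sqrt (\<mu> (snd i) + lam)"
        by (simp add: \<xi>_def sum_divide_distrib[symmetric] diff_divide_distrib mult.commute)
      then show "((1 / real n) * (\<Sum>j<n. \<zeta> i (z j)) - (\<integral>z. \<zeta> i z \<partial>M))\<^sup>2 / (\<mu> (snd i) + lam)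
          = ((\<Sum>j<n. \<xi> i (z j)) / n - (\<integral>z. \<xi> i z \<partial>M))\<^sup>2"
        using p by (simp add: power_divide)
    qed simp
    also have "\<dots> \<le> (a * T)\<^sup>2"
    proof (rule power_mono)
      show "D J z \<le> a * T" using \<Omega>D that by blast
    qed (simp add: D_def L2_set_nonneg)
    finally show ?thesis .
  qed
  with \<Omega> show ?thesis by blast
qed

section \<open>Confidence levels and collection of the constants\<close>

text \<open>From e < 2.72 and 2.72^17 <= 2^25. The value is chosen because (17/25)^2 exceeds 9/20 =
  1/4 + 1/5, the sum of the two Chebyshev constants.\<close>

lemma ln_2_ge: "17 / 25 \<le> ln (2::real)"
proof -
  have "exp (17::real) = exp 1 ^ 17" by (simp add: exp_of_nat_mult[symmetric])
  also have "\<dots> \<le> (272 / 100) ^ 17" using e_less_272 by (intro power_mono) auto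
  also have "\<dots> \<le> (2::real) ^ 25" unfolding power_divide by simp
  finally have "exp (17::real) \<le> 2 ^ 25" .
  then have "ln (exp (17::real)) \<le> ln (2 ^ 25)" by (subst ln_le_cancel_iff) auto
  also have "ln ((2::real) ^ 25) = 25 * ln 2" by (subst ln_realpow) simp_all
  finally show ?thesis by simp
qed

text \<open>For small \<open>\<delta>\<close> the two exponential tail bounds are each at most \<open>\<delta> / 2\<close>; for
  \<open>\<delta> \<ge> 1 / e\<close> one uses the two Chebyshev bounds, whose sum \<open>9 / (20 L\<^sup>2)\<close> is at most \<open>\<delta>\<close>
  because the threshold of the noise event is larger by the factor \<open>sqrt 5 / 2\<close>. This is where the
  constant \<open>sqrt 10\<close>, rather than \<open>2 * sqrt 2\<close>, is needed.\<close>

lemma split_confidence: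
  fixes \<delta> :: real
  assumes \<delta>: "0 < \<delta>" "\<delta> < 1"
  defines "L \<equiv> ln (2 / \<delta>)"
  shows "\<exists>\<epsilon>\<^sub>1 \<epsilon>\<^sub>2. \<epsilon>\<^sub>1 + \<epsilon>\<^sub>2 \<le> \<delta> \<and>
    (2 * exp (1 - 2 * 1 * L) \<le> \<epsilon>\<^sub>1 \<or> 1 / (2 * 1 * L)\<^sup>2 \<le> \<epsilon>\<^sub>1) \<and>
    (2 * exp (1 - 2 * (sqrt 5 / 2) * L) \<le> \<epsilon>\<^sub>2 \<or> 1 / (2 * (sqrt 5 / 2) * L)\<^sup>2 \<le> \<epsilon>\<^sub>2)"
proof -
  have L: "L = ln 2 - ln \<delta>" using \<delta> by (simp add: L_def ln_div)
  have L0: "0 < L" using \<delta> by (simp add: L_def)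
  show ?thesis
  proof (cases "\<delta> \<le> exp (- 1)")
    case True
    \<comment> \<open>This turns 2 * exp (1 - 2 * L) into e \<delta>^2 / 2, which is at most
      \<delta> / 2 exactly when \<delta> <= 1 / e.\<close>
    have eL: "exp (- L) = \<delta> / 2" using \<delta> by (simp add: L exp_diff)
    have "exp (1 - 2 * L) = exp 1 * (exp (- L))\<^sup>2"
      by (simp add: power2_eq_square exp_add[symmetric])
    also have "\<dots> = (exp 1 * \<delta>) * (\<delta> / 4)" by (simp add: eL power2_eq_square)
    also have "\<dots> \<le> 1 * (\<delta> / 4)"
    proof (rule mult_right_mono)
      have "exp 1 * \<delta> \<le> exp 1 * exp (- 1)" using True by (rule mult_left_mono) simp
      then show "exp 1 * \<delta> \<le> 1" by (simp add: exp_minus)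
    qed (use \<delta> in simp)
    finally have 1: "2 * exp (1 - 2 * L) \<le> \<delta> / 2" by simp
    have "1 \<le> sqrt 5 / 2" by (simp add: real_le_rsqrt)
    then have "2 * 1 * L \<le> 2 * (sqrt 5 / 2) * L" using L0 by (intro mult_right_mono) auto
    then have "exp (1 - 2 * (sqrt 5 / 2) * L) \<le> exp (1 - 2 * L)" by simp
    then have "2 * exp (1 - 2 * (sqrt 5 / 2) * L) \<le> \<delta> / 2" using 1 by linarith
    with 1 show ?thesis by (intro exI[of _ "\<delta> / 2"]) simp
  next
    case False
    define v where "v = - ln \<delta>"
    have "exp (- 1) < exp (- v)" using False \<delta> by (simp add: v_def)
    then have "- 1 < - v" by (simp only: exp_less_cancel_iff)
    then have v: "0 \<le> v" "v \<le> 1" using \<delta> by (simp_all add: v_def)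
    have \<delta>v: "\<delta> = exp (- (v / 2)) * exp (- (v / 2))" using \<delta> by (simp add: v_def exp_add[symmetric])
    have l2: "17 / 25 \<le> ln (2::real)" "ln (2::real) \<le> 1" using ln_2_ge ln_2_less_1 by auto
    \<comment> \<open>The root of \<delta> times L is exp (- v / 2) * (ln 2 + v); on [0, 1] it is at
      least its value ln 2 at v = 0, for which the tangent bound exp (- v / 2) >= 1 - v / 2
      suffices.\<close>
    have "ln 2 \<le> (1 - v / 2) * L"
    proof -
      have "(1 - v / 2) * L = ln 2 + v * (1 - ln 2 / 2 - v / 2)"
        by (simp add: L v_def algebra_simps)
      moreover have "0 \<le> v * (1 - ln 2 / 2 - v / 2)" using v l2 by (intro mult_nonneg_nonneg) auto
      ultimately show ?thesis by simp
    qed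
    also have "\<dots> \<le> exp (- (v / 2)) * L"
      using exp_ge_add_one_self[of "- (v / 2)"] L0 by (intro mult_right_mono) auto
    finally have "17 / 25 \<le> exp (- (v / 2)) * L" using l2 by linarith
    then have "(17 / 25)\<^sup>2 \<le> (exp (- (v / 2)) * L)\<^sup>2" by (rule power_mono) simp
    also have "\<dots> = \<delta> * L\<^sup>2" by (simp add: \<delta>v power2_eq_square)
    finally have "9 / 20 \<le> \<delta> * L\<^sup>2" by (simp add: power2_eq_square)
    then have "1 / (4 * L\<^sup>2) + 1 / (5 * L\<^sup>2) \<le> \<delta>"
      using L0 by (simp add: field_simps)
    moreover have "(2 * 1 * L)\<^sup>2 = 4 * L\<^sup>2" "(2 * (sqrt 5 / 2) * L)\<^sup>2 = 5 * L\<^sup>2"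
      by (simp_all add: power_mult_distrib)
    ultimately show ?thesis
      by (intro exI[of _ "1 / (4 * L\<^sup>2)"] exI[of _ "1 / (5 * L\<^sup>2)"]) simp
  qed
qed

text \<open>Apart from regrouping, the only inequality is the factor 2 powr (\<nu> - \<nu>') * m >=
  1 inserted into the resolvent term \<open>Q\<close>. The approximation term carries this factor
  anyway; inserting it gives both the same prefactor.\<close>

lemma assemble_constants:
  fixes n :: nat and lam b \<kappa> N M L \<Gamma> hC hs \<nu> \<nu>' m BD P :: real
  assumes n: "1 \<le> n" and lam: "0 < lam" and nonneg: "0 \<le> b" "0 \<le> \<kappa>" "0 \<le> N" "0 \<le> M" "0 \<le> L" "0 \<le> \<Gamma>" "0 \<le> hs"
    and \<nu>': "0 \<le> \<nu>'" "\<nu>' \<le> \<nu>" and m: "1 \<le> m"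
  defines "T\<^sub>1 \<equiv> 2 * (2 * (b * \<kappa> * \<kappa> / sqrt lam) / n + sqrt (b * \<kappa>\<^sup>2 * N) / sqrt n) * L"
    and "T\<^sub>2 \<equiv> sqrt 5 / 2 * (2 * (2 * (b * M * \<kappa> / sqrt lam) / n + sqrt (b * M\<^sup>2 * N) / sqrt n) * L)"
  shows "2 powr \<nu> * \<Gamma> * (2 powr (\<nu> - \<nu>') * (m * P * hC) + \<nu>' * (T\<^sub>1 / sqrt lam) * hs) + BD / lam * sqrt (2 * lam) * T\<^sub>2
    \<le> ((2 powr (2 * \<nu> - \<nu>' + 2) * \<Gamma> * m * \<nu>' * b * \<kappa>\<^sup>2 * hs + 2 * sqrt 10 * b * M * \<kappa> * BD) / (real n * lam)
        + (2 powr (2 * \<nu> - \<nu>' + 1) * \<Gamma> * m * \<nu>' * sqrt b * \<kappa> * hs + sqrt 10 * sqrt b * M * BD) * sqrt (N / (real n * lam))) * L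
      + 2 powr (2 * \<nu> - \<nu>') * \<Gamma> * m * hC * P"
proof -
  define w where "w = 1 / (real n * lam)"
  define r where "r = sqrt (N / (real n * lam))"
  define t where "t = 2 powr (\<nu> - \<nu>')"
  have sl: "sqrt lam > 0" "sqrt lam * sqrt lam = lam" "(sqrt lam)\<^sup>2 = lam" and sn: "sqrt n > 0" using n lam by auto
  have split: "X * Y * Z / sqrt lam / real n / sqrt lam = X * Y * Z * w" for X Y Z
    using sl by (simp add: w_def field_simps)
  have root: "sqrt (b * x\<^sup>2 * N) / sqrt n / sqrt lam = sqrt b * x * r" if "0 \<le> x" for x
    using that by (simp add: r_def real_sqrt_mult real_sqrt_divide)
  have E1: "T\<^sub>1 / sqrt lam = (4 * b * \<kappa>\<^sup>2 * w + 2 * sqrt b * \<kappa> * r) * L"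
  proof -
    have "T\<^sub>1 / sqrt lam = 2 * (2 * (b * \<kappa> * \<kappa> / sqrt lam / real n / sqrt lam) + sqrt (b * \<kappa>\<^sup>2 * N) / sqrt n / sqrt lam) * L"
      by (simp add: T\<^sub>1_def add_divide_distrib algebra_simps)
    also have "\<dots> = (4 * b * \<kappa>\<^sup>2 * w + 2 * sqrt b * \<kappa> * r) * L"
      unfolding split root[OF nonneg(2)] by (simp add: power2_eq_square algebra_simps)
    finally show ?thesis .
  qed
  have s10: "sqrt 2 * sqrt 5 = sqrt 10" by (simp add: real_sqrt_mult[symmetric])
  have E2: "BD / lam * sqrt (2 * lam) * T\<^sub>2 = (2 * sqrt 10 * b * M * \<kappa> * BD * w + sqrt 10 * sqrt b * M * BD * r) * L"
  proof -
    have "BD / lam * sqrt (2 * lam) = BD * sqrt 2 / sqrt lam"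
      using sl by (simp add: real_sqrt_mult field_simps)
    then have "BD / lam * sqrt (2 * lam) * T\<^sub>2
        = BD * (sqrt 2 * sqrt 5) * (2 * (b * M * \<kappa> / sqrt lam / real n / sqrt lam) + sqrt (b * M\<^sup>2 * N) / sqrt n / sqrt lam) * L"
      by (simp add: T\<^sub>2_def add_divide_distrib algebra_simps)
    also have "\<dots> = (2 * sqrt 10 * b * M * \<kappa> * BD * w + sqrt 10 * sqrt b * M * BD * r) * L"
      unfolding s10 split root[OF nonneg(4)] by (simp add: algebra_simps)
    finally show ?thesis .
  qed
  have p: "2 powr (2 * \<nu> - \<nu>' + 2) = 4 * (2 powr \<nu> * t)" "2 powr (2 * \<nu> - \<nu>' + 1) = 2 * (2 powr \<nu> * t)"
    "2 powr (2 * \<nu> - \<nu>') = 2 powr \<nu> * t"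
  proof -
    have e: "2 * \<nu> - \<nu>' = \<nu> + (\<nu> - \<nu>')" by simp
    show "2 powr (2 * \<nu> - \<nu>') = 2 powr \<nu> * t" unfolding e t_def by (rule powr_add)
    then show "2 powr (2 * \<nu> - \<nu>' + 2) = 4 * (2 powr \<nu> * t)" "2 powr (2 * \<nu> - \<nu>' + 1) = 2 * (2 powr \<nu> * t)"
      by (simp_all add: powr_add)
  qed
  have "1 \<le> t" unfolding t_def using \<nu>' by (intro ge_one_powr_ge_zero) auto
  then have tm: "1 \<le> t * m" using m by (metis mult_mono' mult_1 zero_le_one)
  define Q where "Q = 2 powr \<nu> * \<Gamma> * (\<nu>' * ((4 * b * \<kappa>\<^sup>2 * w + 2 * sqrt b * \<kappa> * r) * L) * hs)"
  have w0: "0 \<le> w" "0 \<le> r" using lam nonneg by (simp_all add: w_def r_def)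
  have "0 \<le> 4 * b * \<kappa>\<^sup>2 * w + 2 * sqrt b * \<kappa> * r" using nonneg w0 by simp
  then have "0 \<le> Q" unfolding Q_def using nonneg \<nu>' by simp
  then have "1 * Q \<le> (t * m) * Q" by (rule mult_right_mono[OF tm])
  moreover have "2 powr \<nu> * \<Gamma> * (t * (m * P * hC) + \<nu>' * (T\<^sub>1 / sqrt lam) * hs) = 2 powr \<nu> * \<Gamma> * t * m * P * hC + Q"
    unfolding E1 Q_def by (simp add: algebra_simps)
  moreover have "((2 powr (2 * \<nu> - \<nu>' + 2) * \<Gamma> * m * \<nu>' * b * \<kappa>\<^sup>2 * hs + 2 * sqrt 10 * b * M * \<kappa> * BD) / (real n * lam)
        + (2 powr (2 * \<nu> - \<nu>' + 1) * \<Gamma> * m * \<nu>' * sqrt b * \<kappa> * hs + sqrt 10 * sqrt b * M * BD) * sqrt (N / (real n * lam))) * L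
      + 2 powr (2 * \<nu> - \<nu>') * \<Gamma> * m * hC * P
    = (t * m) * Q + (2 * sqrt 10 * b * M * \<kappa> * BD * w + sqrt 10 * sqrt b * M * BD * r) * L + 2 powr \<nu> * \<Gamma> * t * m * P * hC"
    unfolding p Q_def r_def[symmetric] by (simp add: w_def add_divide_distrib algebra_simps)
  ultimately show ?thesis unfolding t_def[symmetric] E2 by linarith
qed

text \<open>Given x, the conditional mean of y is c x, so the inner integral vanishes. Truncation
  and a shift by a constant reduce the iteration of the integral over the joint measure to a bounded
  nonnegative integrand.\<close>

lemma noise_centred:
  fixes p q :: "('x::{second_countable_topology, t2_space} \<times> 'y::{real_inner, banach, second_countable_topology}) measure"
    and h :: "'x \<Rightarrow> real" and c :: "'x \<Rightarrow> 'y"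
  assumes cs: "covariate_shift p q \<rho>" and y: "AE (x, y) in p. norm y \<le> M'"
    and h[measurable]: "h \<in> borel_measurable borel" and hK: "\<And>x. \<bar>h x\<bar> \<le> K"
    and c[measurable]: "c \<in> borel_measurable borel" and cK: "\<And>x. norm (c x) \<le> K'"
    and reg: "\<And>x. c x = regression_fun \<rho> x"
  shows "(\<integral>z. h (fst z) * ((c (fst z) - snd z) \<bullet> w) \<partial>p) = 0"
proof -
  define P where "P = marginal_X p"
  define \<tau> where "\<tau> x = distr (\<rho> x) borel (\<lambda>y. (x, y))" for x
  have cs': "prob_space p" "sets p = sets borel" "\<rho> \<in> borel \<rightarrow>\<^sub>M prob_algebra borel"
    using cs unfolding covariate_shift_def by blast+
  have "p = joint_measure (marginal_X p) \<rho>" using cs unfolding covariate_shift_def by blast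
  then have p: "p = P \<bind> \<tau>" unfolding joint_measure_def P_def \<tau>_def[abs_def] .
  interpret p: prob_space p by (rule cs'(1))
  have sp[measurable_cong]: "sets p = sets (borel \<Otimes>\<^sub>M borel)" unfolding borel_prod by (rule cs'(2))
  have fst_m: "fst \<in> p \<rightarrow>\<^sub>M borel" by measurable
  have sP[measurable_cong]: "sets P = sets borel" by (simp add: P_def marginal_X_def)
  interpret P: prob_space P unfolding P_def marginal_X_def by (rule p.prob_space_distr[OF fst_m])
  have \<rho>m: "\<rho> \<in> borel \<rightarrow>\<^sub>M subprob_algebra borel" using cs'(3) by (rule measurable_prob_algebraD)
  have \<rho>: "prob_space (\<rho> x)" "sets (\<rho> x) = sets borel" for x
    using measurable_space[OF cs'(3), of x] by (auto simp: space_prob_algebra)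
  have pair_m: "(\<lambda>y. (x, y)) \<in> \<rho> x \<rightarrow>\<^sub>M borel" for x
    unfolding borel_prod[symmetric] using \<rho>(2)[of x] by (simp add: measurable_Pair1' cong: measurable_cong_sets)
  have "case_prod Pair \<in> (borel :: 'x measure) \<Otimes>\<^sub>M (borel :: 'y measure) \<rightarrow>\<^sub>M borel"
    unfolding borel_prod by (simp add: case_prod_beta')
  from measurable_distr2[OF this \<rho>m]
  have \<tau>m: "\<tau> \<in> P \<rightarrow>\<^sub>M subprob_algebra borel"
    unfolding \<tau>_def using sP by (simp cong: measurable_cong_sets)
  \<comment> \<open>Equal to y almost surely but bounded everywhere, which makes \<open>G\<close>
    bounded everywhere as well.\<close>
  define tr where "tr y = (if norm y \<le> M' then y else 0)" for y :: 'y
  have tr[measurable]: "tr \<in> borel_measurable borel" unfolding tr_def by measurable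
  define B where "B = K * ((K' + \<bar>M'\<bar>) * norm w)"
  define G where "G z = h (fst z) * ((c (fst z) - tr (snd z)) \<bullet> w)" for z
  have Gm[measurable]: "G \<in> borel_measurable borel"
    unfolding G_def borel_prod[symmetric] by measurable
  have GB: "\<bar>G z\<bar> \<le> B" for z
  proof -
    have "norm (tr (snd z)) \<le> \<bar>M'\<bar>" by (auto simp: tr_def)
    then have "norm (c (fst z) - tr (snd z)) \<le> K' + \<bar>M'\<bar>"
      using norm_triangle_ineq4[of "c (fst z)" "tr (snd z)"] cK[of "fst z"] by linarith
    then have "\<bar>(c (fst z) - tr (snd z)) \<bullet> w\<bar> \<le> (K' + \<bar>M'\<bar>) * norm w"
      by (rule order_trans[OF Cauchy_Schwarz_ineq2 mult_right_mono]) simp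
    then show ?thesis
      unfolding G_def B_def abs_mult using hK[of "fst z"] by (intro mult_mono) auto
  qed
  have B0: "0 \<le> B" using GB[of undefined] by linarith
  have GB0: "0 \<le> G z + B" for z using GB[of z] unfolding abs_le_iff by linarith
  have AEp: "AE z in p. norm (snd z) \<le> M'" using y by (simp add: case_prod_beta')
  \<comment> \<open>The bound on y holds almost surely for the joint measure; it must hold under
    almost every conditional distribution before the conditional means of y and \<open>tr\<close>
    can be identified.\<close>
  have "AE z in P \<bind> \<tau>. norm (snd z) \<le> M'"     by (rule subst[OF p, of "\<lambda>q. AE z in q. norm (snd z) \<le> M'"]) (rule AEp)
  then have "AE x in P. AE z in \<tau> x. norm (snd z) \<le> M'"
    by (subst (asm) AE_bind[OF \<tau>m]) (auto simp: borel_prod[symmetric])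
  then have AEx: "AE x in P. AE y in \<rho> x. norm y \<le> M'"
  proof eventually_elim
    case (elim x)
    then show ?case unfolding \<tau>_def
      by (subst (asm) AE_distr_iff[OF pair_m]) (auto simp: borel_prod[symmetric])
  qed
  have inner: "AE x in P. (\<integral>\<^sup>+z. ennreal (G z + B) \<partial>\<tau> x) = ennreal B"
    using AEx
  proof eventually_elim
    case (elim x)
    interpret \<rho>x: prob_space "\<rho> x" by (rule \<rho>)
    note [measurable_cong] = \<rho>(2)[of x]
    have tri: "integrable (\<rho> x) tr"
      by (rule \<rho>x.integrable_const_bound[where B = "\<bar>M'\<bar>"]) (auto simp: tr_def)
    have "(\<integral>y. tr y \<partial>\<rho> x) = (\<integral>y. y \<partial>\<rho> x)"
      by (rule integral_cong_AE) (use elim in \<open>auto simp: tr_def elim: eventually_mono\<close>)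
    then have trc: "(\<integral>y. tr y \<partial>\<rho> x) = c x" by (simp add: reg regression_fun_def)
    have Gx: "G (x, y) = h x * (c x \<bullet> w) - h x * (tr y \<bullet> w)" for y
      by (simp add: G_def inner_diff_left algebra_simps)
    have intG: "integrable (\<rho> x) (\<lambda>y. G (x, y) + B)" unfolding Gx using tri by simp
    have "(\<integral>y. tr y \<bullet> w \<partial>\<rho> x) = c x \<bullet> w"
      using integral_inner_left[of w "\<rho> x" tr] tri trc by simp
    then have val: "(\<integral>y. G (x, y) + B \<partial>\<rho> x) = B"
      unfolding Gx using tri by (simp add: \<rho>x.prob_space)
    have "(\<integral>\<^sup>+z. ennreal (G z + B) \<partial>\<tau> x) = (\<integral>\<^sup>+y. ennreal (G (x, y) + B) \<partial>\<rho> x)"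
      unfolding \<tau>_def by (rule nn_integral_distr[OF pair_m]) simp
    also have "\<dots> = ennreal B"
      using nn_integral_eq_integral[OF intG AE_I2[OF GB0]] by (simp add: val)
    finally show ?case .
  qed
  have Gp: "G \<in> borel_measurable p" using Gm measurable_cong_sets[OF cs'(2) refl] by blast
  have Gi: "integrable p G"
    by (rule p.integrable_const_bound[where B = B, OF _ Gp]) (use GB in auto)
  have "ennreal (\<integral>z. G z + B \<partial>p) = (\<integral>\<^sup>+z. ennreal (G z + B) \<partial>p)"
  proof (rule nn_integral_eq_integral[symmetric])
    show "AE z in p. 0 \<le> G z + B" by (intro AE_I2 GB0)
  qed (use Gi in auto)
  also have "\<dots> = (\<integral>\<^sup>+x. (\<integral>\<^sup>+z. ennreal (G z + B) \<partial>\<tau> x) \<partial>P)"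
    unfolding p by (rule nn_integral_bind[OF _ \<tau>m]) simp
  also have "\<dots> = (\<integral>\<^sup>+x. ennreal B \<partial>P)" by (rule nn_integral_cong_AE[OF inner])
  also have "\<dots> = ennreal B" by (simp add: P.emeasure_space_1)
  finally have "(\<integral>z. G z + B \<partial>p) = B"
    by (rule ennreal_inj[THEN iffD1, rotated 2]) (intro integral_nonneg_AE AE_I2 GB0 B0)+
  then have "(\<integral>z. G z \<partial>p) = 0" using Gi by (simp add: p.prob_space)
  moreover have "(\<integral>z. h (fst z) * ((c (fst z) - snd z) \<bullet> w) \<partial>p) = (\<integral>z. G z \<partial>p)"
  proof (rule integral_cong_AE)
    show "AE z in p. h (fst z) * ((c (fst z) - snd z) \<bullet> w) = G z"
      using AEp by eventually_elim (simp add: G_def tr_def)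
    show "G \<in> borel_measurable p" by (rule Gp)
  qed measurable
  ultimately show ?thesis by simp
qed

theorem theorem17:
  fixes p q :: "('x::{second_countable_topology, t2_space} \<times>
                 'y::{real_inner, banach, second_countable_topology}) measure"
    and \<rho> :: "'x \<Rightarrow> 'y measure"
    and \<beta> :: "'x \<Rightarrow> real"
    and k :: "'x \<Rightarrow> 'x \<Rightarrow> real"
    and repH :: "'h::{real_inner, banach, second_countable_topology} \<Rightarrow> 'x \<Rightarrow> real"
    and repG :: "'g::{real_inner, banach} \<Rightarrow> 'x \<Rightarrow> 'y"
    and \<phi> :: "'x \<Rightarrow> 'h"
    and C\<^sub>X :: "'h \<Rightarrow>\<^sub>L 'h"
    and C\<^sub>o Cstar :: "'h \<Rightarrow>\<^sub>L 'y"
    and g :: "real \<Rightarrow> real \<Rightarrow> real"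
    and \<psi> :: "real \<Rightarrow> real"
    and n :: nat
    and \<delta> lam s b \<kappa> M' M B D \<gamma> \<nu> \<gamma>\<^sub>\<nu> \<nu>' c \<B> A\<^sub>1 A\<^sub>2 A\<^sub>3 :: real
  assumes "locally_compact_space (euclidean :: 'x topology)"
    and "\<nexists>S :: 'y set. finite S \<and> span S = UNIV"
    and "is_rkhs (kernel_Id k) repH"
    and "is_rkhs (kernel_Id k) repG"
    and "\<phi> = feature k repH"
    and "\<phi> \<in> borel_measurable borel"
    and "covariate_shift p q \<rho>"
    and "C\<^sub>X = cov_op (marginal_X q) \<phi>"
    and "b * \<kappa>\<^sup>2 \<le> s"
    and "regularization_family s g B D \<gamma>"
    and "is_qualification s g \<nu>"
    and "qualification_bound s g \<nu> \<gamma>\<^sub>\<nu>"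
    and "0 < \<delta>" and "\<delta> < 1"
    and "1 \<le> n"
    and "0 < lam" and "lam \<le> s"
    and "\<B> = 2 * (2 * b * \<kappa>\<^sup>2 / (sqrt lam * real n) + sqrt (b * \<kappa>\<^sup>2 * eff_dim C\<^sub>X lam / real n))"
    and "\<B> * ln (2 / \<delta>) \<le> sqrt lam / 2"
    and "0 \<le> \<kappa>" and "\<forall>x. k x x \<le> \<kappa>\<^sup>2"
    and "\<beta> \<in> borel_measurable borel"
    and "marginal_X q = density (marginal_X p) (\<lambda>x. ennreal (\<beta> x))"
    and "\<forall>x. 0 \<le> \<beta> x \<and> \<beta> x \<le> b"
    and "AE (x, y) in p. norm y \<le> M'"
    and "index_function \<psi>"
    and "hilbert_schmidt C\<^sub>o"
    and "Cstar = C\<^sub>o o\<^sub>L op_fun \<psi> C\<^sub>X"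
    and "regression_fun \<rho> = (\<lambda>x. blinfun_apply Cstar (\<phi> x))"
    and "covers s \<nu> \<psi> c"
    and "\<nu>' = real_of_int \<lfloor>\<nu>\<rfloor>"
    and "M = M' + \<kappa> * hs_norm Cstar"
    and "A\<^sub>1 = 2 powr (2 * \<nu> - \<nu>' + 2) * (\<gamma>\<^sub>\<nu> + \<gamma>) * max 1 (1 / c) * \<nu>' * b * \<kappa>\<^sup>2 * hs_norm Cstar
              + 2 * sqrt 10 * b * M * \<kappa> * (B + D)"
    and "A\<^sub>2 = 2 powr (2 * \<nu> - \<nu>' + 1) * (\<gamma>\<^sub>\<nu> + \<gamma>) * max 1 (1 / c) * \<nu>' * sqrt b * \<kappa> * hs_norm Cstar
              + sqrt 10 * sqrt b * M * (B + D)"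
    and "A\<^sub>3 = 2 powr (2 * \<nu> - \<nu>') * (\<gamma>\<^sub>\<nu> + \<gamma>) * max 1 (1 / c) * hs_norm C\<^sub>o"
  shows "\<exists>\<Omega> \<in> sets (Pi\<^sub>M {..<n} (\<lambda>_. p)).
           1 - \<delta> \<le> measure (Pi\<^sub>M {..<n} (\<lambda>_. p)) \<Omega> \<and>
           (\<forall>z\<in>\<Omega>.
              (\<lambda>x. regression_fun \<rho> x - estimator g lam n \<beta> \<phi> z x) \<in> range repG \<and>
              rkhs_norm repG (\<lambda>x. regression_fun \<rho> x - estimator g lam n \<beta> \<phi> z x)
                \<le> (A\<^sub>1 / (real n * lam) + A\<^sub>2 * sqrt (eff_dim C\<^sub>X lam / (real n * lam))) * ln (2 / \<delta>)
                  + A\<^sub>3 * \<psi> lam)"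
proof -
  define L where "L = ln (2 / \<delta>)"
  define N where "N = eff_dim C\<^sub>X lam"
  have H: "is_rkhs (kernel_Id k) repH" and G: "is_rkhs (kernel_Id k) repG" and \<phi>: "\<phi> = feature k repH"
    and \<phi>m: "\<phi> \<in> borel_measurable borel" and cs: "covariate_shift p q \<rho>" and C: "C\<^sub>X = cov_op (marginal_X q) \<phi>"
    and bs: "b * \<kappa>\<^sup>2 \<le> s" and reg: "regularization_family s g B D \<gamma>" and qual: "is_qualification s g \<nu>"
    and qb: "qualification_bound s g \<nu> \<gamma>\<^sub>\<nu>" and \<delta>: "0 < \<delta>" "\<delta> < 1" and n: "1 \<le> n" and lam: "0 < lam" "lam \<le> s"
    using assms by blast+
  have \<kappa>: "0 \<le> \<kappa>" and kb: "\<And>x. k x x \<le> \<kappa>\<^sup>2" and \<beta>m: "\<beta> \<in> borel_measurable borel"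
    and dens: "marginal_X q = density (marginal_X p) (\<lambda>x. ennreal (\<beta> x))"
    and \<beta>: "\<And>x. 0 \<le> \<beta> x" "\<And>x. \<beta> x \<le> b" and yM: "AE (x, y) in p. norm y \<le> M'"
    and \<psi>: "index_function \<psi>" and hs: "hilbert_schmidt C\<^sub>o" and Cstar: "Cstar = C\<^sub>o o\<^sub>L op_fun \<psi> C\<^sub>X"
    and regr: "regression_fun \<rho> = (\<lambda>x. blinfun_apply Cstar (\<phi> x))" and cov: "covers s \<nu> \<psi> c"
    using assms by blast+
  have \<nu>: "0 < \<nu>" using qual by (simp add: is_qualification_def)
  have L0: "0 < L" using \<delta> by (simp add: L_def)
  have p: "prob_space p" "sets p = sets borel" and q: "prob_space q" "sets q = sets borel"
    using cs unfolding covariate_shift_def by blast+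
  interpret p: prob_space p by (rule p(1))
  have sp: "sets p = sets (borel \<Otimes>\<^sub>M borel)" unfolding borel_prod by (rule p(2))
  have sq: "sets q = sets (borel \<Otimes>\<^sub>M borel)" unfolding borel_prod by (rule q(2))
  have fst_p: "fst \<in> p \<rightarrow>\<^sub>M borel" using measurable_fst measurable_cong_sets[OF sp refl] by blast
  have snd_p: "snd \<in> p \<rightarrow>\<^sub>M borel" using measurable_snd measurable_cong_sets[OF sp refl] by blast
  have fst_q: "fst \<in> q \<rightarrow>\<^sub>M borel" using measurable_fst measurable_cong_sets[OF sq refl] by blast
  have qX: "prob_space (marginal_X q)" "sets (marginal_X q) = sets borel"
    unfolding marginal_X_def using prob_space.prob_space_distr[OF q(1) fst_q] by auto
  have pX: "prob_space (marginal_X p)" "sets (marginal_X p) = sets borel"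
    unfolding marginal_X_def using p.prob_space_distr[OF fst_p] by auto

  have \<phi>sq: "(norm (\<phi> x))\<^sup>2 \<le> \<kappa>\<^sup>2" for x
    using scalar_rkhs_feature(2)[OF H, of x x] kb[of x] by (simp add: \<phi> power2_norm_eq_inner)
  then have \<phi>\<kappa>: "norm (\<phi> x) \<le> \<kappa>" for x using \<kappa> by (metis power2_le_imp_le)
  \<comment> \<open>Change of measure: weighting by \<beta> turns expectations under p into
    expectations under the target marginal, so the weighted empirical covariance is unbiased for
    \<open>C\<^sub>X\<close>.\<close>
  have trans: "(\<integral>z. \<beta> (fst z) * f (fst z) \<partial>p) = (\<integral>x. f x \<partial>marginal_X q)"
    if f: "f \<in> borel_measurable borel" for f :: "'x \<Rightarrow> real"
  proof -
    have m: "f \<in> borel_measurable (marginal_X p)" "\<beta> \<in> borel_measurable (marginal_X p)"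
      using f \<beta>m measurable_cong_sets[OF pX(2) refl] by blast+
    have "(\<integral>x. f x \<partial>marginal_X q) = (\<integral>x. \<beta> x *\<^sub>R f x \<partial>marginal_X p)"
      unfolding dens by (rule integral_density[OF m]) (simp add: \<beta>)
    also have "\<dots> = (\<integral>z. \<beta> (fst z) *\<^sub>R f (fst z) \<partial>p)"
      unfolding marginal_X_def by (rule integral_distr[OF fst_p]) (use f \<beta>m in simp)
    finally show ?thesis by simp
  qed
  \<comment> \<open>\<beta> has mean 1 under p. Hence \<kappa>^2 <= b \<kappa>^2 <= s, and the
    population eigenvalues lie in the range of the covering condition.\<close>
  have "1 \<le> b"
  proof -
    interpret qX: prob_space "marginal_X q" by (rule qX(1))
    have "1 = (\<integral>z. \<beta> (fst z) * 1 \<partial>p)" using trans[of "\<lambda>_. 1"] by (simp add: qX.prob_space)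
    also have "\<dots> \<le> (\<integral>z. b \<partial>p)"
    proof (rule integral_mono)
      show "integrable p (\<lambda>z. \<beta> (fst z) * 1)"
        by (rule p.integrable_const_bound[where B = b]) (use \<beta> measurable_compose[OF fst_p \<beta>m] in auto)
    qed (use \<beta> in auto)
    finally show ?thesis by (simp add: p.prob_space)
  qed
  then have b: "0 \<le> b" and \<kappa>s: "\<kappa>\<^sup>2 \<le> s"
    using mult_right_mono[of 1 b "\<kappa>\<^sup>2"] bs by auto
  have Cp: "positive_trace_class C\<^sub>X (\<kappa>\<^sup>2)"
    unfolding C by (rule cov_op_positive_trace_class[OF qX \<phi>m \<phi>\<kappa>])
  interpret C: positive_trace_class C\<^sub>X "\<kappa>\<^sup>2" by (rule Cp)
  let ?E = "eigenbasis C\<^sub>X" and ?Y = "some_onb :: 'y set"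
  have C_int: "C\<^sub>X u \<bullet> v = (\<integral>z. \<beta> (fst z) * (\<phi> (fst z) \<bullet> v) * (\<phi> (fst z) \<bullet> u) \<partial>p)" for u v
  proof -
    have "C\<^sub>X u \<bullet> v = (\<integral>x. (\<phi> x \<bullet> v) * (\<phi> x \<bullet> u) \<partial>marginal_X q)"
      unfolding C cov_op_inner[OF qX \<phi>m \<phi>\<kappa>] by (simp add: inner_commute mult.commute)
    also have "\<dots> = (\<integral>z. \<beta> (fst z) * ((\<phi> (fst z) \<bullet> v) * (\<phi> (fst z) \<bullet> u)) \<partial>p)"
      by (rule trans[symmetric]) (use \<phi>m in measurable)
    finally show ?thesis by (simp add: mult.assoc)
  qed
  have onE: "orthonormal ?E" and onY: "orthonormal ?Y"
    by (rule is_onb_orthonormal[OF C.onb] is_onb_orthonormal[OF some_onb])+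
  have cE: "countable ?E" and cY: "countable ?Y"
    by (rule orthonormal_countable[OF onE] orthonormal_countable[OF onY])+
  have \<phi>p: "(\<lambda>z. \<phi> (fst z)) \<in> borel_measurable p" and \<beta>p: "(\<lambda>z. \<beta> (fst z)) \<in> borel_measurable p"
    by (rule measurable_compose[OF fst_p \<phi>m] measurable_compose[OF fst_p \<beta>m])+
  have \<phi>e: "(\<lambda>z. \<phi> (fst z) \<bullet> e) \<in> borel_measurable p" for e
    using \<phi>p by (intro borel_measurable_inner) auto
  have Csm: "(\<lambda>x. Cstar (\<phi> x)) \<in> borel_measurable borel"
    by (rule measurable_compose[OF \<phi>m borel_measurable_continuous_onI])
      (intro linear_continuous_on blinfun.bounded_linear_right)
  have \<mu>0: "0 \<le> C\<^sub>X e \<bullet> e" for e by (rule C.pos)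
  have \<mu>_int: "(\<integral>z. \<beta> (fst z) * (\<phi> (fst z) \<bullet> e)\<^sup>2 \<partial>p) = C\<^sub>X e \<bullet> e" for e
    by (simp add: C_int power2_eq_square mult.assoc)
  have N_le: "(\<Sum>e\<in>S. C\<^sub>X e \<bullet> e / (C\<^sub>X e \<bullet> e + lam)) \<le> N" if S: "finite S" "S \<subseteq> ?E" for S
    unfolding N_def using finite_sum_le_has_sum[OF C.eff_dim_has_sum[OF lam(1)] S] C.ev_nonneg lam
    by (simp add: C.ev_def)
  have N0: "0 \<le> N" using N_le[of "{}"] by simp
  have hsC: "hilbert_schmidt Cstar"
    unfolding Cstar by (rule hilbert_schmidt_compose_op_fun[OF Cp \<psi> hs])
  have Cst: "norm (Cstar (\<phi> x)) \<le> \<kappa> * hs_norm Cstar" for x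
    using hs_norm_bound[OF hsC, of "\<phi> x"] mult_left_mono[OF \<phi>\<kappa>[of x] hs_norm_nonneg[of Cstar]]
    by (simp add: mult.commute)
  have M: "M = M' + \<kappa> * hs_norm Cstar" using assms by blast
  have yM': "AE z in p. norm (snd z) \<le> M'" using yM by (simp add: case_prod_beta')
  have uM: "AE z in p. norm (Cstar (\<phi> (fst z)) - snd z) \<le> M"
    using yM'
  proof eventually_elim
    case (elim z)
    then show ?case
      using norm_triangle_ineq4[of "Cstar (\<phi> (fst z))" "snd z"] Cst[of "fst z"] by (simp add: M)
  qed
  \<comment> \<open>An almost sure upper bound of a norm on a probability space is
    nonnegative.\<close>
  have M0: "0 \<le> M"
  proof -
    have "AE z in p. 0 \<le> M" using uM by eventually_elim (metis norm_ge_zero order_trans)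
    then show ?thesis by simp
  qed
  have uw: "(\<lambda>z. (Cstar (\<phi> (fst z)) - snd z) \<bullet> w) \<in> borel_measurable p" for w
    using measurable_compose[OF fst_p Csm] snd_p by (intro borel_measurable_inner borel_measurable_diff) auto

  obtain \<epsilon>\<^sub>1 \<epsilon>\<^sub>2 where \<epsilon>: "\<epsilon>\<^sub>1 + \<epsilon>\<^sub>2 \<le> \<delta>"
    "2 * exp (1 - 2 * 1 * L) \<le> \<epsilon>\<^sub>1 \<or> 1 / (2 * 1 * L)\<^sup>2 \<le> \<epsilon>\<^sub>1"
    "2 * exp (1 - 2 * (sqrt 5 / 2) * L) \<le> \<epsilon>\<^sub>2 \<or> 1 / (2 * (sqrt 5 / 2) * L)\<^sup>2 \<le> \<epsilon>\<^sub>2"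
    using split_confidence[OF \<delta>] unfolding L_def[symmetric] by blast
  let ?P = "Pi\<^sub>M {..<n} (\<lambda>_. p)"
  interpret P: prob_space ?P by (rule prob_space_PiM) (rule p(1))
  define T\<^sub>1 where "T\<^sub>1 = 2 * (2 * (b * \<kappa> * \<kappa> / sqrt lam) / n + sqrt (b * \<kappa>\<^sup>2 * N) / sqrt n) * L"
  define T\<^sub>2 where "T\<^sub>2 = sqrt 5 / 2 * (2 * (2 * (b * M * \<kappa> / sqrt lam) / n + sqrt (b * M\<^sup>2 * N) / sqrt n) * L)"
  obtain \<Omega>\<^sub>1 where \<Omega>1: "\<Omega>\<^sub>1 \<in> sets ?P" "1 - \<epsilon>\<^sub>1 \<le> measure ?P \<Omega>\<^sub>1"
    and ev1: "\<forall>z\<in>\<Omega>\<^sub>1. \<forall>J. finite J \<and> J \<subseteq> ?E \<times> ?E \<longrightarrow>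
      (\<Sum>i\<in>J. ((1 / real n) * (\<Sum>j<n. (case i of (w, e) \<Rightarrow> \<lambda>z. \<beta> (fst z) * (\<phi> (fst z) \<bullet> w) * (\<phi> (fst z) \<bullet> e)) (z j))
        - (\<integral>z. (case i of (w, e) \<Rightarrow> \<lambda>z. \<beta> (fst z) * (\<phi> (fst z) \<bullet> w) * (\<phi> (fst z) \<bullet> e)) z \<partial>p))\<^sup>2
        / (C\<^sub>X (snd i) \<bullet> snd i + lam)) \<le> T\<^sub>1\<^sup>2"
    using p.weighted_tensor_deviation[OF \<beta>p \<phi>e \<phi>e \<beta> AE_I2[OF \<phi>\<kappa>] \<phi>\<kappa> \<kappa> cE onE cE onE \<mu>0 \<mu>_int N_le lam(1) n L0
        zero_less_one \<epsilon>(2)]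
    unfolding mult_1 T\<^sub>1_def[symmetric] by blast
  have a0: "0 < sqrt 5 / 2" by simp
  obtain \<Omega>\<^sub>2 where \<Omega>2: "\<Omega>\<^sub>2 \<in> sets ?P" "1 - \<epsilon>\<^sub>2 \<le> measure ?P \<Omega>\<^sub>2"
    and ev2: "\<forall>z\<in>\<Omega>\<^sub>2. \<forall>J. finite J \<and> J \<subseteq> ?Y \<times> ?E \<longrightarrow>
      (\<Sum>i\<in>J. ((1 / real n) * (\<Sum>j<n. (case i of (w, e) \<Rightarrow> \<lambda>z. \<beta> (fst z) * ((Cstar (\<phi> (fst z)) - snd z) \<bullet> w) * (\<phi> (fst z) \<bullet> e)) (z j))
        - (\<integral>z. (case i of (w, e) \<Rightarrow> \<lambda>z. \<beta> (fst z) * ((Cstar (\<phi> (fst z)) - snd z) \<bullet> w) * (\<phi> (fst z) \<bullet> e)) z \<partial>p))\<^sup>2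
        / (C\<^sub>X (snd i) \<bullet> snd i + lam)) \<le> T\<^sub>2\<^sup>2"
    using p.weighted_tensor_deviation[OF \<beta>p uw \<phi>e \<beta> uM \<phi>\<kappa> M0 cY onY cE onE \<mu>0 \<mu>_int N_le lam(1) n L0 a0 \<epsilon>(3)]
    unfolding T\<^sub>2_def[symmetric] by blast
  \<comment> \<open>Here the regression function enters: the expectation subtracted in the second
    event is 0, so that event bounds the noise itself.\<close>
  have noise0: "(\<integral>z. \<beta> (fst z) * ((Cstar (\<phi> (fst z)) - snd z) \<bullet> w) * (\<phi> (fst z) \<bullet> e) \<partial>p) = 0" for w e
  proof -
    have "(\<integral>z. (\<beta> (fst z) * (\<phi> (fst z) \<bullet> e)) * ((Cstar (\<phi> (fst z)) - snd z) \<bullet> w) \<partial>p) = 0"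
    proof (rule noise_centred[OF cs yM, where h = "\<lambda>x. \<beta> x * (\<phi> x \<bullet> e)" and c = "\<lambda>x. Cstar (\<phi> x)" and K = "b * (\<kappa> * norm e)"])
      show "(\<lambda>x. \<beta> x * (\<phi> x \<bullet> e)) \<in> borel_measurable borel" using \<beta>m \<phi>m by measurable
      show "\<bar>\<beta> x * (\<phi> x \<bullet> e)\<bar> \<le> b * (\<kappa> * norm e)" for x
      proof -
        have "\<bar>\<phi> x \<bullet> e\<bar> \<le> \<kappa> * norm e"
          using Cauchy_Schwarz_ineq2 mult_right_mono[OF \<phi>\<kappa> norm_ge_zero] by (rule order_trans)
        then show ?thesis unfolding abs_mult using \<beta> b by (intro mult_mono) auto
      qed
      show "Cstar (\<phi> x) = regression_fun \<rho> x" for x by (simp add: regr)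
    qed (rule Csm Cst)+
    then show ?thesis by (simp add: mult_ac)
  qed
  have T1: "0 \<le> T\<^sub>1" unfolding T\<^sub>1_def using b \<kappa> N0 L0 lam by simp
  have T2: "0 \<le> T\<^sub>2" unfolding T\<^sub>2_def using b \<kappa> N0 L0 lam M0 by simp
  \<comment> \<open>\<open>T\<^sub>1\<close> is exactly \<open>\<B>\<close> times ln (2 / \<delta>),
    so this is the smallness hypothesis of the theorem.\<close>
  have T1_le: "T\<^sub>1 \<le> sqrt lam / 2"
  proof -
    have "\<B> = 2 * (2 * b * \<kappa>\<^sup>2 / (sqrt lam * real n) + sqrt (b * \<kappa>\<^sup>2 * N / real n))" using assms by (simp add: N_def)
    then have "T\<^sub>1 = \<B> * L" by (simp add: T\<^sub>1_def power2_eq_square real_sqrt_divide)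
    moreover have "\<B> * ln (2 / \<delta>) \<le> sqrt lam / 2" using assms by blast
    ultimately show ?thesis by (simp add: L_def)
  qed
  have bound: "(\<lambda>x. regression_fun \<rho> x - estimator g lam n \<beta> \<phi> z x) \<in> range repG \<and>
      rkhs_norm repG (\<lambda>x. regression_fun \<rho> x - estimator g lam n \<beta> \<phi> z x)
        \<le> (A\<^sub>1 / (real n * lam) + A\<^sub>2 * sqrt (eff_dim C\<^sub>X lam / (real n * lam))) * ln (2 / \<delta>) + A\<^sub>3 * \<psi> lam"
    if z: "z \<in> \<Omega>\<^sub>1 \<inter> \<Omega>\<^sub>2" for z
  proof -
    let ?Ch = "emp_cov_X n \<beta> \<phi> z"
    have 1: "(\<Sum>(e', e)\<in>J. ((?Ch e - C\<^sub>X e) \<bullet> e')\<^sup>2 / (C\<^sub>X e \<bullet> e + lam)) \<le> T\<^sub>1\<^sup>2"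
      if J: "finite J" "J \<subseteq> ?E \<times> ?E" for J
    proof -
      have "(?Ch e - C\<^sub>X e) \<bullet> w = (1 / real n) * (\<Sum>j<n. \<beta> (fst (z j)) * (\<phi> (fst (z j)) \<bullet> w) * (\<phi> (fst (z j)) \<bullet> e))
          - (\<integral>z. \<beta> (fst z) * (\<phi> (fst z) \<bullet> w) * (\<phi> (fst z) \<bullet> e) \<partial>p)" for w e
        unfolding inner_diff_left C_int emp_cov_X_inner by (simp add: inner_commute mult_ac)
      then show ?thesis
        using ev1[rule_format, of z J] J z by (simp add: case_prod_beta')
    qed
    have 2: "(\<Sum>(y, e)\<in>J. ((1 / real n) * (\<Sum>i<n. \<beta> (fst (z i)) * ((Cstar (\<phi> (fst (z i))) - snd (z i)) \<bullet> y) * (\<phi> (fst (z i)) \<bullet> e)))\<^sup>2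
          / (C\<^sub>X e \<bullet> e + lam)) \<le> T\<^sub>2\<^sup>2"
      if J: "finite J" "J \<subseteq> ?Y \<times> ?E" for J
      using ev2[rule_format, of z J] J z by (simp add: case_prod_beta' noise0)
    have "real_of_int \<lfloor>\<nu>\<rfloor> \<le> \<nu>" "0 \<le> real_of_int \<lfloor>\<nu>\<rfloor>" using \<nu> by auto
    note fl = this
    have \<Gamma>: "0 \<le> \<gamma>\<^sub>\<nu> + \<gamma>"
      using qualification_constant_nonneg[OF qb lam] regularization_gamma_ge_1[OF reg lam] by linarith
    note main = estimator_error_bound[OF H G \<phi> Cp \<kappa>s \<beta> \<phi>sq n bs reg qb \<nu> lam T1 T1_le T2 \<psi> cov hs Cstar 1 2]
    have "2 powr \<nu> * (\<gamma>\<^sub>\<nu> + \<gamma>) * (2 powr (\<nu> - of_int \<lfloor>\<nu>\<rfloor>) * (max 1 (1 / c) * \<psi> lam * hs_norm C\<^sub>o)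
          + of_int \<lfloor>\<nu>\<rfloor> * (T\<^sub>1 / sqrt lam) * hs_norm Cstar) + (B + D) / lam * sqrt (2 * lam) * T\<^sub>2
      \<le> (A\<^sub>1 / (real n * lam) + A\<^sub>2 * sqrt (N / (real n * lam))) * L + A\<^sub>3 * \<psi> lam"
      unfolding T\<^sub>1_def T\<^sub>2_def assms(31) assms(33) assms(34) assms(35)
      by (rule assemble_constants[OF n lam(1) b \<kappa> N0 M0 less_imp_le[OF L0] \<Gamma> hs_norm_nonneg fl(2,1)]) simp
    with main show ?thesis unfolding regr N_def L_def by linarith
  qed
  have "1 - \<delta> \<le> measure ?P (\<Omega>\<^sub>1 \<inter> \<Omega>\<^sub>2)"
  proof -
    have "measure ?P (\<Omega>\<^sub>1 \<union> \<Omega>\<^sub>2) = measure ?P \<Omega>\<^sub>1 + measure ?P \<Omega>\<^sub>2 - measure ?P (\<Omega>\<^sub>1 \<inter> \<Omega>\<^sub>2)"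
      by (rule measure_Un3) (use \<Omega>1 \<Omega>2 P.fmeasurable_eq_sets in auto)
    moreover have "measure ?P (\<Omega>\<^sub>1 \<union> \<Omega>\<^sub>2) \<le> 1" by (rule P.prob_le_1)
    ultimately show ?thesis using \<Omega>1 \<Omega>2 \<epsilon>(1) by linarith
  qed
  then show ?thesis
    using \<Omega>1(1) \<Omega>2(1) bound by (intro bexI[of _ "\<Omega>\<^sub>1 \<inter> \<Omega>\<^sub>2"]) blast+
qed

end
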